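(* Consider the TSP instance $G_1$ on $V=\{1,\dots,n\}$ with $d(\{i,i+1\})=1$ for $i=1,\dots,n-1$, $d(\{n,1\})=1$, and $d(e)=n$ for all other edges; its unique optimal Hamiltonian cycle is $s^*=(1,2,\dots,n)$. Run the cross-entropy algorithm described in the context (with $M=1$, $\rho=1$, $\pi_{\min}=\frac{1}{n(n-2)}$, $\pi_{\max}=1-\frac1n$) with a sample size $N\in\Omega(n^{\epsilon})$ for some constant $\epsilon\in(0,1)$. Then, as $n\to\infty$: (a) with the vertex-based random solution generation, the algorithm finds $s^*$ within $n^6$ iterations with probability $1-e^{-\Omega(N)}$; (b) with the edge-based random solution generation, the algorithm finds $s^*$ within $n^3\ln n$ iterations with probability $1-e^{-\Omega(N)}$.
   Context: Let $K_n$ be the complete graph on $V=\{1,\dots,n\}$ with edge set $E$ of all 2-element subsets. A feasible solution is a Hamiltonian cycle of $K_n$; its cost $f(s)$ is the sum of $d$ over its $n$ edges. For a Hamiltonian cycle $H$, let $\Pi^H=(\pi_{i,j})$ be the symmetric $n\times n$ matrix with $\pi_{i,i}=0$, $\pi_{i,j}=\pi_{\max}=1-\frac1n$ if $\{i,j\}\in H$ and $\pi_{i,j}=\pi_{\min}=\frac{1}{n(n-2)}$ otherwise. Vertex-based generation from $\Pi$: pick a start vertex uniformly at random; while unvisited vertices remain, from the current vertex $v$ move to an unvisited $v'$ chosen with probability $\pi_{v,v'}/\sum_{k\text{ unvisited}}\pi_{v,k}$; output the resulting Hamiltonian cycle. Edge-based generation from $\Pi$: start with $B=\emptyset$ and repeatedly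 add an edge $\{i,j\}\notin B$ chosen among admissible edges with probability proportional to $\pi_{i,j}+\pi_{j,i}$, until $B$ is a Hamiltonian cycle; an edge is admissible if adding it creates no vertex of degree $\ge3$ and no cycle with fewer than $n$ edges. The algorithm: $\Pi_0$ has all off-diagonal entries $\frac1{n-1}$. In iteration $t=0,1,2,\dots$, generate $N$ independent solutions from $\Pi_t$, let $X_t^{[1]}$ be one of minimum cost, and set $\Pi_{t+1}=\Pi^{X_t^{[1]}}$. The optimal solution is found within $T$ iterations if $X_t^{[1]}$ is optimal for some $t\le T$. Asymptotics are as $n\to\infty$ with $N=N(n)$. *)

theory Defs
  imports "HOL-Probability.Probability" "HOL-Library.Landau_Symbols"
begin

definition Kn_edges :: "nat \<Rightarrow> nat set set" where
  "Kn_edges n = {{i, j} | i j. i \<in> {1..n} \<and> j \<in> {1..n} \<and> i \<noteq> j}"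

definition cycle_edges :: "nat list \<Rightarrow> nat set set" where
  "cycle_edges vs = {{vs ! i, vs ! (Suc i mod length vs)} | i. i < length vs}"

definition is_cycle :: "nat set set \<Rightarrow> bool" where
  "is_cycle C \<longleftrightarrow> (\<exists>vs. distinct vs \<and> length vs \<ge> 3 \<and> C = cycle_edges vs)"

definition hamiltonian_cycle :: "nat \<Rightarrow> nat set set \<Rightarrow> bool" where
  "hamiltonian_cycle n H \<longleftrightarrow> (\<exists>vs. distinct vs \<and> set vs = {1..n} \<and> n \<ge> 3 \<and> H = cycle_edges vs)"

definition degree :: "nat set set \<Rightarrow> nat \<Rightarrow> nat" where
  "degree B v = card {e \<in> B. v \<in> e}"

definition d_G1 :: "nat \<Rightarrow> nat set \<Rightarrow> real" where
  "d_G1 n e = (if e \<in> {{i, i + 1} | i. 1 \<le> i \<and> i \<le> n - 1} \<or> e = {n, 1} then 1 else real n)"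

definition cost :: "nat \<Rightarrow> nat set set \<Rightarrow> real" where
  "cost n H = (\<Sum>e\<in>H. d_G1 n e)"

definition optimal :: "nat \<Rightarrow> nat set set \<Rightarrow> bool" where
  "optimal n H \<longleftrightarrow> hamiltonian_cycle n H \<and> (\<forall>H'. hamiltonian_cycle n H' \<longrightarrow> cost n H \<le> cost n H')"

definition pi_max :: "nat \<Rightarrow> real" where "pi_max n = 1 - 1 / real n"
definition pi_min :: "nat \<Rightarrow> real" where "pi_min n = 1 / (real n * (real n - 2))"

definition Pi_of :: "nat \<Rightarrow> nat set set \<Rightarrow> nat \<Rightarrow> nat \<Rightarrow> real" where
  "Pi_of n H i j = (if i = j then 0 else if {i, j} \<in> H then pi_max n else pi_min n)"

definition Pi0 :: "nat \<Rightarrow> nat \<Rightarrow> nat \<Rightarrow> real" where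
  "Pi0 n i j = (if i = j then 0 else 1 / (real n - 1))"

definition wchoice :: "('a \<Rightarrow> real) \<Rightarrow> 'a set \<Rightarrow> 'a pmf" where
  "wchoice w A = embed_pmf (\<lambda>x. if x \<in> A then w x / (\<Sum>y\<in>A. w y) else 0)"

fun vpath :: "(nat \<Rightarrow> nat \<Rightarrow> real) \<Rightarrow> nat \<Rightarrow> nat \<Rightarrow> nat set \<Rightarrow> nat list pmf" where
  "vpath P 0 v U = return_pmf [v]"
| "vpath P (Suc k) v U =
     bind_pmf (wchoice (\<lambda>v'. P v v') U) (\<lambda>v'.
     bind_pmf (vpath P k v' (U - {v'})) (\<lambda>p. return_pmf (v # p)))"

definition vertex_gen :: "nat \<Rightarrow> (nat \<Rightarrow> nat \<Rightarrow> real) \<Rightarrow> nat set set pmf" where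
  "vertex_gen n P =
     bind_pmf (pmf_of_set {1..n}) (\<lambda>v.
     map_pmf cycle_edges (vpath P (n - 1) v ({1..n} - {v})))"

definition admissible :: "nat \<Rightarrow> nat set set \<Rightarrow> nat set \<Rightarrow> bool" where
  "admissible n B e \<longleftrightarrow> e \<in> Kn_edges n \<and> e \<notin> B \<and>
     (\<forall>v. degree (insert e B) v \<le> 2) \<and>
     \<not> (\<exists>C \<subseteq> insert e B. is_cycle C \<and> card C < n)"

definition edge_weight :: "(nat \<Rightarrow> nat \<Rightarrow> real) \<Rightarrow> nat set \<Rightarrow> real" where
  "edge_weight P e = (\<Sum>i\<in>e. \<Sum>j\<in>e - {i}. P i j)"

text \<open>At most k further edges are added (n additions always suffice).\<close>
fun egen :: "nat \<Rightarrow> (nat \<Rightarrow> nat \<Rightarrow> real) \<Rightarrow> nat \<Rightarrow> nat set set \<Rightarrow> nat set set pmf" where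
  "egen n P 0 B = return_pmf B"
| "egen n P (Suc k) B =
     (if hamiltonian_cycle n B then return_pmf B
      else bind_pmf (wchoice (edge_weight P) {e. admissible n B e}) (\<lambda>e. egen n P k (insert e B)))"

definition edge_gen :: "nat \<Rightarrow> (nat \<Rightarrow> nat \<Rightarrow> real) \<Rightarrow> nat set set pmf" where
  "edge_gen n P = egen n P n {}"

fun samples :: "nat \<Rightarrow> 'a pmf \<Rightarrow> 'a list pmf" where
  "samples 0 g = return_pmf []"
| "samples (Suc k) g = bind_pmf g (\<lambda>x. bind_pmf (samples k g) (\<lambda>xs. return_pmf (x # xs)))"

definition valid_selector :: "(nat \<Rightarrow> nat set set list \<Rightarrow> nat set set) \<Rightarrow> bool" where
  "valid_selector sel \<longleftrightarrow> (\<forall>n xs. xs \<noteq> [] \<longrightarrow>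
      sel n xs \<in> set xs \<and> (\<forall>y\<in>set xs. cost n (sel n xs) \<le> cost n y))"

fun run :: "(nat \<Rightarrow> (nat \<Rightarrow> nat \<Rightarrow> real) \<Rightarrow> nat set set pmf) \<Rightarrow>
            (nat \<Rightarrow> nat set set list \<Rightarrow> nat set set) \<Rightarrow> nat \<Rightarrow> nat \<Rightarrow> nat \<Rightarrow>
            (nat \<Rightarrow> nat \<Rightarrow> real) \<Rightarrow> nat set set list pmf" where
  "run gen sel n N 0 P = map_pmf (\<lambda>x. [x]) (map_pmf (sel n) (samples N (gen n P)))"
| "run gen sel n N (Suc T) P =
     bind_pmf (map_pmf (sel n) (samples N (gen n P))) (\<lambda>x.
     map_pmf (\<lambda>xs. x # xs) (run gen sel n N T (Pi_of n x)))"

definition found_prob :: "(nat \<Rightarrow> (nat \<Rightarrow> nat \<Rightarrow> real) \<Rightarrow> nat set set pmf) \<Rightarrow>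
            (nat \<Rightarrow> nat set set list \<Rightarrow> nat set set) \<Rightarrow> nat \<Rightarrow> nat \<Rightarrow> nat \<Rightarrow> real" where
  "found_prob gen sel n N T =
     measure_pmf.prob (run gen sel n N T (Pi0 n)) {xs. \<exists>x\<in>set xs. optimal n x}"

end

theory Submission
  imports Defs "HOL-Real_Asymp.Real_Asymp"
begin

text \<open>
  Let the level of a tour be the number of its edges outside the optimal tour; the cost is an increasing
  function of the level. A tour is resampled from its own matrix with constant probability, so with
  \<open>N\<close> samples the level increases in a given iteration only with probability \<open>exp (- \<Omega>(N))\<close>, which
  absorbs a union bound over polynomially many iterations. It remains to bound from below the probability
  that a single sample decreases the level \<open>j\<close>.

  Every edge of the optimal tour that is missing in \<open>H\<close> can be inserted at the expense of two or three bad
  edges, by an exchange of at most three edges. Vertex-based generation follows \<open>H\<close> except for at most two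
  steps, when it starts at a new edge; this gives \<open>\<Omega>(n^(-5))\<close>. In edge-based generation a
  missing edge \<open>f\<close> is chosen before its competing bad edges with probability \<open>\<Omega>(n^(-2))\<close>. Afterwards the bad
  edges at its endpoints get blocked by the degree constraint with constant probability, and the third bad edge
  by the cycle constraint if it comes last on the cycle closed by \<open>f\<close>, hence with probability at least \<open>1/n\<close>.
  The \<open>j\<close> missing edges give disjoint events, hence \<open>\<Omega>(j / n^3)\<close>. Allotting to level \<open>j\<close> a number of
  iterations inversely proportional to these bounds, the harmonic sum yields the total of \<open>n^3 ln n\<close>.
\<close>

section \<open>Paths and cycles\<close>

text \<open>The time bounds do not depend on \<open>N\<close>: \<open>b\<close> iterations at level
  \<open>j\<close> draw \<open>b * N\<close> samples, and all of them miss with probability at most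
  \<open>exp (- q j * b * N)\<close>. So it suffices that \<open>q j * b\<close> stays above a
  constant, and constant factors in \<open>q j\<close> affect only the rate in the exponent. The
  obstacle in the edge-based case is the random order of insertion, in which every choice may fall
  outside \<open>H\<close>. Such an edge has relative weight \<open>zeta n\<close>, about
  \<open>n^(-2)\<close>, and with \<open>r\<close> edges missing there are \<open>O(r^2)\<close> of
  them against at least \<open>r / 3\<close> admissible edges of \<open>H\<close>. The fraction of
  weight lost is \<open>O(zeta n * r)\<close>, which sums to a constant over all \<open>r\<close>.
  Up to this constant factor, the choice is uniform over the admissible edges of \<open>H\<close>.
  Instead of enumerating orders, each partial tour is given a value that does not decrease on
  average under this uniform choice.\<close>

fun path_edges :: "'a list \<Rightarrow> 'a set set" where
  "path_edges (x # y # zs) = insert {x, y} (path_edges (y # zs))"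
| "path_edges _ = {}"

lemma path_edges_Cons: "ys \<noteq> [] \<Longrightarrow> path_edges (x # ys) = insert {x, hd ys} (path_edges ys)"
  by (cases ys) auto

lemma path_edges_append:
  "xs \<noteq> [] \<Longrightarrow> ys \<noteq> [] \<Longrightarrow>
   path_edges (xs @ ys) = insert {last xs, hd ys} (path_edges xs \<union> path_edges ys)"
  by (induction xs rule: path_edges.induct) (auto simp: path_edges_Cons)

lemma path_edges_rev: "path_edges (rev xs) = path_edges xs"
proof (induction xs)
  case (Cons x xs)
  then show ?case
    by (cases "xs = []") (auto simp: path_edges_append path_edges_Cons last_rev insert_commute)
qed simp

lemma path_edges_conv_nth: "path_edges xs = (\<lambda>i. {xs ! i, xs ! Suc i}) ` {..<length xs - 1}"
proof (induction xs rule: path_edges.induct)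
  case (1 x y zs)
  have "(\<lambda>i. {(x # y # zs) ! i, (x # y # zs) ! Suc i}) ` {..<length (x # y # zs) - 1}
        = insert {x, y} ((\<lambda>i. {(y # zs) ! i, (y # zs) ! Suc i}) ` {..<length (y # zs) - 1})"
    by (simp add: lessThan_Suc_eq_insert_0 image_image)
  with 1 show ?case by simp
qed auto

lemma cycle_edges_conv_path: "xs \<noteq> [] \<Longrightarrow> cycle_edges xs = insert {last xs, hd xs} (path_edges xs)"
proof -
  assume ne: "xs \<noteq> []"
  define m where "m = length xs - 1"
  have m: "length xs = Suc m" using ne by (cases xs) (auto simp: m_def)
  have "cycle_edges xs = (\<lambda>i. {xs ! i, xs ! (Suc i mod length xs)}) ` {..<Suc m}"
    by (auto simp: cycle_edges_def m)
  also have "\<dots> = insert {xs ! m, xs ! 0} ((\<lambda>i. {xs ! i, xs ! (Suc i mod length xs)}) ` {..<m})"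
    by (simp add: lessThan_Suc m)
  also have "(\<lambda>i. {xs ! i, xs ! (Suc i mod length xs)}) ` {..<m} = (\<lambda>i. {xs ! i, xs ! Suc i}) ` {..<m}"
    by (intro image_cong) (auto simp: m)
  finally show ?thesis
    using ne by (simp add: path_edges_conv_nth last_conv_nth hd_conv_nth m)
qed

lemma cycle_edges_rev: "cycle_edges (rev xs) = cycle_edges xs"
  by (cases "xs = []") (auto simp: cycle_edges_conv_path path_edges_rev last_rev hd_rev insert_commute)

lemma cycle_edges_append:
  "xs \<noteq> [] \<Longrightarrow> ys \<noteq> [] \<Longrightarrow> cycle_edges (xs @ ys) =
     {{last xs, hd ys}, {last ys, hd xs}} \<union> path_edges xs \<union> path_edges ys"
  by (auto simp: cycle_edges_conv_path path_edges_append)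

lemma cycle_edges_append_commute: "cycle_edges (xs @ ys) = cycle_edges (ys @ xs)"
  by (cases "xs = []"; cases "ys = []") (auto simp: cycle_edges_append)

lemma path_edges_subset_cycle_edges: "path_edges xs \<subseteq> cycle_edges xs"
  by (cases "xs = []") (auto simp: cycle_edges_conv_path)

lemma path_edges_in_set: "e \<in> path_edges xs \<Longrightarrow> e \<subseteq> set xs"
  by (induction xs rule: path_edges.induct) auto

lemma cycle_edges_in_set: "e \<in> cycle_edges xs \<Longrightarrow> e \<subseteq> set xs"
proof (cases "xs = []")
  case True
  then show "e \<in> cycle_edges xs \<Longrightarrow> e \<subseteq> set xs" by (simp add: cycle_edges_def)
next
  case False
  then show "e \<in> cycle_edges xs \<Longrightarrow> e \<subseteq> set xs"
    using path_edges_in_set[of e xs] by (auto simp: cycle_edges_conv_path)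
qed

lemma finite_path_edges [simp]: "finite (path_edges xs)"
  by (induction xs rule: path_edges.induct) auto

lemma finite_cycle_edges [simp]: "finite (cycle_edges xs)"
  by (cases "xs = []") (auto simp: cycle_edges_conv_path, simp add: cycle_edges_def)

lemma card_path_edges: "distinct xs \<Longrightarrow> card (path_edges xs) = length xs - 1"
proof (induction xs rule: path_edges.induct)
  case (1 x y zs)
  have "{x, y} \<notin> path_edges (y # zs)"
    using 1(2) path_edges_in_set[of "{x, y}" "y # zs"] by auto
  with 1 show ?case by simp
qed auto

lemma path_edges_ex: "e \<in> path_edges xs \<Longrightarrow> \<exists>ys zs. xs = ys @ zs \<and> ys \<noteq> [] \<and> zs \<noteq> [] \<and> e = {last ys, hd zs}"
proof (induction xs rule: path_edges.induct)
  case (1 x y zs)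
  then consider "e = {x, y}" | "e \<in> path_edges (y # zs)" by auto
  then show ?case
  proof cases
    case 1
    then show ?thesis by (intro exI[of _ "[x]"] exI[of _ "y # zs"]) auto
  next
    case 2
    with 1 obtain ys zs' where "y # zs = ys @ zs'" "ys \<noteq> []" "zs' \<noteq> []" "e = {last ys, hd zs'}" by blast
    then show ?thesis by (intro exI[of _ "x # ys"] exI[of _ zs']) auto
  qed
qed auto

text \<open>An edge of the path cuts \<open>xs\<close> into two parts and joins the end of the first
  to the start of the second. If it also joined \<open>last xs\<close> to \<open>hd xs\<close>, both
  parts would be singletons.\<close>

lemma last_hd_notin_path_edges:
  assumes "distinct xs" "length xs \<ge> 3"
  shows "{last xs, hd xs} \<notin> path_edges xs"
proof
  assume "{last xs, hd xs} \<in> path_edges xs"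
  then obtain ys zs where *: "xs = ys @ zs" "ys \<noteq> []" "zs \<noteq> []" "{last xs, hd xs} = {last ys, hd zs}"
    using path_edges_ex by blast
  then have l: "last xs \<in> set zs" "hd xs \<in> set ys" "last ys \<in> set ys" "hd zs \<in> set zs" by auto
  have "set ys \<inter> set zs = {}" using assms * by auto
  then have "last xs \<noteq> last ys" using l by auto
  then have "last xs = hd zs" "hd xs = last ys" using *(4) by (auto simp: doubleton_eq_iff)
  then have "last zs = hd zs" "last ys = hd ys" using * by auto
  moreover have "distinct ys" "distinct zs" using * assms by auto
  ultimately have "length ys = 1" "length zs = 1" using *(2,3)
    by (cases ys; cases zs; fastforce split: if_splits)+
  then show False using assms * by simp
qed

lemma card_cycle_edges:
  assumes "distinct xs" "length xs \<ge> 3"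
  shows "card (cycle_edges xs) = length xs"
proof -
  have "xs \<noteq> []" using assms by auto
  then show ?thesis
    using assms by (simp add: cycle_edges_conv_path last_hd_notin_path_edges card_path_edges)
qed

lemma cycle_edges_card2:
  assumes "distinct xs" "length xs \<ge> 2" "e \<in> cycle_edges xs"
  shows "card e = 2"
proof -
  have "xs \<noteq> []" using assms by auto
  then have "e = {last xs, hd xs} \<or> e \<in> path_edges xs" using assms by (auto simp: cycle_edges_conv_path)
  then show ?thesis
  proof
    assume e: "e = {last xs, hd xs}"
    obtain x y ys where "xs = x # y # ys" using assms(2)
      by (cases xs rule: path_edges.cases) auto
    then have "last xs \<in> set (tl xs)" "hd xs \<notin> set (tl xs)" using assms by auto
    then have "last xs \<noteq> hd xs" by metis
    then show ?thesis using e by simp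
  next
    assume "e \<in> path_edges xs"
    then obtain ys zs where "xs = ys @ zs" "ys \<noteq> []" "zs \<noteq> []" "e = {last ys, hd zs}" using path_edges_ex by blast
    then have "last ys \<in> set ys" "hd zs \<in> set zs" "set ys \<inter> set zs = {}" using assms(1) by auto
    then have "last ys \<noteq> hd zs" by auto
    then show ?thesis using \<open>e = {last ys, hd zs}\<close> by simp
  qed
qed

lemma cycle_edges_at_hd:
  assumes "distinct (v # ws)" "length ws \<ge> 2"
  shows "{e \<in> cycle_edges (v # ws). v \<in> e} = {{v, hd ws}, {v, last ws}}" "hd ws \<noteq> last ws"
proof -
  have ne: "ws \<noteq> []" using assms by auto
  have "e \<in> path_edges ws \<Longrightarrow> v \<notin> e" for e using path_edges_in_set[of e ws] assms by auto
  then show "{e \<in> cycle_edges (v # ws). v \<in> e} = {{v, hd ws}, {v, last ws}}"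
    using ne by (auto simp: cycle_edges_conv_path path_edges_Cons)
  obtain x y ys where "ws = x # y # ys" using assms(2)
    by (cases ws rule: path_edges.cases) auto
  then show "hd ws \<noteq> last ws" using assms by auto
qed

lemma rotate_to:
  assumes "v \<in> set xs"
  obtains ws where "cycle_edges (v # ws) = cycle_edges xs" "set (v # ws) = set xs"
    "distinct xs \<longleftrightarrow> distinct (v # ws)" "length (v # ws) = length xs"
proof -
  obtain as bs where xs: "xs = as @ v # bs" using assms by (auto simp: in_set_conv_decomp)
  show thesis
    by (rule that[of "bs @ as"])
      (use cycle_edges_append_commute[of as "v # bs"] in \<open>auto simp: xs\<close>)
qed

lemma degree_cycle_edges:
  assumes "distinct xs" "length xs \<ge> 3"
  shows "degree (cycle_edges xs) v = (if v \<in> set xs then 2 else 0)"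
proof (cases "v \<in> set xs")
  case True
  then obtain ws where ws: "cycle_edges (v # ws) = cycle_edges xs" "set (v # ws) = set xs"
    "distinct xs \<longleftrightarrow> distinct (v # ws)" "length (v # ws) = length xs" using rotate_to by blast
  have "distinct (v # ws)" "length ws \<ge> 2" using ws assms by auto
  from cycle_edges_at_hd[OF this] show ?thesis using True
    by (simp add: degree_def flip: ws(1)) (metis card_2_iff doubleton_eq_iff)
next
  case False
  then have "{e \<in> cycle_edges xs. v \<in> e} = {}" using cycle_edges_in_set by blast
  then show ?thesis using False unfolding degree_def by simp
qed

text \<open>A cycle contained in a Hamiltonian cycle already contains both edges at each of its
  vertices, hence its vertex set is closed under passing to neighbours.\<close>

lemma cycle_in_cycle:
  assumes xs: "distinct xs" "length xs \<ge> 3" and ys: "distinct ys" "length ys \<ge> 3"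
    and sub: "cycle_edges ys \<subseteq> cycle_edges xs"
  shows "cycle_edges ys = cycle_edges xs"
proof -
  have same: "{e \<in> cycle_edges ys. v \<in> e} = {e \<in> cycle_edges xs. v \<in> e}" if "v \<in> set ys" for v
  proof (rule card_subset_eq)
    have "degree (cycle_edges ys) v = 2" using degree_cycle_edges[OF ys] that by simp
    moreover have "degree (cycle_edges ys) v \<le> degree (cycle_edges xs) v"
      unfolding degree_def using sub by (intro card_mono) auto
    ultimately show "card {e \<in> cycle_edges ys. v \<in> e} = card {e \<in> cycle_edges xs. v \<in> e}"
      using degree_cycle_edges[OF xs, of v] unfolding degree_def by (auto split: if_splits)
  qed (use sub in auto)
  have nb: "w \<in> set ys" if "v \<in> set ys" "{v, w} \<in> cycle_edges xs" for v w
    using same[OF that(1)] that cycle_edges_in_set[of "{v,w}" ys] by blast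
  obtain v where v: "v \<in> set ys" using ys by (cases ys) auto
  have "v \<in> set xs"
    using degree_cycle_edges[OF xs, of v] degree_cycle_edges[OF ys, of v] v same[OF v]
    unfolding degree_def by (auto split: if_splits)
  then obtain ws where ws: "cycle_edges (v # ws) = cycle_edges xs" "set (v # ws) = set xs"
    using rotate_to by metis
  have "set zs \<subseteq> set ys" if "path_edges (v # zs) \<subseteq> cycle_edges xs" for zs
    using that
  proof (induction zs rule: rev_induct)
    case (snoc z zs)
    have "path_edges (v # zs @ [z]) = insert {last (v # zs), z} (path_edges (v # zs))"
      using path_edges_append[of "v # zs" "[z]"] by simp
    with snoc have "set zs \<subseteq> set ys" "{last (v # zs), z} \<in> cycle_edges xs" by auto
    moreover have "last (v # zs) \<in> set ys"
      using v \<open>set zs \<subseteq> set ys\<close> last_in_set[of "v # zs"] by auto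
    ultimately show ?case using nb[of "last (v # zs)" z] by auto
  qed simp
  from this[of ws] have "set xs \<subseteq> set ys"
    using path_edges_subset_cycle_edges[of "v # ws"] ws v by auto
  moreover have "e \<in> cycle_edges ys" if "e \<in> cycle_edges xs" "v \<in> e" "v \<in> set ys" for e v
    using same[OF that(3)] that by blast
  moreover have "\<exists>v. v \<in> e" if "e \<in> cycle_edges xs" for e
    using cycle_edges_card2[of xs e] xs that by (auto simp: card_2_iff)
  ultimately have "cycle_edges xs \<subseteq> cycle_edges ys"
    using cycle_edges_in_set[of _ xs] by blast
  with sub show ?thesis by blast
qed

section \<open>Exchanges in Hamiltonian cycles\<close>

lemma hamiltonian_cycleI:
  "distinct vs \<Longrightarrow> set vs = {1..n} \<Longrightarrow> n \<ge> 3 \<Longrightarrow> hamiltonian_cycle n (cycle_edges vs)"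
  unfolding hamiltonian_cycle_def by blast

lemma hamiltonian_cycleE:
  assumes "hamiltonian_cycle n H"
  obtains vs where "distinct vs" "set vs = {1..n}" "length vs = n" "n \<ge> 3" "H = cycle_edges vs"
  using assms unfolding hamiltonian_cycle_def by (metis card_atLeastAtMost diff_Suc_1 distinct_card)

lemma hamiltonian_cycle_start:
  assumes "hamiltonian_cycle n H" "v \<in> {1..n}"
  obtains ws where "distinct (v # ws)" "set (v # ws) = {1..n}" "length (v # ws) = n" "H = cycle_edges (v # ws)"
proof -
  obtain vs where vs: "distinct vs" "set vs = {1..n}" "length vs = n" "H = cycle_edges vs"
    using assms(1) by (rule hamiltonian_cycleE)
  with assms(2) rotate_to[of v vs] that show thesis by metis
qed

lemma finite_hamiltonian_cycle: "hamiltonian_cycle n H \<Longrightarrow> finite H"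
  by (auto elim!: hamiltonian_cycleE)

lemma card_hamiltonian_cycle: "hamiltonian_cycle n H \<Longrightarrow> card H = n"
  by (auto elim!: hamiltonian_cycleE simp: card_cycle_edges)

lemma degree_hamiltonian_cycle: "hamiltonian_cycle n H \<Longrightarrow> degree H v = (if v \<in> {1..n} then 2 else 0)"
  by (auto elim!: hamiltonian_cycleE simp: degree_cycle_edges)

lemma hamiltonian_cycle_subset_Kn: "hamiltonian_cycle n H \<Longrightarrow> H \<subseteq> Kn_edges n"
proof
  fix e assume "hamiltonian_cycle n H" "e \<in> H"
  then obtain vs where vs: "distinct vs" "set vs = {1..n}" "length vs = n" "n \<ge> 3" "H = cycle_edges vs"
    by (metis hamiltonian_cycleE)
  then have "card e = 2" "e \<subseteq> {1..n}"
    using \<open>e \<in> H\<close> cycle_edges_card2[of vs e] cycle_edges_in_set[of e vs] by auto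
  then show "e \<in> Kn_edges n" unfolding Kn_edges_def card_2_iff by blast
qed

lemma is_cycle_subset_hamiltonian_cycle:
  assumes "hamiltonian_cycle n H" "is_cycle C" "C \<subseteq> H"
  shows "C = H"
  using assms unfolding is_cycle_def
  by (metis cycle_in_cycle hamiltonian_cycleE)

lemma Kn_edgesE:
  assumes "e \<in> Kn_edges n"
  obtains i j where "e = {i, j}" "i \<noteq> j" "i \<in> {1..n}" "j \<in> {1..n}"
  using assms unfolding Kn_edges_def by blast

lemma finite_Kn_edges [simp]: "finite (Kn_edges n)"
  by (rule finite_subset[of _ "Pow {1..n}"]) (auto simp: Kn_edges_def)

text \<open>The edge \<open>f = {a, b}\<close> enters the cycle \<open>H\<close> while the edges \<open>e1, e2\<close> at its endpoints leave;
  \<open>g1, g2\<close> are the edges of \<open>H\<close> that stay at \<open>a, b\<close>. Either this yields a Hamiltonian path,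
  which is closed by one further edge, or it splits off the cycle \<open>insert f Q\<close>, which is then opened
  at the third removed edge.\<close>

locale exchange =
  fixes n :: nat and H :: "nat set set" and f :: "nat set" and a b :: nat
    and e1 g1 e2 g2 :: "nat set" and E3 Q E :: "nat set set"
  assumes ham: "hamiltonian_cycle n H"
    and f: "f = {a, b}" "f \<notin> H"
    and at_a: "{e \<in> H. a \<in> e} = {e1, g1}" "e1 \<noteq> g1"
    and at_b: "{e \<in> H. b \<in> e} = {e2, g2}" "e2 \<noteq> g2"
    and Q: "Q \<subseteq> H" "e1 \<notin> Q" "e2 \<notin> Q"
    and alt: "(E3 = {} \<and> Q = {} \<and> card E = 1) \<or>
      (\<exists>e3. E3 = {e3} \<and> {e3, g1, g2} \<subseteq> Q \<and> e3 \<notin> {g1, g2} \<and> is_cycle (insert f Q) \<and>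
            card (insert f Q) < n \<and> card E = 2)"
    and ham': "hamiltonian_cycle n (E \<union> insert f (H - ({e1, e2} \<union> E3)))"

text \<open>Counting replaces case distinctions: \<open>H\<close> has exactly \<open>n\<close>
  edges, so when it is listed as two edges and a rest of at most \<open>n - 2\<close>, no two of the
  listed items can coincide.\<close>

lemma card_insert2_tight:
  assumes "finite R" "card (insert x (insert y R)) \<ge> card R + 2"
  shows "x \<noteq> y" "x \<notin> R" "y \<notin> R"
  using assms by (auto simp: card_insert_if split: if_splits)

lemma card_insert3_tight:
  assumes "finite R" "card (insert x (insert y (insert z R))) \<ge> card R + 3"
  shows "x \<noteq> y" "x \<noteq> z" "y \<noteq> z" "x \<notin> R" "y \<notin> R" "z \<notin> R"
  using assms by (auto simp: card_insert_if split: if_splits)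

text \<open>At each endpoint of \<open>f\<close>, some edge of \<open>H\<close> lies outside
  \<open>U\<close>. If these two edges can be picked on matching sides of \<open>a\<close> and
  \<open>b\<close>, reversing a segment reconnects the tour. Otherwise the arc between
  \<open>a\<close> and \<open>b\<close> that keeps its end edges forms a short cycle with
  \<open>f\<close>, and a third edge outside \<open>U\<close> must be found on that arc.\<close>

lemma exchange_exists:
  assumes H: "hamiltonian_cycle n H" and U: "hamiltonian_cycle n U" and fU: "f \<in> U" "f \<notin> H"
  obtains a b e1 g1 e2 g2 E3 Q E where
    "exchange n H f a b e1 g1 e2 g2 E3 Q E" "({e1, e2} \<union> E3) \<inter> U = {}"
proof -
  obtain a b where ab: "f = {a, b}" "a \<noteq> b" "a \<in> {1..n}" "b \<in> {1..n}"
    using hamiltonian_cycle_subset_Kn[OF U] fU(1) Kn_edgesE by (metis subsetD)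
  \<comment> \<open>\<open>f\<close> already takes one of the two places that \<open>U\<close> has
    at its endpoint.\<close>
  have three: "x \<notin> U \<or> y \<notin> U" if "{e \<in> H. v \<in> e} = {x, y}" "x \<noteq> y" "v \<in> f" for v x y
  proof (rule ccontr)
    assume "\<not> ?thesis"
    then have "{x, y, f} \<subseteq> {e \<in> U. v \<in> e}" using that fU by blast
    then have "card {x, y, f} \<le> degree U v" unfolding degree_def
      using finite_hamiltonian_cycle[OF U] by (intro card_mono) auto
    moreover have "x \<in> H" "y \<in> H" using that(1) by blast+
    then have "f \<noteq> x" "f \<noteq> y" using fU(2) by blast+
    then have "card {x, y, f} = 3" using that(2) by simp
    ultimately show False using degree_hamiltonian_cycle[OF U, of v] by (auto split: if_splits)
  qed
  obtain ws0 where ws0: "distinct (b # ws0)" "set (b # ws0) = {1..n}" "length (b # ws0) = n" "H = cycle_edges (b # ws0)"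
    using hamiltonian_cycle_start[OF H ab(4)] by metis
  have n3: "n \<ge> 3" using H unfolding hamiltonian_cycle_def by auto
  \<comment> \<open>Reversing the cycle if necessary, the closing edge at \<open>b\<close> can be
    taken outside \<open>U\<close>; it will be \<open>e2\<close> unless the mirrored exchange is
    used.\<close>
  have "\<exists>ws. distinct (b # ws) \<and> set (b # ws) = {1..n} \<and> H = cycle_edges (b # ws) \<and> {b, last ws} \<notin> U"
  proof (cases "{b, last ws0} \<in> U")
    case True
    have "length ws0 \<ge> 2" using ws0(3) n3 by simp
    have 1: "{e \<in> H. b \<in> e} = {{b, hd ws0}, {b, last ws0}}" "{b, hd ws0} \<noteq> {b, last ws0}"
      using cycle_edges_at_hd[OF ws0(1) \<open>length ws0 \<ge> 2\<close>] ws0(4) by (simp_all add: doubleton_eq_iff)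
    have "{b, hd ws0} \<notin> U" using three[of b, OF 1(1) 1(2)] True ab(1) by simp
    moreover have "cycle_edges (b # rev ws0) = H"
      using cycle_edges_append_commute[of "[b]" "rev ws0"] cycle_edges_rev[of "b # ws0"] ws0(4) by simp
    moreover have "last (rev ws0) = hd ws0" using \<open>length ws0 \<ge> 2\<close> by (auto simp: last_rev)
    ultimately have "distinct (b # rev ws0) \<and> set (b # rev ws0) = {1..n} \<and> H = cycle_edges (b # rev ws0) \<and> {b, last (rev ws0)} \<notin> U"
      using ws0(1,2) by simp
    then show ?thesis by blast
  next
    case False
    then show ?thesis using ws0 by blast
  qed
  then obtain ws where ws: "distinct (b # ws)" "set (b # ws) = {1..n}" "H = cycle_edges (b # ws)" "{b, last ws} \<notin> U"
    by blast
  have len: "length (b # ws) = n" using ws(1,2) by (metis card_atLeastAtMost diff_Suc_1 distinct_card)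
  then have ws2: "length ws \<ge> 2" using n3 by simp
  have "a \<in> set (b # ws)" using ab(3) ws(2) by metis
  then have "a \<in> set ws" using ab(2) by simp
  then obtain A' B where ws_eq: "ws = A' @ a # B" by (auto simp: in_set_conv_decomp)
  have atb: "{e \<in> H. b \<in> e} = {{b, hd ws}, {b, last ws}}" "hd ws \<noteq> last ws"
    using cycle_edges_at_hd[OF ws(1) ws2] ws(3) by auto
  have A': "A' \<noteq> []"
  proof
    assume "A' = []"
    then have "hd ws = a" using ws_eq by simp
    then have "f \<in> {e \<in> H. b \<in> e}" unfolding atb(1) using ab(1) by (simp add: insert_commute)
    then show False using fU(2) by blast
  qed
  have B: "B \<noteq> []"
  proof
    assume "B = []"
    then have "last ws = a" using ws_eq by simp
    then have "f \<in> {e \<in> H. b \<in> e}" unfolding atb(1) using ab(1) by (simp add: insert_commute)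
    then show False using fU(2) by blast
  qed
  define A where "A = b # A'"
  have A: "A \<noteq> []" "hd A = b" "last A = last A'" using A' by (auto simp: A_def)
  have vs: "b # ws = A @ a # B" by (simp add: A_def ws_eq)
  have d: "distinct (A @ a # B)" "length A + length B + 1 = n" "set (A @ a # B) = {1..n}"
    using ws len vs by auto
  have "cycle_edges (a # B @ A) = H" using ws(3) cycle_edges_append_commute[of "a # B" A] vs by simp
  moreover have "distinct (a # B @ A)" "length (B @ A) \<ge> 2" using d n3 by auto
  ultimately have ata: "{e \<in> H. a \<in> e} = {{a, hd B}, {a, last A}}" "hd B \<noteq> last A"
    using cycle_edges_at_hd[of a "B @ A"] A B by auto
  have hws: "hd ws = hd A'" "last ws = last B" using A' B ws_eq by auto
  have Heq: "H = insert {a, last A} (insert {b, last B} (path_edges A \<union> path_edges (a # B)))"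
    using ws(3) vs A B by (simp add: cycle_edges_append) blast
  have finH: "finite H" "card H = n" using finite_hamiltonian_cycle[OF H] card_hamiltonian_cycle[OF H] by auto
  have dd: "distinct A" "distinct (a # B)" "distinct (A @ [a])" "distinct B" using d by auto
  show thesis
  proof (cases "{a, last A} \<in> U")
    case False
    let ?R = "path_edges A \<union> path_edges (a # B)"
    have "card ?R \<le> (length A - 1) + length B"
      using card_Un_le[of "path_edges A" "path_edges (a # B)"] card_path_edges[OF dd(1)] card_path_edges[OF dd(2)] by simp
    then have "card ?R + 2 \<le> n" using d(2) A(1) by (cases A) auto
    then have "card (insert {a, last A} (insert {b, last B} ?R)) \<ge> card ?R + 2"
      using Heq finH by simp
    from card_insert2_tight[OF _ this] have
      t: "{a, last A} \<noteq> {b, last B}" "{a, last A} \<notin> ?R" "{b, last B} \<notin> ?R" by auto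
    have HR: "H - {{a, last A}, {b, last B}} = ?R" using Heq t by blast
    \<comment> \<open>Reversing the segment \<open>A\<close>, which starts at \<open>b\<close>,
      brings \<open>b\<close> next to \<open>a\<close>.\<close>
    have "hamiltonian_cycle n (cycle_edges (rev A @ a # B))"
      using d n3 by (intro hamiltonian_cycleI) auto
    moreover have "cycle_edges (rev A @ a # B) = {{last A, last B}} \<union> insert f ?R"
      using A B ab(1) by (auto simp: cycle_edges_append path_edges_rev last_rev hd_rev)
    ultimately have "exchange n H f a b {a, last A} {a, hd B} {b, last B} {b, hd ws} {} {} {{last A, last B}}"
      using H ab fU ata atb hws HR by unfold_locales (auto simp: doubleton_eq_iff)
    then show thesis using False ws(4) hws by (intro that) auto
  next
    case True
    then have e1: "{a, hd B} \<notin> U" using three[of a, OF ata(1)] ata(2) ab(1) by (simp add: doubleton_eq_iff)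
    show thesis
    proof (cases "{b, hd A'} \<in> U")
      case False
      let ?R = "path_edges (A' @ [a]) \<union> path_edges (B @ [b])"
      have Heq': "H = insert {a, hd B} (insert {b, hd A'} ?R)"
        using cycle_edges_append_commute[of "[b]" "A' @ a # B"] cycle_edges_append[of "A' @ [a]" "B @ [b]"]
          ws(3) ws_eq A' B by (auto simp: insert_commute)
      have "card ?R \<le> length A' + length B"
        using card_Un_le[of "path_edges (A' @ [a])" "path_edges (B @ [b])"]
          card_path_edges[of "A' @ [a]"] card_path_edges[of "B @ [b]"] d by (auto simp: A_def)
      then have "card ?R + 2 \<le> n" using d(2) by (auto simp: A_def)
      then have "card (insert {a, hd B} (insert {b, hd A'} ?R)) \<ge> card ?R + 2"
        using Heq' finH by simp
      from card_insert2_tight[OF _ this] have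
        t: "{a, hd B} \<noteq> {b, hd A'}" "{a, hd B} \<notin> ?R" "{b, hd A'} \<notin> ?R" by auto
      have HR: "H - {{a, hd B}, {b, hd A'}} = ?R" using Heq' t by blast
      \<comment> \<open>The mirror image: both removed edges lie on the other side of their
        endpoints, so the segment from \<open>hd B\<close> to \<open>b\<close> is reversed.\<close>
      have "hamiltonian_cycle n (cycle_edges ((A' @ [a]) @ rev (B @ [b])))"
        using d n3 by (intro hamiltonian_cycleI) (auto simp: A_def)
      moreover have "cycle_edges ((A' @ [a]) @ rev (B @ [b])) = {{hd A', hd B}} \<union> insert f ?R"
        using A' B ab(1)
        by (subst cycle_edges_append) (auto simp: path_edges_rev last_rev hd_rev insert_commute simp del: rev_append)
      ultimately have "exchange n H f a b {a, hd B} {a, last A} {b, hd A'} {b, last B} {} {} {{hd A', hd B}}"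
        using H ab fU ata atb hws HR by unfold_locales (auto simp: doubleton_eq_iff)
      then show thesis using False e1 by (intro that) auto
    next
      case g2: True
      let ?Q = "path_edges (A @ [a])"
      have dA: "length (A @ [a]) \<ge> 3" "length (A @ [a]) < n" using A' B d(2) by (auto simp: A_def neq_Nil_conv)
      have cyc: "cycle_edges (A @ [a]) = insert f ?Q" using A ab(1) by (simp add: cycle_edges_conv_path)
      \<comment> \<open>A Hamiltonian cycle contains no shorter cycle, so \<open>U\<close> misses
        some edge of the arc from \<open>b\<close> to \<open>a\<close>.\<close>
      have "\<not> ?Q \<subseteq> U"
      proof
        assume "?Q \<subseteq> U"
        then have "cycle_edges (A @ [a]) \<subseteq> U" using fU cyc by simp
        moreover have "is_cycle (cycle_edges (A @ [a]))" using dd(3) dA unfolding is_cycle_def by blast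
        ultimately have "cycle_edges (A @ [a]) = U" using is_cycle_subset_hamiltonian_cycle[OF U] by blast
        then show False using card_cycle_edges[OF dd(3) dA(1)] dA(2) card_hamiltonian_cycle[OF U] by simp
      qed
      then obtain e3 where e3: "e3 \<in> ?Q" "e3 \<notin> U" by blast
      then obtain P1 P2 where P: "A @ [a] = P1 @ P2" "P1 \<noteq> []" "P2 \<noteq> []" "e3 = {last P1, hd P2}"
        using path_edges_ex by blast
      have P': "hd P1 = b" "last P2 = a" using P A by (metis hd_append2, metis last_appendR last_snoc)
      have dP: "distinct P1" "distinct P2" "distinct (P2 @ P1 @ B)" "set (P2 @ P1 @ B) = {1..n}"
          "length P1 + length P2 + length B = n"
      proof -
        have eq: "A @ a # B = P1 @ P2 @ B" using P(1) by simp
        have "distinct (P1 @ P2 @ B)" "set (P1 @ P2 @ B) = {1..n}" "length (P1 @ P2 @ B) = n"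
          using d unfolding eq[symmetric] by simp_all
        then show "distinct P1" "distinct P2" "distinct (P2 @ P1 @ B)" "set (P2 @ P1 @ B) = {1..n}"
          "length P1 + length P2 + length B = n" by (simp_all add: Un_left_commute Int_commute) auto
      qed
      let ?R = "path_edges P1 \<union> path_edges P2 \<union> path_edges B"
      have Qeq: "?Q = insert e3 (path_edges P1 \<union> path_edges P2)"
        using P by (simp add: path_edges_append)
      have Heq3: "H = insert {a, hd B} (insert {b, last B} (insert e3 ?R))"
        using cycle_edges_append[of "A @ [a]" B] ws(3) vs A B Qeq by (auto simp: insert_commute)
      have "card ?R \<le> (length P1 - 1) + (length P2 - 1) + (length B - 1)"
        using card_Un_le[of "path_edges P1 \<union> path_edges P2" "path_edges B"]
          card_Un_le[of "path_edges P1" "path_edges P2"]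
          card_path_edges[OF dP(1)] card_path_edges[OF dP(2)] card_path_edges[OF dd(4)] by linarith
      then have "card ?R + 3 \<le> n" using dP(5) P B by (cases P1; cases P2; cases B) auto
      then have "card (insert {a, hd B} (insert {b, last B} (insert e3 ?R))) \<ge> card ?R + 3"
        using Heq3 finH by simp
      from card_insert3_tight[OF _ this] have
        t: "{a, hd B} \<noteq> {b, last B}" "{a, hd B} \<noteq> e3" "{b, last B} \<noteq> e3"
          "{a, hd B} \<notin> ?R" "{b, last B} \<notin> ?R" "e3 \<notin> ?R" by auto
      have HR: "H - {{a, hd B}, {b, last B}, e3} = ?R" using Heq3 t by blast
      let ?E = "{{last P1, hd B}, {last B, hd P2}}"
      \<comment> \<open>Opened at \<open>e3\<close>, the short cycle \<open>insert f ?Q\<close>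
        becomes the path \<open>P2 @ P1\<close>, which passes through \<open>f\<close>;
        \<open>B\<close> then joins its two ends.\<close>
      have "cycle_edges (P2 @ P1 @ B) = ?E \<union> insert f ?R"
        using P P' B ab(1) by (auto simp: cycle_edges_append path_edges_append)
      moreover have "hamiltonian_cycle n (cycle_edges (P2 @ P1 @ B))"
        using dP n3 by (intro hamiltonian_cycleI) auto
      ultimately have ham': "hamiltonian_cycle n (?E \<union> insert f (H - ({{a, hd B}, {b, last B}} \<union> {e3})))"
        using HR by (simp add: insert_commute Un_commute)
      have "last P1 \<in> set P1" "last B \<in> set B" "hd B \<in> set B" "hd P2 \<in> set P2" using P B by auto
      then have "last P1 \<noteq> last B" "last P1 \<noteq> hd P2" using dP(3) by (auto simp: disjoint_iff)
      then have "card ?E = 2" by (auto simp: doubleton_eq_iff card_2_iff)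
      moreover have "is_cycle (insert f ?Q)"
        using dd(3) dA cyc unfolding is_cycle_def by metis
      moreover have "card (insert f ?Q) < n"
        using card_cycle_edges[OF dd(3) dA(1)] dA(2) cyc by simp
      moreover have "{a, last A} \<in> ?Q" "{b, hd A'} \<in> ?Q"
        using A A' path_edges_append[of A "[a]"] path_edges_append[of A "[a]"] path_edges_Cons[of A' b]
        by (auto simp: A_def insert_commute)
      moreover have "e3 \<noteq> {a, last A}" "e3 \<noteq> {b, hd A'}" using e3 True g2 by auto
      moreover have "?Q \<subseteq> H" "{a, hd B} \<notin> ?Q" "{b, last B} \<notin> ?Q" using Heq3 Qeq t by auto
      ultimately have "exchange n H f a b {a, hd B} {a, last A} {b, last B} {b, hd ws} {e3} ?Q ?E"
        using H ab fU ata atb hws ham' e3(1) by unfold_locales (auto simp: doubleton_eq_iff)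
      then show thesis using e1 ws(4) e3 hws by (intro that) auto
    qed
  qed
qed

section \<open>Levels and the run of the algorithm\<close>

definition unit_cycle :: "nat \<Rightarrow> nat set set" where
  "unit_cycle n = cycle_edges [1..<Suc n]"

definition level :: "nat \<Rightarrow> nat set set \<Rightarrow> nat" where
  "level n H = card (H - unit_cycle n)"

lemma hamiltonian_unit_cycle: "n \<ge> 3 \<Longrightarrow> hamiltonian_cycle n (unit_cycle n)"
  unfolding unit_cycle_def by (rule hamiltonian_cycleI) auto

lemma d_G1_unit_cycle: "n \<ge> 3 \<Longrightarrow> d_G1 n e = (if e \<in> unit_cycle n then 1 else real n)"
proof -
  assume n: "n \<ge> 3"
  have "path_edges [1..<Suc n] = {{i, i + 1} | i. 1 \<le> i \<and> i \<le> n - 1}"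
  proof -
    have "path_edges [1..<Suc n] = (\<lambda>i. {[1..<Suc n] ! i, [1..<Suc n] ! Suc i}) ` {..<n - 1}"
      by (simp add: path_edges_conv_nth del: upt_Suc)
    also have "\<dots> = (\<lambda>i. {Suc i, Suc (Suc i)}) ` {..<n - 1}"
      by (intro image_cong) (auto simp del: upt_Suc)
    also have "\<dots> = (\<lambda>i. {i, Suc i}) ` (Suc ` {..<n - 1})"
      by (simp add: image_image)
    also have "Suc ` {..<n - 1} = {1..n - 1}"
      by (metis One_nat_def image_Suc_lessThan)
    finally show ?thesis by auto
  qed
  moreover have "hd [1..<Suc n] = 1" using n by (simp add: upt_rec del: upt_Suc)
  ultimately have "unit_cycle n = insert {n, 1} {{i, i + 1} | i. 1 \<le> i \<and> i \<le> n - 1}"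
    unfolding unit_cycle_def using n by (subst cycle_edges_conv_path) auto
  then show ?thesis unfolding d_G1_def by auto
qed

lemma cost_eq_level:
  assumes "hamiltonian_cycle n H"
  shows "cost n H = real n + real (level n H) * (real n - 1)"
proof -
  have n: "n \<ge> 3" using assms unfolding hamiltonian_cycle_def by auto
  have fin: "finite H" "card H = n"
    using assms finite_hamiltonian_cycle card_hamiltonian_cycle by auto
  have "cost n H = (\<Sum>e\<in>H. 1 + (if e \<in> unit_cycle n then 0 else real n - 1))"
    unfolding cost_def by (intro sum.cong) (auto simp: d_G1_unit_cycle[OF n])
  also have "\<dots> = real n + (\<Sum>e\<in>H. if e \<in> unit_cycle n then 0 else real n - 1)"
    using fin by (simp add: sum.distrib)
  also have "(\<Sum>e\<in>H. if e \<in> unit_cycle n then 0 else real n - 1) = (\<Sum>e\<in>H - unit_cycle n. real n - 1)"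
    using fin(1) by (intro sum.mono_neutral_cong_right) auto
  finally show ?thesis by (simp add: level_def)
qed

lemma cost_le_iff_level_le:
  assumes "hamiltonian_cycle n H" "hamiltonian_cycle n H'"
  shows "cost n H \<le> cost n H' \<longleftrightarrow> level n H \<le> level n H'"
proof -
  have "n \<ge> 3" using assms unfolding hamiltonian_cycle_def by auto
  then show ?thesis using assms by (simp add: cost_eq_level)
qed

lemma optimal_if_level_0: "hamiltonian_cycle n H \<Longrightarrow> level n H = 0 \<Longrightarrow> optimal n H"
  unfolding optimal_def by (simp add: cost_le_iff_level_le)

lemma level_le: "hamiltonian_cycle n H \<Longrightarrow> level n H \<le> n"
  unfolding level_def
  by (metis Diff_subset card_hamiltonian_cycle card_mono finite_hamiltonian_cycle)

text \<open>Both cycles have \<open>n\<close> edges, so as many edges of the optimum are missing as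
  there are foreign ones. The count of missing edges supplies the factor \<open>j\<close> in the
  edge-based bound.\<close>

lemma card_unit_minus: "hamiltonian_cycle n H \<Longrightarrow> card (unit_cycle n - H) = level n H"
proof -
  assume H: "hamiltonian_cycle n H"
  then have "n \<ge> 3" unfolding hamiltonian_cycle_def by auto
  note U = hamiltonian_unit_cycle[OF this]
  have "card (unit_cycle n - H) = n - card (unit_cycle n \<inter> H)"
    using U H by (metis card_Diff_subset_Int card_hamiltonian_cycle finite_Int finite_hamiltonian_cycle)
  moreover have "level n H = n - card (unit_cycle n \<inter> H)"
    unfolding level_def using U H
    by (metis card_Diff_subset_Int card_hamiltonian_cycle finite_Int finite_hamiltonian_cycle Int_commute)
  ultimately show ?thesis by simp
qed

context exchange
begin

definition new_cycle :: "nat set set" where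
  "new_cycle = E \<union> insert f (H - ({e1, e2} \<union> E3))"

lemma new_cycle_diff: "f \<in> new_cycle" "new_cycle - H \<subseteq> insert f E" "card (new_cycle - H) \<le> 3"
proof -
  show 1: "f \<in> new_cycle" "new_cycle - H \<subseteq> insert f E" by (auto simp: new_cycle_def)
  have "finite E" "card E \<le> 2" using alt by (auto intro: card_ge_0_finite)
  then show "card (new_cycle - H) \<le> 3"
    using card_mono[OF _ 1(2)] card_insert_le_m1[of 3 E f] by (simp add: card_insert_if split: if_splits)
qed

lemma in_H: "e1 \<in> H" "g1 \<in> H" "e2 \<in> H" "g2 \<in> H" "E3 \<subseteq> H" "f \<notin> E3"
proof -
  show "e1 \<in> H" "g1 \<in> H" using at_a(1) by blast+
  show "e2 \<in> H" "g2 \<in> H" using at_b(1) by blast+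
  show "E3 \<subseteq> H" using alt Q(1) by blast
  then show "f \<notin> E3" using f(2) by blast
qed

text \<open>An edge of \<open>H\<close> incident with both \<open>a\<close> and \<open>b\<close>
  would be \<open>f\<close>, which is not in \<open>H\<close>.\<close>

lemma e1_ne_e2: "e1 \<noteq> e2" "e1 \<noteq> g2" "e2 \<noteq> g1" "g1 \<noteq> g2"
proof -
  have n: "card e = 2" if "e \<in> H" for e
    using ham that cycle_edges_card2 by (auto elim!: hamiltonian_cycleE)
  have "a \<noteq> b"
  proof
    assume "a = b"
    have "f \<in> new_cycle" by (simp add: new_cycle_def)
    then have "f \<in> Kn_edges n" using ham' hamiltonian_cycle_subset_Kn unfolding new_cycle_def by blast
    then show False using \<open>a = b\<close> f(1) by (auto simp: Kn_edges_def doubleton_eq_iff)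
  qed
  then have *: "e \<notin> H" if "a \<in> e" "b \<in> e" for e
    using n[of e] that f by (auto simp: card_2_iff doubleton_eq_iff insert_commute)
  have "a \<in> e1" "a \<in> g1" "b \<in> e2" "b \<in> g2" using at_a(1) at_b(1) by blast+
  then show "e1 \<noteq> e2" "e1 \<noteq> g2" "e2 \<noteq> g1" "g1 \<noteq> g2" using * in_H by blast+
qed

lemma card_removed: "card ({e1, e2} \<union> E3) = Suc (card E)"
  using alt
proof
  assume "E3 = {} \<and> Q = {} \<and> card E = 1"
  then show ?thesis using e1_ne_e2 by simp
next
  assume "\<exists>e3. E3 = {e3} \<and> {e3, g1, g2} \<subseteq> Q \<and> e3 \<notin> {g1, g2} \<and> is_cycle (insert f Q) \<and>
          card (insert f Q) < n \<and> card E = 2"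
  then obtain e3 where "E3 = {e3}" "e3 \<in> Q" "card E = 2" by blast
  then have "e3 \<noteq> e1" "e3 \<noteq> e2" using Q by auto
  then have "card {e1, e2, e3} = 3" using e1_ne_e2 by simp
  then show ?thesis using \<open>E3 = {e3}\<close> \<open>card E = 2\<close> by (simp add: insert_commute)
qed

lemma finite_HE: "finite H" "finite E"
  using finite_hamiltonian_cycle[OF ham] alt by (auto intro: card_ge_0_finite)

text \<open>\<open>Suc (card E)\<close> edges outside the optimum leave, while at most
  \<open>card E\<close> enter, because \<open>f\<close> belongs to the optimum.\<close>

lemma level_new_cycle:
  assumes "({e1, e2} \<union> E3) \<inter> unit_cycle n = {}" "f \<in> unit_cycle n"
  shows "level n new_cycle < level n H"
proof -
  let ?X = "{e1, e2} \<union> E3" and ?U = "unit_cycle n"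
  note fin = finite_HE and X = card_removed
  have XH: "?X \<subseteq> H - ?U" using in_H assms by blast
  have "new_cycle - ?U \<subseteq> E \<union> ((H - ?U) - ?X)" using assms(2) by (auto simp: new_cycle_def)
  then have "level n new_cycle \<le> card (E \<union> ((H - ?U) - ?X))"
    unfolding level_def using fin by (intro card_mono) auto
  also have "\<dots> \<le> card E + card ((H - ?U) - ?X)" by (rule card_Un_le)
  also have "card ((H - ?U) - ?X) = level n H - card ?X"
    unfolding level_def using XH fin by (intro card_Diff_subset) (auto intro: finite_subset)
  finally have "level n new_cycle \<le> card E + (level n H - card ?X)" .
  moreover have "card ?X \<le> level n H" unfolding level_def using XH fin by (intro card_mono) auto
  ultimately show ?thesis using X by linarith
qed

end

lemma improvement_exists:
  assumes "hamiltonian_cycle n H" "f \<in> unit_cycle n - H"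
  obtains a b e1 g1 e2 g2 E3 Q E where "exchange n H f a b e1 g1 e2 g2 E3 Q E"
    "level n (exchange.new_cycle H f e1 e2 E3 E) < level n H"
proof -
  have "n \<ge> 3" using assms unfolding hamiltonian_cycle_def by auto
  then obtain a b e1 g1 e2 g2 E3 Q E where
    *: "exchange n H f a b e1 g1 e2 g2 E3 Q E" "({e1, e2} \<union> E3) \<inter> unit_cycle n = {}"
    using exchange_exists[OF assms(1) hamiltonian_unit_cycle, of f] assms(2) by (metis DiffD1 DiffD2)
  show thesis by (rule that[OF *(1) exchange.level_new_cycle[OF *]]) (use assms(2) in simp)
qed

section \<open>Best of \<open>N\<close> samples and the run as a sequence of such steps\<close>

lemma measure_bind_pmf:
  "measure_pmf.prob (bind_pmf p f) A = measure_pmf.expectation p (\<lambda>x. measure_pmf.prob (f x) A)"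
proof -
  have int: "integrable (measure_pmf p) (\<lambda>x. measure_pmf.prob (f x) A)"
    by (rule measure_pmf.integrable_const_bound[where B=1]) auto
  have "ennreal (measure_pmf.prob (bind_pmf p f) A) = \<integral>\<^sup>+x. ennreal (measure_pmf.prob (f x) A) \<partial>measure_pmf p"
    by (simp flip: measure_pmf.emeasure_eq_measure)
  also have "\<dots> = ennreal (measure_pmf.expectation p (\<lambda>x. measure_pmf.prob (f x) A))"
    using int by (intro nn_integral_eq_integral) auto
  finally show ?thesis
    by (simp add: integral_nonneg)
qed

lemma set_samples: "xs \<in> set_pmf (samples k g) \<Longrightarrow> length xs = k \<and> set xs \<subseteq> set_pmf g"
  by (induction k arbitrary: xs) fastforce+

lemma prob_samples_disjoint:
  "measure_pmf.prob (samples k g) {xs. set xs \<inter> A = {}} = (1 - measure_pmf.prob g A) ^ k"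
proof (induction k)
  case (Suc k)
  have *: "measure_pmf.prob (bind_pmf (samples k g) (\<lambda>xs. return_pmf (x # xs))) {xs. set xs \<inter> A = {}}
        = indicator (- A) x * (1 - measure_pmf.prob g A) ^ k" for x
  proof -
    have "bind_pmf (samples k g) (\<lambda>xs. return_pmf (x # xs)) = map_pmf ((#) x) (samples k g)"
      by (simp add: map_pmf_def)
    moreover have "(#) x -` {xs. set xs \<inter> A = {}} = (if x \<in> A then {} else {xs. set xs \<inter> A = {}})" by auto
    ultimately show ?thesis using Suc by simp
  qed
  have "measure_pmf.prob (samples (Suc k) g) {xs. set xs \<inter> A = {}}
      = measure_pmf.expectation g (indicator (- A)) * (1 - measure_pmf.prob g A) ^ k"
    unfolding samples.simps measure_bind_pmf[of g] * by simp
  also have "measure_pmf.expectation g (indicator (- A)) = 1 - measure_pmf.prob g A"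
    using measure_pmf.prob_compl[of A g] by (simp add: Compl_eq_Diff_UNIV)
  finally show ?case by simp
qed simp

definition next_best :: "(nat \<Rightarrow> (nat \<Rightarrow> nat \<Rightarrow> real) \<Rightarrow> nat set set pmf) \<Rightarrow>
    (nat \<Rightarrow> nat set set list \<Rightarrow> nat set set) \<Rightarrow> nat \<Rightarrow> nat \<Rightarrow> (nat \<Rightarrow> nat \<Rightarrow> real) \<Rightarrow> nat set set pmf" where
  "next_best gen sel n N P = map_pmf (sel n) (samples N (gen n P))"

lemma set_next_best:
  assumes "valid_selector sel" "N > 0" "x \<in> set_pmf (next_best gen sel n N P)"
  shows "x \<in> set_pmf (gen n P)"
proof -
  obtain xs where "xs \<in> set_pmf (samples N (gen n P))" "x = sel n xs"
    using assms(3) by (auto simp: next_best_def)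
  moreover from this have "xs \<noteq> []" using set_samples assms(2) by fastforce
  ultimately show ?thesis using set_samples assms(1) unfolding valid_selector_def by blast
qed

text \<open>The selected sample has the least level, so its level exceeds \<open>l\<close> only if
  all \<open>N\<close> independent samples do.\<close>

lemma prob_next_best_level:
  assumes sel: "valid_selector sel" "N > 0"
    and ham: "\<And>x. x \<in> set_pmf (gen n P) \<Longrightarrow> hamiltonian_cycle n x"
  shows "measure_pmf.prob (next_best gen sel n N P) {x. level n x > l}
         \<le> (1 - measure_pmf.prob (gen n P) {x. level n x \<le> l}) ^ N"
proof -
  have "measure_pmf.prob (next_best gen sel n N P) {x. level n x > l}
      = measure_pmf.prob (samples N (gen n P)) {xs. level n (sel n xs) > l}"
    unfolding next_best_def by (simp add: vimage_def)
  also have "\<dots> \<le> measure_pmf.prob (samples N (gen n P)) {xs. set xs \<inter> {x. level n x \<le> l} = {}}"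
  \<comment> \<open>The events are compared only on the support, where all samples are Hamiltonian
    cycles and cost is ordered like level.\<close>
  proof (rule measure_pmf.finite_measure_mono_AE)
    show "AE xs in samples N (gen n P). xs \<in> {xs. level n (sel n xs) > l}
            \<longrightarrow> xs \<in> {xs. set xs \<inter> {x. level n x \<le> l} = {}}"
    proof (rule AE_pmfI, clarsimp)
      fix xs assume xs: "xs \<in> set_pmf (samples N (gen n P))" "level n (sel n xs) > l"
      then have "length xs = N" "set xs \<subseteq> set_pmf (gen n P)" using set_samples by blast+
      moreover from this have "xs \<noteq> []" using sel(2) by auto
      ultimately have s: "sel n xs \<in> set xs" "\<forall>y\<in>set xs. cost n (sel n xs) \<le> cost n y"
        using sel(1) unfolding valid_selector_def by blast+
      have "level n (sel n xs) \<le> level n y" if "y \<in> set xs" for y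
        using s that ham \<open>set xs \<subseteq> _\<close> cost_le_iff_level_le by (metis subsetD)
      then show "set xs \<inter> {x. level n x \<le> l} = {}" using xs(2) by fastforce
    qed
  qed auto
  finally show ?thesis by (simp add: prob_samples_disjoint)
qed

text \<open>An iteration fails to decrease the level \<open>j\<close> with probability at most \<open>y j\<close>; it is given
  \<open>b j\<close> attempts.\<close>

lemma prob_run_not_optimal:
  assumes sup: "\<And>H x. hamiltonian_cycle n H \<Longrightarrow> x \<in> set_pmf (next_best gen sel n N (Pi_of n H)) \<Longrightarrow> hamiltonian_cycle n x"
    and up: "\<And>H. hamiltonian_cycle n H \<Longrightarrow>
        measure_pmf.prob (next_best gen sel n N (Pi_of n H)) {x. level n x > level n H} \<le> \<delta>"
    and stay: "\<And>H. hamiltonian_cycle n H \<Longrightarrow> level n H > 0 \<Longrightarrow>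
        measure_pmf.prob (next_best gen sel n N (Pi_of n H)) {x. level n x \<ge> level n H} \<le> y (level n H)"
    and y: "\<And>j. y j \<ge> 0" and \<delta>: "\<delta> \<ge> 0"
  shows "hamiltonian_cycle n H \<Longrightarrow> level n H > 0 \<Longrightarrow> s + (\<Sum>j\<in>{1..<level n H}. b j) \<le> T \<Longrightarrow>
    measure_pmf.prob (run gen sel n N T (Pi_of n H)) {xs. \<forall>x\<in>set xs. \<not> optimal n x}
      \<le> real (T + 1) * \<delta> + y (level n H) ^ s + (\<Sum>j\<in>{1..<level n H}. y j ^ b j)"
proof (induction T arbitrary: H s)
  case 0
  then have "s = 0" by simp
  \<comment> \<open>\<open>s\<close> counts the attempts left at the current level; with none left
    the term \<open>y (level n H) ^ 0\<close> is 1 and the bound is trivial.\<close>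
  have "1 \<le> real (0 + 1) * \<delta> + y (level n H) ^ s + (\<Sum>j\<in>{1..<level n H}. y j ^ b j)"
    using \<delta> y \<open>s = 0\<close> by (simp add: sum_nonneg add_nonneg_nonneg)
  then show ?case using measure_pmf.prob_le_1 order_trans by blast
next
  case (Suc T)
  show ?case
  proof (cases s)
    case 0
    have "1 \<le> real (Suc T + 1) * \<delta> + y (level n H) ^ s + (\<Sum>j\<in>{1..<level n H}. y j ^ b j)"
      using \<delta> y 0 by (simp add: sum_nonneg add_nonneg_nonneg)
    then show ?thesis using measure_pmf.prob_le_1 order_trans by blast
  next
    case (Suc s')
    let ?K = "next_best gen sel n N (Pi_of n H)" and ?bad = "{xs. \<forall>x\<in>set xs. \<not> optimal n x}"
    let ?S = "\<Sum>j\<in>{1..<level n H}. y j ^ b j" and ?k = "level n H"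
    \<comment> \<open>A bound by outcome: a rise is charged in full to \<open>\<delta>\<close>,
      staying uses up one attempt, and a drop to level \<open>j\<close> starts a fresh budget of
      \<open>b j\<close> attempts, whose failure term is already in \<open>?S\<close>. Levels that
      are skipped only leave slack.\<close>
    let ?g = "\<lambda>x. indicator {x. level n x > ?k} x + indicator {x. level n x \<ge> ?k} x * y ?k ^ s'
               + (real (T + 1) * \<delta> + ?S)"
    have S0: "?S \<ge> 0" using y by (simp add: sum_nonneg)
    have pt: "measure_pmf.prob (map_pmf ((#) x) (run gen sel n N T (Pi_of n x))) ?bad \<le> ?g x"
      if x: "x \<in> set_pmf ?K" for x
    proof -
      have hx: "hamiltonian_cycle n x" using sup Suc.prems(1) x by blast
      have g0: "?g x \<ge> 0" using S0 y \<delta> by (intro add_nonneg_nonneg mult_nonneg_nonneg) auto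
      show ?thesis
      proof (cases "optimal n x")
        case True
        then have "(#) x -` ?bad = {}" by auto
        then show ?thesis using g0 unfolding measure_map_pmf by (simp only: measure_empty)
      next
        case False
        then have v: "(#) x -` ?bad = ?bad" by auto
        have l0: "level n x > 0" using False hx optimal_if_level_0 by blast
        consider "level n x > ?k" | "level n x = ?k" | "level n x < ?k" by linarith
        then have "measure_pmf.prob (run gen sel n N T (Pi_of n x)) ?bad \<le> ?g x"
        proof cases
          case 1
          then have "1 \<le> ?g x" using S0 y \<delta> by (auto intro!: add_nonneg_nonneg mult_nonneg_nonneg)
          then show ?thesis using measure_pmf.prob_le_1 order_trans by blast
        next
          case 2
          then show ?thesis using Suc.IH[OF hx l0, of s'] Suc.prems \<open>s = Suc s'\<close> by simp
        next
          case 3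
          have sub: "insert (level n x) {1..<level n x} \<subseteq> {1..<?k}" using 3 l0 by auto
          have "b (level n x) + (\<Sum>j\<in>{1..<level n x}. b j) = (\<Sum>j\<in>insert (level n x) {1..<level n x}. b j)" by simp
          also have "\<dots> \<le> (\<Sum>j\<in>{1..<?k}. b j)" using sub by (intro sum_mono2) auto
          finally have "b (level n x) + (\<Sum>j\<in>{1..<level n x}. b j) \<le> T" using Suc.prems \<open>s = Suc s'\<close> by simp
          from Suc.IH[OF hx l0 this]
          have "measure_pmf.prob (run gen sel n N T (Pi_of n x)) ?bad
             \<le> real (T + 1) * \<delta> + (\<Sum>j\<in>insert (level n x) {1..<level n x}. y j ^ b j)" by simp
          also have "(\<Sum>j\<in>insert (level n x) {1..<level n x}. y j ^ b j) \<le> ?S"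
            using sub y by (intro sum_mono2) auto
          finally show ?thesis using 3 by simp
        qed
        with v show ?thesis by simp
      qed
    qed
    have "measure_pmf.prob (run gen sel n N (Suc T) (Pi_of n H)) ?bad
        = measure_pmf.expectation ?K (\<lambda>x. measure_pmf.prob (map_pmf ((#) x) (run gen sel n N T (Pi_of n x))) ?bad)"
      by (simp add: measure_bind_pmf next_best_def)
    also have "\<dots> \<le> measure_pmf.expectation ?K ?g"
    proof (rule integral_mono_AE)
      show "integrable ?K (\<lambda>x. measure_pmf.prob (map_pmf ((#) x) (run gen sel n N T (Pi_of n x))) ?bad)"
        by (rule measure_pmf.integrable_const_bound[where B=1]) auto
      show "integrable ?K ?g"
        by (auto intro!: Bochner_Integration.integrable_add integrable_mult_left
            integrable_real_indicator simp: measure_pmf.emeasure_eq_measure)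
    qed (use pt in \<open>auto intro: AE_pmfI\<close>)
    also have "\<dots> = measure_pmf.prob ?K {x. level n x > ?k} + measure_pmf.prob ?K {x. level n x \<ge> ?k} * y ?k ^ s'
               + (real (T + 1) * \<delta> + ?S)"
      by (subst Bochner_Integration.integral_add Bochner_Integration.integral_add;
          auto intro!: Bochner_Integration.integrable_add integrable_mult_left
            integrable_real_indicator simp: measure_pmf.emeasure_eq_measure)+
    also have "\<dots> \<le> \<delta> + y ?k * y ?k ^ s' + (real (T + 1) * \<delta> + ?S)"
      using up[OF Suc.prems(1)] stay[OF Suc.prems(1,2)] y \<delta> by (intro add_mono mult_right_mono) auto
    finally show ?thesis using \<open>s = Suc s'\<close> by (simp add: algebra_simps)
  qed
qed

text \<open>Taking \<open>N\<close> samples turns the success probabilities \<open>p\<close> and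
  \<open>q j\<close> of one sample into failure probabilities \<open>exp (- p * N)\<close> and
  \<open>exp (- q j * N)\<close> of one iteration. The strict inequality on \<open>b\<close>
  reserves one iteration for the start from \<open>Pi0\<close>, of which only the validity of the
  tour is used.\<close>

lemma found_prob_ge:
  assumes sel: "valid_selector sel" "N > 0"
    and sup0: "\<And>x. x \<in> set_pmf (gen n (Pi0 n)) \<Longrightarrow> hamiltonian_cycle n x"
    and sup: "\<And>H x. hamiltonian_cycle n H \<Longrightarrow> x \<in> set_pmf (gen n (Pi_of n H)) \<Longrightarrow> hamiltonian_cycle n x"
    and p: "\<And>H. hamiltonian_cycle n H \<Longrightarrow> measure_pmf.prob (gen n (Pi_of n H)) {H} \<ge> p"
    and q: "\<And>H. hamiltonian_cycle n H \<Longrightarrow> level n H > 0 \<Longrightarrow>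
        measure_pmf.prob (gen n (Pi_of n H)) {x. level n x < level n H} \<ge> q (level n H)"
    and b: "(\<Sum>j\<in>{1..n}. b j) < T"
  shows "found_prob gen sel n N T \<ge> 1 - (real T * exp (- p * real N) + (\<Sum>j\<in>{1..n}. exp (- q j * real N * real (b j))))"
proof -
  let ?bad = "{xs. \<forall>x\<in>set xs. \<not> optimal n x}"
  let ?y = "\<lambda>j. exp (- q j * real N)" and ?\<delta> = "exp (- p * real N)"
  have pow: "(1 - x) ^ N \<le> exp (- z * real N)" if "0 \<le> 1 - x" "z \<le> x" for x z :: real
  proof -
    have "(1 - x) ^ N \<le> exp (- z) ^ N"
      using that exp_ge_add_one_self[of "- z"] by (intro power_mono) auto
    then show ?thesis by (simp flip: exp_of_nat_mult add: mult.commute)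
  qed
  have fail: "measure_pmf.prob (run gen sel n N T' (Pi_of n H)) ?bad
      \<le> real (T' + 1) * ?\<delta> + (\<Sum>j\<in>{1..n}. ?y j ^ b j)"
    if H: "hamiltonian_cycle n H" "level n H > 0" and T': "(\<Sum>j\<in>{1..n}. b j) \<le> T'" for H T'
  proof -
    have sub: "insert (level n H) {1..<level n H} \<subseteq> {1..n}" using level_le[OF H(1)] H(2) by auto
    have "b (level n H) + (\<Sum>j\<in>{1..<level n H}. b j) = (\<Sum>j\<in>insert (level n H) {1..<level n H}. b j)" by simp
    also have "\<dots> \<le> (\<Sum>j\<in>{1..n}. b j)" using sub by (intro sum_mono2) auto
    finally have le: "b (level n H) + (\<Sum>j\<in>{1..<level n H}. b j) \<le> T'" using T' by simp
    have "measure_pmf.prob (run gen sel n N T' (Pi_of n H)) ?bad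
        \<le> real (T' + 1) * ?\<delta> + ?y (level n H) ^ b (level n H) + (\<Sum>j\<in>{1..<level n H}. ?y j ^ b j)"
    proof (rule prob_run_not_optimal[OF _ _ _ _ _ H le])
      fix H x assume "hamiltonian_cycle n H" "x \<in> set_pmf (next_best gen sel n N (Pi_of n H))"
      then show "hamiltonian_cycle n x" using set_next_best[OF sel] sup by blast
    next
      fix H assume H: "hamiltonian_cycle n H"
      have "p \<le> measure_pmf.prob (gen n (Pi_of n H)) {x. level n x \<le> level n H}"
        using p[OF H] by (rule order_trans) (intro measure_pmf.finite_measure_mono, auto)
      then have "(1 - measure_pmf.prob (gen n (Pi_of n H)) {x. level n x \<le> level n H}) ^ N \<le> ?\<delta>"
        by (intro pow) auto
      then show "measure_pmf.prob (next_best gen sel n N (Pi_of n H)) {x. level n x > level n H} \<le> ?\<delta>"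
        using prob_next_best_level[where gen=gen and n=n and P="Pi_of n H" and l="level n H", OF sel sup[OF H]] by linarith
    next
      fix H assume H: "hamiltonian_cycle n H" "level n H > 0"
      \<comment> \<open>As the level is positive, a strict decrease is the same as reaching
        \<open>level n H - 1\<close>, the threshold form required by
        \<open>prob_next_best_level\<close>.\<close>
      then have eq: "{x. level n x \<le> level n H - 1} = {x. level n x < level n H}"
        "{x. level n H - 1 < level n x} = {x. level n x \<ge> level n H}" by auto
      have "(1 - measure_pmf.prob (gen n (Pi_of n H)) {x. level n x < level n H}) ^ N \<le> ?y (level n H)"
        using q[OF H] by (intro pow) auto
      then show "measure_pmf.prob (next_best gen sel n N (Pi_of n H)) {x. level n x \<ge> level n H} \<le> ?y (level n H)"
        using prob_next_best_level[where gen=gen and n=n and P="Pi_of n H" and l="level n H - 1", OF sel sup[OF H(1)]]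
        unfolding eq by linarith
    qed auto
    also have "\<dots> = real (T' + 1) * ?\<delta> + (\<Sum>j\<in>insert (level n H) {1..<level n H}. ?y j ^ b j)" by simp
    also have "\<dots> \<le> real (T' + 1) * ?\<delta> + (\<Sum>j\<in>{1..n}. ?y j ^ b j)"
      using sub by (intro add_left_mono sum_mono2) auto
    finally show ?thesis .
  qed
  obtain T' where T': "T = Suc T'" using b by (cases T) auto
  let ?K = "next_best gen sel n N (Pi0 n)"
  let ?B = "real T * ?\<delta> + (\<Sum>j\<in>{1..n}. ?y j ^ b j)"
  have "measure_pmf.prob (run gen sel n N T (Pi0 n)) ?bad
     = measure_pmf.expectation ?K (\<lambda>x. measure_pmf.prob (map_pmf ((#) x) (run gen sel n N T' (Pi_of n x))) ?bad)"
    by (simp add: measure_bind_pmf next_best_def T')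
  also have "\<dots> \<le> measure_pmf.expectation ?K (\<lambda>x. ?B)"
  proof (rule integral_mono_AE)
    show "integrable ?K (\<lambda>x. measure_pmf.prob (map_pmf ((#) x) (run gen sel n N T' (Pi_of n x))) ?bad)"
      by (rule measure_pmf.integrable_const_bound[where B=1]) auto
    show "AE x in ?K. measure_pmf.prob (map_pmf ((#) x) (run gen sel n N T' (Pi_of n x))) ?bad \<le> ?B"
    proof (rule AE_pmfI)
      fix x assume "x \<in> set_pmf ?K"
      then have hx: "hamiltonian_cycle n x" using set_next_best[OF sel] sup0 by blast
      show "measure_pmf.prob (map_pmf ((#) x) (run gen sel n N T' (Pi_of n x))) ?bad \<le> ?B"
      proof (cases "optimal n x")
        case True
        then have "(#) x -` ?bad = {}" by auto
        then show ?thesis unfolding measure_map_pmf by (simp only: measure_empty) (simp add: sum_nonneg)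
      next
        case False
        then have "(#) x -` ?bad = ?bad" by auto
        moreover have "level n x > 0" using False hx optimal_if_level_0 by blast
        ultimately show ?thesis using fail[OF hx, of T'] b T' by simp
      qed
    qed
  qed auto
  finally have "measure_pmf.prob (run gen sel n N T (Pi0 n)) ?bad \<le> ?B" by simp
  moreover have "found_prob gen sel n N T = 1 - measure_pmf.prob (run gen sel n N T (Pi0 n)) ?bad"
    unfolding found_prob_def using measure_pmf.prob_compl[of ?bad "run gen sel n N T (Pi0 n)"]
    by (simp add: set_diff_eq)
  moreover have "?y j ^ b j = exp (- q j * real N * real (b j))" for j
    by (simp flip: exp_of_nat_mult add: mult_ac)
  ultimately show ?thesis by simp
qed

section \<open>Vertex-based generation\<close>

lemma pmf_wchoice:
  assumes "finite A" "\<And>x. x \<in> A \<Longrightarrow> w x \<ge> 0" "sum w A > 0"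
  shows "pmf (wchoice w A) x = (if x \<in> A then w x / sum w A else 0)"
  unfolding wchoice_def
proof (rule pmf_embed_pmf)
  show "0 \<le> (if x \<in> A then w x / sum w A else 0)" for x
    using assms by simp
  have "(\<integral>\<^sup>+x. ennreal (if x \<in> A then w x / sum w A else 0) \<partial>count_space UNIV)
      = (\<Sum>x\<in>A. ennreal (w x / sum w A))"
    using assms(1) by (subst nn_integral_count_space'[where A=A]) auto
  also have "\<dots> = ennreal (\<Sum>x\<in>A. w x / sum w A)"
    using assms by (intro sum_ennreal) auto
  also have "(\<Sum>x\<in>A. w x / sum w A) = 1"
    using assms by (simp flip: sum_divide_distrib)
  finally show "(\<integral>\<^sup>+x. ennreal (if x \<in> A then w x / sum w A else 0) \<partial>count_space UNIV) = 1" by simp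
qed

lemma set_wchoice:
  assumes "finite A" "A \<noteq> {}" "\<And>x. x \<in> A \<Longrightarrow> w x > 0"
  shows "set_pmf (wchoice w A) = A"
proof -
  have s: "sum w A > 0" using assms by (intro sum_pos)
  have "w x / sum w A \<noteq> 0" if "x \<in> A" for x using s assms(3)[OF that] by simp
  then show ?thesis
    using pmf_wchoice[of A w, OF assms(1) less_imp_le[OF assms(3)] s] by (auto simp: set_pmf_eq)
qed

lemma prob_bind_wchoice:
  assumes "finite A" "A \<noteq> {}" "\<And>x. x \<in> A \<Longrightarrow> w x > 0"
  shows "measure_pmf.prob (bind_pmf (wchoice w A) g) S = (\<Sum>x\<in>A. w x * measure_pmf.prob (g x) S) / sum w A"
proof -
  have s: "sum w A > 0" using assms by (intro sum_pos)
  have "measure_pmf.prob (bind_pmf (wchoice w A) g) S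
      = (\<Sum>x\<in>A. measure_pmf.prob (g x) S * pmf (wchoice w A) x)"
    unfolding measure_bind_pmf
    by (rule integral_measure_pmf_real[OF assms(1)]) (use set_wchoice[of A w] assms in auto)
  also have "\<dots> = (\<Sum>x\<in>A. w x * measure_pmf.prob (g x) S / sum w A)"
    using pmf_wchoice[of A w, OF assms(1) less_imp_le[OF assms(3)] s] by (intro sum.cong) auto
  finally show ?thesis by (simp add: sum_divide_distrib)
qed

text \<open>The last identity is the point of the particular \<open>pi_min\<close>: one neighbour on
  the tour and the \<open>n - 2\<close> other vertices together weigh exactly 1.\<close>

lemma pi_bounds:
  assumes "n \<ge> 3"
  shows "pi_min n > 0" "pi_max n > 0" "pi_min n \<le> pi_max n" "pi_max n \<le> 1"
    "pi_max n + (real n - 2) * pi_min n = 1"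
proof -
  have n: "real n \<ge> 3" using assms by simp
  then show 1: "pi_min n > 0" "pi_max n > 0" "pi_max n \<le> 1" "pi_max n + (real n - 2) * pi_min n = 1"
    by (auto simp: pi_min_def pi_max_def field_simps)
  have "pi_min n * 1 \<le> pi_min n * (real n - 2)" using n 1(1) by (intro mult_left_mono) auto
  also have "\<dots> = 1 / real n" using n by (simp add: pi_min_def field_simps)
  also have "\<dots> \<le> pi_max n" using n by (simp add: pi_max_def field_simps)
  finally show "pi_min n \<le> pi_max n" by simp
qed

lemma Pi_of_pos: "n \<ge> 3 \<Longrightarrow> i \<noteq> j \<Longrightarrow> Pi_of n H i j > 0"
  using pi_bounds[of n] by (simp add: Pi_of_def)

lemma set_vpath:
  assumes "\<And>i j. i \<noteq> j \<Longrightarrow> P i j > 0"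
  shows "finite U \<Longrightarrow> card U = k \<Longrightarrow> v \<notin> U \<Longrightarrow> p \<in> set_pmf (vpath P k v U) \<Longrightarrow>
    distinct p \<and> set p = insert v U"
proof (induction k arbitrary: v U p)
  case (Suc k)
  have "U \<noteq> {}" using Suc.prems by auto
  moreover have "P v x > 0" if "x \<in> U" for x using that Suc.prems(3) by (intro assms) auto
  ultimately have "set_pmf (wchoice (\<lambda>v'. P v v') U) = U"
    using Suc.prems(1) by (intro set_wchoice)
  then obtain u q where u: "u \<in> U" "q \<in> set_pmf (vpath P k u (U - {u}))" "p = v # q"
    using Suc.prems by auto
  then have "distinct q \<and> set q = insert u (U - {u})"
    using Suc.prems by (intro Suc.IH) auto
  then show ?case using u Suc.prems by auto
qed auto

lemma vertex_gen_hamiltonian: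
  assumes "\<And>i j. i \<noteq> j \<Longrightarrow> P i j > 0" "n \<ge> 3" "x \<in> set_pmf (vertex_gen n P)"
  shows "hamiltonian_cycle n x"
proof -
  have "{1..n} \<noteq> {}" using assms(2) by auto
  then obtain v p where v: "v \<in> {1..n}" "p \<in> set_pmf (vpath P (n - 1) v ({1..n} - {v}))" "x = cycle_edges p"
    using assms(3) by (auto simp: vertex_gen_def)
  have "distinct p \<and> set p = insert v ({1..n} - {v})"
    by (rule set_vpath[OF assms(1) _ _ _ v(2)]) (use v(1) in auto)
  moreover have "insert v ({1..n} - {v}) = {1..n}" using v(1) by blast
  ultimately show ?thesis unfolding v(3) using assms(2) by (intro hamiltonian_cycleI) simp_all
qed

definition nbrs :: "nat set set \<Rightarrow> nat \<Rightarrow> nat set" where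
  "nbrs H v = {u. {v, u} \<in> H}"

lemma card_nbrs:
  assumes "hamiltonian_cycle n H"
  shows "card (nbrs H v) \<le> 2" "finite (nbrs H v)"
proof -
  have inj: "inj_on (\<lambda>u. {v, u}) (nbrs H v)" by (auto simp: inj_on_def doubleton_eq_iff)
  have im: "(\<lambda>u. {v, u}) ` nbrs H v \<subseteq> {e \<in> H. v \<in> e}" by (auto simp: nbrs_def)
  have fin: "finite {e \<in> H. v \<in> e}" using finite_hamiltonian_cycle[OF assms] by simp
  show "finite (nbrs H v)" using finite_imageD[OF finite_subset[OF im fin] inj] .
  have "card (nbrs H v) \<le> degree H v" unfolding degree_def
    using card_inj_on_le[OF inj im fin] .
  then show "card (nbrs H v) \<le> 2" using degree_hamiltonian_cycle[OF assms, of v] by (auto split: if_splits)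
qed

text \<open>With at most one tour neighbour among at most \<open>n - 1\<close> candidates, the total
  is bounded by the identity in \<open>pi_bounds\<close>; a second neighbour adds at most
  \<open>pi_max n - pi_min n\<close>, which is below 1.\<close>

lemma sum_Pi_of_le:
  assumes H: "hamiltonian_cycle n H" and "U \<subseteq> {1..n} - {v}" "v \<in> {1..n}"
  shows "(\<Sum>u\<in>U. Pi_of n H v u) \<le> (if card (nbrs H v \<inter> U) \<le> 1 then 1 else 2)"
proof -
  have n3: "n \<ge> 3" using H unfolding hamiltonian_cycle_def by auto
  note pb = pi_bounds[OF n3]
  have fin: "finite U" using assms finite_subset by blast
  have cU: "card U \<le> n - 1" using card_mono[OF _ assms(2)] assms(3) by simp
  let ?h = "card (nbrs H v \<inter> U)"
  have h2: "?h \<le> 2" using card_nbrs[OF H, of v] card_mono[of "nbrs H v" "nbrs H v \<inter> U"] by auto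
  have "(\<Sum>u\<in>U. Pi_of n H v u) = (\<Sum>u\<in>U. pi_min n + (if u \<in> nbrs H v then pi_max n - pi_min n else 0))"
    using assms(2) by (intro sum.cong) (auto simp: Pi_of_def nbrs_def)
  also have "\<dots> = real (card U) * pi_min n + real ?h * (pi_max n - pi_min n)"
    using fin by (simp add: sum.distrib sum.If_cases Int_commute)
  finally have eq: "(\<Sum>u\<in>U. Pi_of n H v u) = real (card U) * pi_min n + real ?h * (pi_max n - pi_min n)" .
  have c: "real (card U) * pi_min n \<le> (real n - 1) * pi_min n"
    using cU pb(1) n3 by (intro mult_right_mono) auto
  show ?thesis
  proof (cases "?h \<le> 1")
    case True
    have "real ?h * (pi_max n - pi_min n) \<le> 1 * (pi_max n - pi_min n)"
      using True pb by (intro mult_right_mono) auto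
    then show ?thesis using True eq c pb(5) by (simp add: algebra_simps)
  next
    case False
    have "real ?h * (pi_max n - pi_min n) \<le> 2 * (pi_max n - pi_min n)"
      using h2 pb by (intro mult_right_mono) auto
    then show ?thesis using False eq c pb by (simp add: algebra_simps)
  qed
qed

text \<open>A step along \<open>H\<close> costs only a factor \<open>1 - 1 / n\<close> when at most one neighbour is unvisited, which
  holds after every step along \<open>H\<close>. The factor \<open>1 / 2\<close> for the remaining positions is charged to the
  preceding step off \<open>H\<close>, or to the start.\<close>

lemma pmf_vpath_ge:
  assumes H: "hamiltonian_cycle n H"
  shows "distinct (v # ps) \<Longrightarrow> set (v # ps) \<subseteq> {1..n} \<Longrightarrow>
    pmf (vpath (Pi_of n H) (length ps) v (set ps)) (v # ps)
      \<ge> (if card (nbrs H v \<inter> set ps) \<le> 1 then 1 else 1 / 2) * (1 - 1 / real n) ^ length ps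
         * (1 / (4 * real n ^ 2)) ^ card (path_edges (v # ps) - H)"
proof (induction ps arbitrary: v)
  case (Cons u ps)
  have n3: "n \<ge> 3" using H unfolding hamiltonian_cycle_def by auto
  note pb = pi_bounds[OF n3]
  let ?U = "set (u # ps)" and ?\<alpha> = "1 - 1 / real n" and ?\<beta> = "1 / (4 * real n ^ 2)"
  let ?j = "card (path_edges (u # ps) - H)" and ?J = "card (path_edges (v # u # ps) - H)"
  let ?c = "if card (nbrs H v \<inter> ?U) \<le> 1 then 1 else (1 / 2 :: real)"
  let ?c' = "if card (nbrs H u \<inter> set ps) \<le> 1 then 1 else (1 / 2 :: real)"
  let ?W = "\<Sum>x\<in>?U. Pi_of n H v x"
  have \<alpha>: "?\<alpha> > 0" "pi_max n = ?\<alpha>" using n3 by (auto simp: pi_max_def)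
  have W: "?W > 0" using Cons.prems n3 by (intro sum_pos Pi_of_pos) auto
  have "?W \<le> (if card (nbrs H v \<inter> ?U) \<le> 1 then 1 else 2)"
    using Cons.prems by (intro sum_Pi_of_le[OF H]) auto
  then have cW: "?W * ?c \<le> 1"
    by (auto simp del: list.set split: if_splits)
  have "{v, u} \<notin> path_edges (u # ps)" using path_edges_in_set[of "{v,u}" "u # ps"] Cons.prems by auto
  then have J: "?J = (if {v, u} \<in> H then ?j else Suc ?j)"
    by (simp add: insert_Diff_if)
  have IH: "pmf (vpath (Pi_of n H) (length ps) u (set ps)) (u # ps) \<ge> ?c' * ?\<alpha> ^ length ps * ?\<beta> ^ ?j"
    using Cons.prems by (intro Cons.IH) auto
  have ev: "?U - {u} = set ps" using Cons.prems by auto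
  have "pmf (vpath (Pi_of n H) (length (u # ps)) v ?U) (v # u # ps)
      = measure_pmf.prob (vpath (Pi_of n H) (length (u # ps)) v ?U) {v # u # ps}"
    by (simp add: measure_pmf_single)
  also have "\<dots> = (\<Sum>x\<in>?U. Pi_of n H v x * measure_pmf.prob
        (bind_pmf (vpath (Pi_of n H) (length ps) x (?U - {x})) (\<lambda>p. return_pmf (v # p))) {v # u # ps}) / ?W"
    unfolding length_Cons vpath.simps
    using Cons.prems n3 by (intro prob_bind_wchoice) (auto intro!: Pi_of_pos)
  also have "\<dots> \<ge> Pi_of n H v u * measure_pmf.prob
        (bind_pmf (vpath (Pi_of n H) (length ps) u (?U - {u})) (\<lambda>p. return_pmf (v # p))) {v # u # ps} / ?W"
  proof (intro divide_right_mono member_le_sum)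
    show "0 \<le> Pi_of n H v x * measure_pmf.prob
        (bind_pmf (vpath (Pi_of n H) (length ps) x (?U - {x})) (\<lambda>p. return_pmf (v # p))) {v # u # ps}"
      if "x \<in> ?U - {u}" for x
    proof (intro mult_nonneg_nonneg)
      have "v \<noteq> x" using Cons.prems(1) that by auto
      then show "0 \<le> Pi_of n H v x" using Pi_of_pos[OF n3] less_imp_le by blast
    qed simp
  qed (use W in auto)
  also have "measure_pmf.prob (bind_pmf (vpath (Pi_of n H) (length ps) u (?U - {u})) (\<lambda>p. return_pmf (v # p))) {v # u # ps}
      = pmf (vpath (Pi_of n H) (length ps) u (set ps)) (u # ps)"
  proof -
    have "bind_pmf (vpath (Pi_of n H) (length ps) u (?U - {u})) (\<lambda>p. return_pmf (v # p))
        = map_pmf ((#) v) (vpath (Pi_of n H) (length ps) u (set ps))"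
      unfolding ev by (simp add: map_pmf_def)
    then show ?thesis using pmf_map_inj'[of "(#) v"] by (simp add: measure_pmf_single)
  qed
  finally have ge: "pmf (vpath (Pi_of n H) (length (u # ps)) v ?U) (v # u # ps)
      \<ge> Pi_of n H v u * pmf (vpath (Pi_of n H) (length ps) u (set ps)) (u # ps) / ?W" .
  have "v \<noteq> u" using Cons.prems by auto
  have "?c * ?\<alpha> ^ length (u # ps) * ?\<beta> ^ ?J * ?W \<le> Pi_of n H v u * (?c' * ?\<alpha> ^ length ps * ?\<beta> ^ ?j)"
  proof (cases "{v, u} \<in> H")
    case True
    \<comment> \<open>\<open>v\<close> is itself one of the at most two neighbours of
      \<open>u\<close> and is already visited.\<close>
    have "nbrs H u \<inter> set ps \<subseteq> nbrs H u - {v}" using Cons.prems by auto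
    then have "card (nbrs H u \<inter> set ps) \<le> card (nbrs H u - {v})"
      using card_nbrs[OF H, of u] by (intro card_mono) auto
    also have "v \<in> nbrs H u" using True by (simp add: nbrs_def insert_commute)
    then have "card (nbrs H u - {v}) \<le> 1" using card_nbrs[OF H, of u] by simp
    finally have c': "?c' = 1" by simp
    have "?c * ?\<alpha> ^ length (u # ps) * ?\<beta> ^ ?J * ?W = (?W * ?c) * (?\<alpha> * ?\<alpha> ^ length ps * ?\<beta> ^ ?j)"
      using True J by simp
    also have "\<dots> \<le> 1 * (?\<alpha> * ?\<alpha> ^ length ps * ?\<beta> ^ ?j)"
      using cW \<alpha> by (intro mult_right_mono mult_nonneg_nonneg) auto
    also have "\<dots> = Pi_of n H v u * (1 * ?\<alpha> ^ length ps * ?\<beta> ^ ?j)"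
      using True \<alpha> \<open>v \<noteq> u\<close> by (simp add: Pi_of_def)
    finally show ?thesis unfolding c' .
  next
    case False
    have mn: "pi_min n \<ge> 1 / real n ^ 2"
      unfolding pi_min_def power2_eq_square using n3 by (intro divide_left_mono mult_left_mono mult_pos_pos) auto
    have "?c * ?\<alpha> ^ length (u # ps) * ?\<beta> ^ ?J * ?W = (?W * ?c) * ?\<alpha> * (?\<beta> * (?\<alpha> ^ length ps * ?\<beta> ^ ?j))"
      using False J by simp
    also have "\<dots> \<le> 1 * (?\<beta> * (?\<alpha> ^ length ps * ?\<beta> ^ ?j))"
      using \<alpha> by (intro mult_right_mono mult_le_one[OF cW] mult_nonneg_nonneg zero_le_power) auto
    also have "\<dots> = (?\<beta> * 2) * (1 / 2 * (?\<alpha> ^ length ps * ?\<beta> ^ ?j))" by simp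
    also have "\<dots> \<le> pi_min n * (?c' * (?\<alpha> ^ length ps * ?\<beta> ^ ?j))"
      using \<alpha> mn pb(1) by (intro mult_mono mult_right_mono mult_nonneg_nonneg)
        (auto intro: order_trans[OF _ mn] simp: field_simps)
    also have "\<dots> = Pi_of n H v u * (?c' * ?\<alpha> ^ length ps * ?\<beta> ^ ?j)"
      using False \<open>v \<noteq> u\<close> by (simp add: Pi_of_def)
    finally show ?thesis .
  qed
  also have "\<dots> \<le> Pi_of n H v u * pmf (vpath (Pi_of n H) (length ps) u (set ps)) (u # ps)"
    using IH Pi_of_pos[OF n3 \<open>v \<noteq> u\<close>, of H] by (intro mult_left_mono) auto
  finally have "?c * ?\<alpha> ^ length (u # ps) * ?\<beta> ^ ?J
      \<le> Pi_of n H v u * pmf (vpath (Pi_of n H) (length ps) u (set ps)) (u # ps) / ?W"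
    using W by (simp add: pos_le_divide_eq)
  with ge show ?case by linarith
qed simp

text \<open>With \<open>m = n - 1\<close>, the number \<open>1 - 1 / n\<close> is the inverse of
  \<open>1 + 1 / m\<close>, and \<open>(1 + 1 / m) ^ m\<close> is at most
  \<open>exp 1\<close>.\<close>

lemma one_minus_inverse_power_ge: "n \<ge> 2 \<Longrightarrow> (1 - 1 / real n) ^ (n - 1) \<ge> exp (- 1)"
proof -
  assume n: "n \<ge> 2"
  define m where "m = n - 1"
  have m: "m > 0" "real n = real m + 1" using n by (auto simp: m_def)
  have "(1 + 1 / real m) ^ m \<le> exp (1 / real m) ^ m"
    by (intro power_mono) auto
  also have "\<dots> = exp 1" using m by (simp flip: exp_of_nat_mult)
  finally have "exp (- 1) \<le> 1 / (1 + 1 / real m) ^ m"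
    using m by (simp add: exp_minus field_simps)
  also have "\<dots> = (1 - 1 / real n) ^ m"
    using m by (simp add: power_one_over[symmetric] field_simps)
  finally show ?thesis by (simp add: m_def)
qed

text \<open>The \<open>n - 1\<close> factors \<open>1 - 1 / n\<close> multiply to at least
  \<open>exp (- 1)\<close>; the factor 1/2 covers the start, where both tour neighbours are
  unvisited.\<close>

lemma prob_vpath_ge:
  assumes H: "hamiltonian_cycle n H" and v: "distinct (v # ps)" "set (v # ps) = {1..n}"
    and j: "card (path_edges (v # ps) - H) \<le> j"
  shows "measure_pmf.prob (map_pmf cycle_edges (vpath (Pi_of n H) (n - 1) v ({1..n} - {v}))) {cycle_edges (v # ps)}
     \<ge> exp (- 1) / 2 * (1 / (4 * real n ^ 2)) ^ j"
proof -
  have n3: "n \<ge> 3" using H unfolding hamiltonian_cycle_def by auto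
  have ps: "length ps = n - 1" "set ps = {1..n} - {v}"
    using distinct_card[OF v(1)] v by auto
  let ?\<beta> = "1 / (4 * real n ^ 2)"
  have "(1::real) \<le> real n ^ 2" using n3 by (intro one_le_power) auto
  then have "1 \<le> 4 * real n ^ 2" by linarith
  then have "?\<beta> \<le> 1" using n3 by simp
  then have pj: "?\<beta> ^ j \<le> ?\<beta> ^ card (path_edges (v # ps) - H)"
    using j by (intro power_decreasing) auto
  have "exp (- 1) / 2 * ?\<beta> ^ j \<le> 1 / 2 * (1 - 1 / real n) ^ (n - 1) * ?\<beta> ^ j"
    using one_minus_inverse_power_ge[of n] n3 by (intro mult_right_mono) auto
  also have "\<dots> \<le> (if card (nbrs H v \<inter> set ps) \<le> 1 then 1 else 1 / 2) * (1 - 1 / real n) ^ length ps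
         * ?\<beta> ^ card (path_edges (v # ps) - H)"
    using pj n3 unfolding ps(1) by (intro mult_mono mult_right_mono mult_nonneg_nonneg zero_le_power) auto
  also have "\<dots> \<le> pmf (vpath (Pi_of n H) (length ps) v (set ps)) (v # ps)"
    using v by (intro pmf_vpath_ge[OF H]) auto
  also have "\<dots> = measure_pmf.prob (vpath (Pi_of n H) (n - 1) v ({1..n} - {v})) {v # ps}"
    using ps by (simp add: measure_pmf_single)
  also have "\<dots> \<le> measure_pmf.prob (map_pmf cycle_edges (vpath (Pi_of n H) (n - 1) v ({1..n} - {v}))) {cycle_edges (v # ps)}"
    unfolding measure_map_pmf by (intro measure_pmf.finite_measure_mono) auto
  finally show ?thesis .
qed

lemma prob_vertex_gen:
  assumes "n > 0"
  shows "measure_pmf.prob (vertex_gen n P) S =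
    (\<Sum>v\<in>{1..n}. measure_pmf.prob (map_pmf cycle_edges (vpath P (n - 1) v ({1..n} - {v}))) S) / real n"
  unfolding vertex_gen_def measure_bind_pmf using assms
  by (subst integral_pmf_of_set) auto

lemma prob_vertex_gen_same:
  assumes H: "hamiltonian_cycle n H"
  shows "measure_pmf.prob (vertex_gen n (Pi_of n H)) {H} \<ge> exp (- 1) / 2"
proof -
  have n3: "n \<ge> 3" using H unfolding hamiltonian_cycle_def by auto
  have "exp (- 1) / 2 \<le> measure_pmf.prob (map_pmf cycle_edges (vpath (Pi_of n H) (n - 1) v ({1..n} - {v}))) {H}"
    if v: "v \<in> {1..n}" for v
  proof -
    obtain ws where ws: "distinct (v # ws)" "set (v # ws) = {1..n}" "H = cycle_edges (v # ws)"
      using hamiltonian_cycle_start[OF H v] by metis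
    then have "path_edges (v # ws) - H = {}" using path_edges_subset_cycle_edges by blast
    then show ?thesis using prob_vpath_ge[OF H ws(1,2), of 0] ws(3) by simp
  qed
  then have "(\<Sum>v\<in>{1..n}. exp (- 1) / 2) \<le>
      (\<Sum>v\<in>{1..n}. measure_pmf.prob (map_pmf cycle_edges (vpath (Pi_of n H) (n - 1) v ({1..n} - {v}))) {H})"
    by (intro sum_mono) auto
  then show ?thesis using n3 by (simp add: prob_vertex_gen field_simps)
qed

text \<open>Starting the tour right after a new edge makes that edge the closing one, which is free.\<close>

lemma prob_vertex_gen_new:
  assumes H: "hamiltonian_cycle n H" and H': "hamiltonian_cycle n H'"
    and f: "f \<in> H' - H" and j: "card (H' - H) \<le> Suc j"
  shows "measure_pmf.prob (vertex_gen n (Pi_of n H)) {H'} \<ge> exp (- 1) / (2 * real n) * (1 / (4 * real n ^ 2)) ^ j"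
proof -
  have n3: "n \<ge> 3" using H unfolding hamiltonian_cycle_def by auto
  obtain a b where ab: "f = {a, b}" "a \<in> {1..n}" "b \<in> {1..n}"
    using f hamiltonian_cycle_subset_Kn[OF H'] Kn_edgesE by (metis DiffD1 subsetD)
  obtain ws where ws: "distinct (b # ws)" "set (b # ws) = {1..n}" "length (b # ws) = n" "H' = cycle_edges (b # ws)"
    using hamiltonian_cycle_start[OF H' ab(3)] by metis
  have "length ws \<ge> 2" using ws(3) n3 by simp
  then have ne: "ws \<noteq> []" by auto
  have "f \<in> {e \<in> H'. b \<in> e}" using f ab by auto
  then have "f = {b, hd ws} \<or> f = {b, last ws}"
    using cycle_edges_at_hd[OF ws(1) \<open>length ws \<ge> 2\<close>] ws(4) by auto
  then have "\<exists>vs. distinct vs \<and> set vs = {1..n} \<and> length vs = n \<and> H' = cycle_edges vs \<and> f = {last vs, hd vs}"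
  proof
    assume "f = {b, hd ws}"
    then show ?thesis
      using ws ne cycle_edges_append_commute[of "[b]" ws] by (intro exI[of _ "ws @ [b]"]) auto
  next
    assume "f = {b, last ws}"
    then show ?thesis using ws ne by (intro exI[of _ "b # ws"]) auto
  qed
  then obtain vs where vs: "distinct vs" "set vs = {1..n}" "length vs = n" "H' = cycle_edges vs" "f = {last vs, hd vs}"
    by blast
  obtain v ps where vps: "vs = v # ps" using vs(3) n3 by (cases vs) auto
  have "path_edges vs - H \<subseteq> (H' - H) - {f}"
    using last_hd_notin_path_edges[of vs] path_edges_subset_cycle_edges[of vs] vs n3 by auto
  then have "card (path_edges vs - H) \<le> card ((H' - H) - {f})"
    using finite_hamiltonian_cycle[OF H'] by (intro card_mono) auto
  also have "\<dots> \<le> j" using f j finite_hamiltonian_cycle[OF H'] by simp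
  finally have c: "card (path_edges (v # ps) - H) \<le> j" by (simp add: vps)
  have v: "v \<in> {1..n}" using vs(2) vps by auto
  have "exp (- 1) / 2 * (1 / (4 * real n ^ 2)) ^ j
     \<le> measure_pmf.prob (map_pmf cycle_edges (vpath (Pi_of n H) (n - 1) v ({1..n} - {v}))) {H'}"
    using prob_vpath_ge[OF H _ _ c] vs vps by simp
  also have "\<dots> \<le> (\<Sum>v\<in>{1..n}. measure_pmf.prob (map_pmf cycle_edges (vpath (Pi_of n H) (n - 1) v ({1..n} - {v}))) {H'})"
    using v by (intro member_le_sum) auto
  finally have "exp (- 1) / 2 * (1 / (4 * real n ^ 2)) ^ j / real n \<le> measure_pmf.prob (vertex_gen n (Pi_of n H)) {H'}"
    using n3 unfolding prob_vertex_gen[OF less_le_trans[OF zero_less_numeral n3]]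
    by (intro divide_right_mono) auto
  then show ?thesis by simp
qed

lemma prob_vertex_gen_improve:
  assumes H: "hamiltonian_cycle n H" and l: "level n H > 0"
  shows "measure_pmf.prob (vertex_gen n (Pi_of n H)) {x. level n x < level n H} \<ge> exp (- 1) / 32 / real n ^ 5"
proof -
  have n3: "n \<ge> 3" using H unfolding hamiltonian_cycle_def by auto
  obtain f where f: "f \<in> unit_cycle n - H" using l card_unit_minus[OF H] by (metis card.empty ex_in_conv less_irrefl)
  from improvement_exists[OF H f] obtain a b e1 g1 e2 g2 E3 Q E where
    ex: "exchange n H f a b e1 g1 e2 g2 E3 Q E" and
    lt: "level n (exchange.new_cycle H f e1 e2 E3 E) < level n H" by metis
  interpret exchange n H f a b e1 g1 e2 g2 E3 Q E by (fact ex)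
  \<comment> \<open>At most three edges are new and one of them closes the tour. One factor
    \<open>n\<close> pays for the start vertex, and two steps off \<open>H\<close> cost
    \<open>4 * n ^ 2\<close> each.\<close>
  have "exp (- 1) / 32 / real n ^ 5 = exp (- 1) / (2 * real n) * (1 / (4 * real n ^ 2)) ^ 2"
    by (simp add: power_divide power_mult_distrib flip: power_mult) (simp add: field_simps eval_nat_numeral)
  also have "\<dots> \<le> measure_pmf.prob (vertex_gen n (Pi_of n H)) {new_cycle}"
    using new_cycle_diff f by (intro prob_vertex_gen_new[OF H ham'[folded new_cycle_def], of f]) auto
  also have "\<dots> \<le> measure_pmf.prob (vertex_gen n (Pi_of n H)) {x. level n x < level n H}"
    using lt by (intro measure_pmf.finite_measure_mono) auto
  finally show ?thesis .
qed

section \<open>Edge-based generation\<close>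

lemma finite_admissible [simp]: "finite {e. admissible n B e}"
  by (rule finite_subset[of _ "Kn_edges n"]) (auto simp: admissible_def)

text \<open>Degrees within \<open>H\<close> are at most 2, and the only cycle inside
  \<open>H\<close> is \<open>H\<close> itself, which is not short.\<close>

lemma admissible_if_subset_hamiltonian:
  assumes H: "hamiltonian_cycle n H" and "insert e B \<subseteq> H" "e \<notin> B"
  shows "admissible n B e"
  unfolding admissible_def
proof (intro conjI allI notI)
  show "e \<in> Kn_edges n" using hamiltonian_cycle_subset_Kn[OF H] assms by auto
  show "degree (insert e B) v \<le> 2" for v
  proof -
    have "degree (insert e B) v \<le> degree H v" unfolding degree_def
      using assms(2) finite_hamiltonian_cycle[OF H] by (intro card_mono) auto
    then show ?thesis using degree_hamiltonian_cycle[OF H, of v] by (auto split: if_splits)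
  qed
  assume "\<exists>C\<subseteq>insert e B. is_cycle C \<and> card C < n"
  then obtain C where C: "C \<subseteq> insert e B" "is_cycle C" "card C < n" by blast
  then have "C = H" using is_cycle_subset_hamiltonian_cycle[OF H C(2)] assms(2) by blast
  then show False using C(3) card_hamiltonian_cycle[OF H] by simp
qed (use assms in auto)

section \<open>Partial tours as disjoint paths; edge-based generation ends in a tour\<close>

lemma three_edges_degree:
  assumes "finite B" "x \<in> B" "y \<in> B" "z \<in> B" "x \<noteq> y" "x \<noteq> z" "y \<noteq> z" "v \<in> x" "v \<in> y" "v \<in> z"
  shows "degree B v \<ge> 3"
proof -
  have "card {x, y, z} \<le> degree B v" unfolding degree_def
    using assms by (intro card_mono) auto
  then show ?thesis using assms by simp
qed

text \<open>The shape of every unfinished edge set reached by \<open>egen\<close>: disjoint paths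
  through all vertices, isolated vertices being one-element lists. The number of paths equals the
  number of edges still missing, so it can match the recursion counter of
  \<open>egen\<close>.\<close>

definition path_cover :: "nat \<Rightarrow> nat list set \<Rightarrow> nat set set \<Rightarrow> bool" where
  "path_cover n P B \<longleftrightarrow> finite P \<and> (\<forall>xs\<in>P. xs \<noteq> [] \<and> distinct xs) \<and>
     (\<forall>xs\<in>P. \<forall>ys\<in>P. xs \<noteq> ys \<longrightarrow> set xs \<inter> set ys = {}) \<and>
     (\<Union>xs\<in>P. set xs) = {1..n} \<and> B = (\<Union>xs\<in>P. path_edges xs)"

lemma path_cover_singletons: "path_cover n ((\<lambda>i. [i]) ` {1..n}) {}"
  by (auto simp: path_cover_def)

lemma path_cover_finite: "path_cover n P B \<Longrightarrow> finite B"
  by (auto simp: path_cover_def)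

text \<open>Concatenating the paths in any order and closing the result gives such a cycle. Hence an
  unfinished edge set always has an admissible continuation.\<close>

lemma path_cover_subset_hamiltonian:
  assumes "path_cover n P B" "n \<ge> 3"
  obtains H where "hamiltonian_cycle n H" "B \<subseteq> H"
proof -
  have "finite P" using assms(1) by (simp add: path_cover_def)
  then obtain xss where xss: "set xss = P" "distinct xss"
    using finite_distinct_list by metis
  have "distinct (concat xss)"
    using assms(1) xss unfolding path_cover_def by (intro distinct_concat) auto
  moreover have "set (concat xss) = {1..n}"
    using assms(1) xss unfolding path_cover_def by simp
  ultimately have "hamiltonian_cycle n (cycle_edges (concat xss))"
    using assms(2) by (intro hamiltonian_cycleI)
  moreover have "path_edges xs \<subseteq> path_edges (concat xss)" if xs: "xs \<in> set xss" for xs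
  proof (cases "xs = []")
    case False
    obtain as bs where "xss = as @ xs # bs" using xs by (meson in_set_conv_decomp)
    then have eq: "concat xss = concat as @ xs @ concat bs" by simp
    have 1: "path_edges xs \<subseteq> path_edges (xs @ ys)" for ys
      using False by (cases "ys = []") (auto simp: path_edges_append)
    have 2: "path_edges ys \<subseteq> path_edges (zs @ ys)" for zs ys :: "nat list"
      by (cases "ys = []"; cases "zs = []") (auto simp: path_edges_append)
    show ?thesis unfolding eq by (rule subset_trans[OF 1 2])
  qed simp
  then have "(\<Union>xs\<in>set xss. path_edges xs) \<subseteq> cycle_edges (concat xss)"
    using path_edges_subset_cycle_edges[of "concat xss"] by blast
  moreover have "B = (\<Union>xs\<in>set xss. path_edges xs)" using assms(1) xss(1) by (simp add: path_cover_def)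
  ultimately show thesis using that by blast
qed

lemma path_cover_merge:
  assumes P: "path_cover n P B" and xy: "xs \<in> P" "ys \<in> P" "xs \<noteq> ys"
    and xs': "xs' \<in> {xs, rev xs}" and ys': "ys' \<in> {ys, rev ys}"
  shows "path_cover n (insert (xs' @ ys') (P - {xs, ys})) (insert {last xs', hd ys'} B)"
    "Suc (card (insert (xs' @ ys') (P - {xs, ys}))) = card P"
proof -
  note P' = P[unfolded path_cover_def]
  have s: "set xs' = set xs" "set ys' = set ys" "path_edges xs' = path_edges xs" "path_edges ys' = path_edges ys"
    "xs' \<noteq> []" "ys' \<noteq> []" "distinct xs'" "distinct ys'"
    using xs' ys' P' xy by (auto simp: path_edges_rev)
  have dis: "set xs \<inter> set ys = {}" using P' xy by blast
  have dis': "set zs \<inter> set (xs' @ ys') = {}" if "zs \<in> P - {xs, ys}" for zs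
  proof -
    have "zs \<in> P" "zs \<noteq> xs" "zs \<noteq> ys" using that by auto
    then have "set zs \<inter> set xs = {}" "set zs \<inter> set ys = {}" using P' xy(1,2) by metis+
    then show ?thesis using s by auto
  qed
  have split: "P = insert xs (insert ys (P - {xs, ys}))" using xy by blast
  have "(\<Union>zs\<in>P. set zs) = set xs \<union> set ys \<union> (\<Union>zs\<in>P - {xs, ys}. set zs)"
    using xy by blast
  moreover have "(\<Union>zs\<in>P. path_edges zs) = path_edges xs \<union> path_edges ys \<union> (\<Union>zs\<in>P - {xs, ys}. path_edges zs)"
    using xy by blast
  ultimately have un: "(\<Union>zs\<in>insert (xs' @ ys') (P - {xs, ys}). set zs) = {1..n}"
    "insert {last xs', hd ys'} B = (\<Union>zs\<in>insert (xs' @ ys') (P - {xs, ys}). path_edges zs)"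
    using P' s by (simp_all add: path_edges_append)
  have pair: "set zs \<inter> set zs' = {}"
    if "zs \<in> insert (xs' @ ys') (P - {xs, ys})" "zs' \<in> insert (xs' @ ys') (P - {xs, ys})" "zs \<noteq> zs'" for zs zs'
    using that dis'[of zs] dis'[of zs'] P' by (metis DiffD1 Int_commute insertE)
  show "path_cover n (insert (xs' @ ys') (P - {xs, ys})) (insert {last xs', hd ys'} B)"
    unfolding path_cover_def using P' s dis un pair by simp
  have "xs' @ ys' \<notin> P - {xs, ys}"
  proof
    assume "xs' @ ys' \<in> P - {xs, ys}"
    from dis'[OF this] s(5) show False by simp
  qed
  moreover have "card P = Suc (Suc (card (P - {xs, ys})))"
    using P' xy by (subst split) (simp add: card_insert_disjoint)
  ultimately show "Suc (card (insert (xs' @ ys') (P - {xs, ys}))) = card P" using P' by simp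
qed

text \<open>An inner vertex of a path already has degree 2.\<close>

lemma path_cover_admissible_end:
  assumes P: "path_cover n P B" and e: "admissible n B e" "u \<in> e" and xs: "xs \<in> P" "u \<in> set xs"
  shows "u = hd xs \<or> u = last xs"
proof (rule ccontr)
  assume not: "\<not> ?thesis"
  note P' = P[unfolded path_cover_def]
  obtain as bs where ab: "xs = as @ u # bs" using xs(2) by (auto simp: in_set_conv_decomp)
  have ne: "as \<noteq> []" "bs \<noteq> []" using not ab by auto
  have "path_edges xs = insert {last as, u} (path_edges as \<union> insert {u, hd bs} (path_edges bs))"
    using ab ne by (simp add: path_edges_append path_edges_Cons)
  then have inB: "{last as, u} \<in> B" "{u, hd bs} \<in> B" using P' xs by blast+
  have d: "distinct xs" using P' xs by blast
  have "last as \<in> set as" "hd bs \<in> set bs" using ne by auto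
  then have "last as \<noteq> hd bs" "last as \<noteq> u" using d ab by auto
  then have "{last as, u} \<noteq> {u, hd bs}" by (auto simp: doubleton_eq_iff)
  moreover have "e \<notin> B" using e by (auto simp: admissible_def)
  ultimately have "degree (insert e B) u \<ge> 3"
    using inB e path_cover_finite[OF P]
    by (intro three_edges_degree[of _ e "{last as, u}" "{u, hd bs}"]) auto
  then show False using e unfolding admissible_def by (metis not_less_eq_eq numeral_2_eq_2 numeral_3_eq_3)
qed

text \<open>An admissible edge joins ends of paths. If the paths differ, they merge; if they agree,
  the path closes to a cycle, which admissibility allows only with \<open>n\<close> edges.\<close>

lemma path_cover_insert_admissible:
  assumes P: "path_cover n P B" and e: "admissible n B e" and n: "n \<ge> 3"
  shows "hamiltonian_cycle n (insert e B) \<or> (\<exists>P'. path_cover n P' (insert e B) \<and> Suc (card P') = card P)"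
proof -
  note P' = P[unfolded path_cover_def]
  obtain u v where uv: "e = {u, v}" "u \<noteq> v" "u \<in> {1..n}" "v \<in> {1..n}"
    using e Kn_edgesE unfolding admissible_def by metis
  obtain xs ys where xy: "xs \<in> P" "ys \<in> P" "u \<in> set xs" "v \<in> set ys"
    using P' uv by (metis UN_E)
  have eB: "e \<notin> B" using e by (auto simp: admissible_def)
  have ux: "u = hd xs \<or> u = last xs" and vy: "v = hd ys \<or> v = last ys"
    using path_cover_admissible_end[OF P e] uv(1) xy by auto
  have ne: "xs \<noteq> []" "ys \<noteq> []" using xy by auto
  show ?thesis
  proof (cases "xs = ys")
    case False
    have "\<exists>xs'\<in>{xs, rev xs}. last xs' = u" using ux ne by (auto simp: last_rev)
    then obtain xs' where xs': "xs' \<in> {xs, rev xs}" "last xs' = u" by blast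
    have "\<exists>ys'\<in>{ys, rev ys}. hd ys' = v" using vy ne by (auto simp: hd_rev)
    then obtain ys' where ys': "ys' \<in> {ys, rev ys}" "hd ys' = v" by blast
    show ?thesis using path_cover_merge[OF P xy(1,2) False xs'(1) ys'(1)] xs' ys' uv(1) by auto
  next
    case True
    have d: "distinct xs" using P' xy by blast
    have e_eq: "e = {last xs, hd xs}" using ux vy True uv(1,2) by auto
    have "length xs \<ge> 3"
    proof (rule ccontr)
      assume "\<not> ?thesis"
      moreover have "card {u, v} \<le> length xs"
        using xy True distinct_card[OF d] card_mono[of "set xs" "{u, v}"] by simp
      ultimately have "length xs = Suc (Suc 0)" using uv(2) by simp
      then obtain x y where "xs = [x, y]" by (auto simp: length_Suc_conv)
      then have "e \<in> path_edges xs" using e_eq by (simp add: insert_commute)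
      then show False using eB P' xy by blast
    qed
    have cyc: "cycle_edges xs = insert e (path_edges xs)" using e_eq ne by (simp add: cycle_edges_conv_path)
    have "path_edges xs \<subseteq> B" using P' xy by blast
    then have "cycle_edges xs \<subseteq> insert e B" using cyc by auto
    moreover have "is_cycle (cycle_edges xs)" using d \<open>length xs \<ge> 3\<close> unfolding is_cycle_def by blast
    ultimately have "\<not> card (cycle_edges xs) < n" using e unfolding admissible_def by blast
    then have "length xs \<ge> n" using card_cycle_edges[OF d \<open>length xs \<ge> 3\<close>] by simp
    moreover have sub: "set xs \<subseteq> {1..n}" using P' xy by blast
    ultimately have all: "set xs = {1..n}" using distinct_card[OF d]
      by (metis card_atLeastAtMost card_seteq diff_Suc_1 finite_atLeastAtMost)
    have "zs = xs" if "zs \<in> P" for zs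
    proof (rule ccontr)
      assume "zs \<noteq> xs"
      then have "set zs \<inter> set xs = {}" "zs \<noteq> []" "set zs \<subseteq> {1..n}" using P' xy that by blast+
      moreover from this have "hd zs \<in> set zs" by simp
      ultimately show False unfolding all by blast
    qed
    then have "P = {xs}" using xy by blast
    then have "B = path_edges xs" using P' by simp
    then have "insert e B = cycle_edges xs" using cyc by simp
    then show ?thesis using hamiltonian_cycleI[OF d all n] by simp
  qed
qed

lemma egen_hamiltonian: "hamiltonian_cycle n B \<Longrightarrow> egen n P k B = return_pmf B"
  by (cases k) auto

text \<open>Each addition either completes the tour or lowers the number of paths by one. The
  counter cannot reach 0 before completion, since no paths would be left to cover the
  vertices.\<close>

lemma set_egen:
  assumes w: "\<And>e. e \<in> Kn_edges n \<Longrightarrow> edge_weight P e > 0" and n: "n \<ge> 3"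
  shows "path_cover n \<P> B \<Longrightarrow> card \<P> = k \<Longrightarrow> x \<in> set_pmf (egen n P k B) \<Longrightarrow> hamiltonian_cycle n x"
proof (induction k arbitrary: B \<P>)
  case 0
  then have "{1..n} = {}" unfolding path_cover_def by auto
  then show ?case using n by auto
next
  case (Suc k)
  show ?case
  proof (cases "hamiltonian_cycle n B")
    case False
    obtain H where H: "hamiltonian_cycle n H" "B \<subseteq> H"
      using path_cover_subset_hamiltonian[OF Suc.prems(1) n] by blast
    then have "B \<noteq> H" using False by auto
    then obtain e0 where "e0 \<in> H" "e0 \<notin> B" using H(2) by blast
    then have "admissible n B e0" using H by (intro admissible_if_subset_hamiltonian[of n H]) auto
    then have ne: "{e. admissible n B e} \<noteq> {}" by blast
    have "set_pmf (wchoice (edge_weight P) {e. admissible n B e}) = {e. admissible n B e}"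
      using ne w by (intro set_wchoice) (auto simp: admissible_def)
    then obtain e where e: "admissible n B e" "x \<in> set_pmf (egen n P k (insert e B))"
      using Suc.prems(3) False by auto
    from path_cover_insert_admissible[OF Suc.prems(1) e(1) n] show ?thesis
    proof
      assume "hamiltonian_cycle n (insert e B)"
      then show ?thesis using e(2) by (simp add: egen_hamiltonian)
    next
      assume "\<exists>P'. path_cover n P' (insert e B) \<and> Suc (card P') = card \<P>"
      then show ?thesis using Suc.IH[OF _ _ e(2)] Suc.prems(2) by auto
    qed
  qed (use Suc.prems in simp)
qed

lemma edge_weight_doubleton: "i \<noteq> j \<Longrightarrow> edge_weight P {i, j} = P i j + P j i"
  unfolding edge_weight_def by (simp add: insert_Diff_if)

lemma edge_gen_hamiltonian:
  assumes "\<And>i j. i \<noteq> j \<Longrightarrow> P i j > 0" "n \<ge> 3" "x \<in> set_pmf (edge_gen n P)"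
  shows "hamiltonian_cycle n x"
proof (rule set_egen[OF _ assms(2) path_cover_singletons])
  show "edge_weight P e > 0" if "e \<in> Kn_edges n" for e
    using that assms(1) by (auto elim!: Kn_edgesE simp: edge_weight_doubleton add_pos_pos)
  show "card ((\<lambda>i. [i]) ` {1..n}) = n" by (subst card_image) (auto simp: inj_on_def)
qed (use assms(3) in \<open>simp add: edge_gen_def\<close>)

text \<open>An admissible edge joins two vertices of degree at most 1. The degree deficits
  \<open>2 - degree B v\<close> sum to \<open>2 * r\<close>, so there are at most
  \<open>2 * r\<close> such vertices.\<close>

lemma card_admissible_le:
  assumes H: "hamiltonian_cycle n H" and B: "B \<subseteq> H" "card B = n - r" "r \<le> n"
  shows "card {e. admissible n B e} \<le> (2 * r) choose 2"
proof -
  let ?D = "{v \<in> {1..n}. degree B v \<le> 1}"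
  have finB: "finite B" using B finite_hamiltonian_cycle[OF H] finite_subset by blast
  have deg2: "degree B v \<le> 2" for v
  proof -
    have "degree B v \<le> degree H v" unfolding degree_def
      using B finite_hamiltonian_cycle[OF H] by (intro card_mono) auto
    then show ?thesis using degree_hamiltonian_cycle[OF H, of v] by (auto split: if_splits)
  qed
  have "(\<Sum>v\<in>{1..n}. degree B v) = (\<Sum>v\<in>{1..n}. \<Sum>e\<in>B. if v \<in> e then 1 else 0)"
    unfolding degree_def using finB by (intro sum.cong) (auto simp: sum.If_cases Int_def conj_commute)
  also have "\<dots> = (\<Sum>e\<in>B. \<Sum>v\<in>{1..n}. if v \<in> e then 1 else 0)" by (rule sum.swap)
  also have "\<dots> = (\<Sum>e\<in>B. 2)"
  proof (rule sum.cong[OF refl])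
    fix e assume "e \<in> B"
    then have "e \<in> Kn_edges n" using B hamiltonian_cycle_subset_Kn[OF H] by blast
    then obtain i j where ij: "e = {i, j}" "i \<noteq> j" "i \<in> {1..n}" "j \<in> {1..n}" by (rule Kn_edgesE)
    then have "{1..n} \<inter> {v. v \<in> e} = {i, j}" by auto
    then show "(\<Sum>v\<in>{1..n}. if v \<in> e then 1 else 0) = (2::nat)" using ij by (simp add: sum.If_cases)
  qed
  finally have sumdeg: "(\<Sum>v\<in>{1..n}. degree B v) = 2 * card B" by simp
  have "card ?D = (\<Sum>v\<in>?D. 1)" by simp
  also have "\<dots> \<le> (\<Sum>v\<in>?D. 2 - degree B v)" by (intro sum_mono) auto
  also have "\<dots> \<le> (\<Sum>v\<in>{1..n}. 2 - degree B v)" by (intro sum_mono2) auto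
  also have "\<dots> = (\<Sum>v\<in>{1..n}. 2) - (\<Sum>v\<in>{1..n}. degree B v)"
    using deg2 by (intro sum_subtractf_nat) auto
  also have "\<dots> = 2 * r" using sumdeg B by simp
  finally have D: "card ?D \<le> 2 * r" .
  have "{e. admissible n B e} \<subseteq> {e. e \<subseteq> ?D \<and> card e = 2}"
  proof
    fix e assume "e \<in> {e. admissible n B e}"
    then have e: "e \<in> Kn_edges n" "e \<notin> B" "\<And>v. degree (insert e B) v \<le> 2"
      by (auto simp: admissible_def)
    from e(1) obtain i j where ij: "e = {i, j}" "i \<noteq> j" "i \<in> {1..n}" "j \<in> {1..n}" by (rule Kn_edgesE)
    have "degree B v \<le> 1" if "v \<in> e" for v
    proof -
      have "{x \<in> insert e B. v \<in> x} = insert e {x \<in> B. v \<in> x}" using that by auto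
      then have "degree (insert e B) v = Suc (degree B v)"
        unfolding degree_def using finB e(2) by simp
      then show ?thesis using e(3)[of v] by simp
    qed
    then show "e \<in> {e. e \<subseteq> ?D \<and> card e = 2}" using ij by auto
  qed
  then have "card {e. admissible n B e} \<le> card {e. e \<subseteq> ?D \<and> card e = 2}"
    by (intro card_mono) (auto intro: finite_subset[of _ "Pow ?D"])
  also have "\<dots> = card ?D choose 2" by (intro n_subsets) auto
  also have "\<dots> \<le> (2 * r) choose 2" using D by (intro binomial_right_mono)
  finally show ?thesis .
qed

section \<open>Relative weights and the loss from edges outside the current tour\<close>

definition zeta :: "nat \<Rightarrow> real" where "zeta n = pi_min n / pi_max n"

text \<open>The product of the losses \<open>exp (- 6 * zeta n * s)\<close> over
  \<open>s = 1, ..., r\<close>, one for each edge still to be added; here \<open>zeta n\<close> is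
  the weight of an edge outside the tour relative to one inside it.\<close>

definition kappa :: "nat \<Rightarrow> nat \<Rightarrow> real" where
  "kappa n r = exp (- 3 * zeta n * real r * (real r + 1))"

lemma zeta_eq: "n \<ge> 3 \<Longrightarrow> zeta n = 1 / ((real n - 1) * (real n - 2))"
proof -
  assume "n \<ge> 3"
  then have x: "real n \<ge> 3" by simp
  then have "1 - 1 / real n = (real n - 1) / real n" by (simp add: field_simps)
  then show ?thesis unfolding zeta_def pi_min_def pi_max_def using x by simp
qed

lemma zeta_pos: "n \<ge> 3 \<Longrightarrow> zeta n > 0"
  using pi_bounds[of n] by (simp add: zeta_def)

lemma zeta_ge: "n \<ge> 3 \<Longrightarrow> zeta n \<ge> 1 / real n ^ 2"
  unfolding power2_eq_square by (subst zeta_eq) (auto intro!: divide_left_mono mult_mono mult_pos_pos)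

lemma kappa_antimono: "n \<ge> 3 \<Longrightarrow> r \<le> s \<Longrightarrow> kappa n s \<le> kappa n r"
  using zeta_pos[of n] unfolding kappa_def by (auto intro!: mult_mono)

lemma kappa_bounds:
  assumes "n \<ge> 3"
  shows "kappa n r \<le> 1" "kappa n r > 0"
  using assms zeta_pos[of n] unfolding kappa_def by (auto intro!: mult_nonneg_nonneg)

text \<open>\<open>n * (n + 1)\<close> is at most 6 times \<open>(n - 1) * (n - 2)\<close>, with
  equality at \<open>n = 3\<close>; the exponent is therefore at least
  \<open>- 3 * 6\<close>.\<close>

lemma kappa_n_ge: "n \<ge> 3 \<Longrightarrow> kappa n n \<ge> exp (- 18)"
proof -
  assume n: "n \<ge> 3"
  then have r: "real n \<ge> 3" by simp
  have "real n * (real n + 1) \<le> 6 * ((real n - 1) * (real n - 2))"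
  proof -
    have "0 \<le> (real n - 3) * (5 * real n - 4)" using r by (intro mult_nonneg_nonneg) auto
    then show ?thesis by (simp add: algebra_simps)
  qed
  then have "zeta n * (real n * (real n + 1)) \<le> 6"
    using r by (simp add: zeta_eq[OF n] field_simps)
  then have "- 18 \<le> - 3 * zeta n * real n * (real n + 1)" unfolding mult.assoc by linarith
  then show ?thesis unfolding kappa_def by simp
qed

lemma edge_weight_Pi_of:
  assumes "e \<in> Kn_edges n"
  shows "edge_weight (Pi_of n H) e = (if e \<in> H then 2 * pi_max n else 2 * pi_min n)"
  using assms by (auto elim!: Kn_edgesE simp: edge_weight_doubleton Pi_of_def insert_commute)

text \<open>Dividing all weights by \<open>2 * pi_max n\<close> leaves weight 1 on the edges of
  \<open>H\<close> and \<open>zeta n\<close> on the others.\<close>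

lemma prob_egen_Suc:
  assumes H: "hamiltonian_cycle n H" and B: "\<not> hamiltonian_cycle n B" and A: "A = {e. admissible n B e}" "A \<noteq> {}"
  shows "measure_pmf.prob (egen n (Pi_of n H) (Suc k) B) G =
    ((\<Sum>e\<in>A \<inter> H. measure_pmf.prob (egen n (Pi_of n H) k (insert e B)) G)
      + zeta n * (\<Sum>e\<in>A - H. measure_pmf.prob (egen n (Pi_of n H) k (insert e B)) G))
    / (real (card (A \<inter> H)) + zeta n * real (card (A - H)))"
proof -
  have n3: "n \<ge> 3" using H unfolding hamiltonian_cycle_def by auto
  note pb = pi_bounds[OF n3]
  have fin: "finite A" using A by simp
  have Kn: "A \<subseteq> Kn_edges n" using A by (auto simp: admissible_def)
  let ?w = "edge_weight (Pi_of n H)" and ?p = "\<lambda>e. measure_pmf.prob (egen n (Pi_of n H) k (insert e B)) G"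
  have w: "?w e > 0" if "e \<in> A" for e using edge_weight_Pi_of[of e n H] Kn that pb by auto
  have dec: "(\<Sum>e\<in>A. ?w e * g e) = 2 * pi_max n * ((\<Sum>e\<in>A \<inter> H. g e) + zeta n * (\<Sum>e\<in>A - H. g e))" for g
  proof -
    have "(\<Sum>e\<in>A. ?w e * g e) = (\<Sum>e\<in>A \<inter> H. ?w e * g e) + (\<Sum>e\<in>A - H. ?w e * g e)"
      using fin by (subst sum.Int_Diff[of A _ H]) auto
    also have "(\<Sum>e\<in>A \<inter> H. ?w e * g e) = 2 * pi_max n * (\<Sum>e\<in>A \<inter> H. g e)"
      unfolding sum_distrib_left using Kn edge_weight_Pi_of by (intro sum.cong) auto
    also have "(\<Sum>e\<in>A - H. ?w e * g e) = 2 * pi_min n * (\<Sum>e\<in>A - H. g e)"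
      unfolding sum_distrib_left using Kn edge_weight_Pi_of by (intro sum.cong) auto
    finally show ?thesis using pb by (simp add: zeta_def distrib_left)
  qed
  have "measure_pmf.prob (egen n (Pi_of n H) (Suc k) B) G = (\<Sum>e\<in>A. ?w e * ?p e) / sum ?w A"
    using B A(1) prob_bind_wchoice[OF fin A(2) w, where g = "\<lambda>e. egen n (Pi_of n H) k (insert e B)" and S = G] by simp
  also have "sum ?w A = 2 * pi_max n * (real (card (A \<inter> H)) + zeta n * real (card (A - H)))"
    using dec[of "\<lambda>_. 1"] by simp
  finally show ?thesis unfolding dec using pb by simp
qed

text \<open>Edges outside \<open>H\<close> take at most the fraction \<open>6 * zeta n * r\<close> of the weight when \<open>r\<close> edges are
  missing; \<open>kappa\<close> collects the resulting losses.\<close>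

lemma prob_egen_step:
  assumes H: "hamiltonian_cycle n H" and H0: "hamiltonian_cycle n H0" "B \<subseteq> H0" "card B = n - Suc k" "Suc k \<le> n"
    and A: "A = {e. admissible n B e}"
    and h: "real (card (A \<inter> H)) \<ge> real (Suc k) / 3"
    and x: "x \<ge> 0"
    and sum: "(\<Sum>e\<in>A \<inter> H. measure_pmf.prob (egen n (Pi_of n H) k (insert e B)) G)
      + zeta n * (\<Sum>e\<in>A - H. measure_pmf.prob (egen n (Pi_of n H) k (insert e B)) G)
      \<ge> real (card (A \<inter> H)) * (kappa n k * x)"
  shows "measure_pmf.prob (egen n (Pi_of n H) (Suc k) B) G \<ge> kappa n (Suc k) * x"
proof -
  have n3: "n \<ge> 3" using H unfolding hamiltonian_cycle_def by auto
  note z = zeta_pos[OF n3]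
  let ?h = "real (card (A \<inter> H))" and ?m = "real (card (A - H))" and ?r = "real (Suc k)"
  have hpos: "?h > 0" using h by (rule less_le_trans[rotated]) simp
  have "A \<noteq> {}" using hpos by auto
  have nB: "\<not> hamiltonian_cycle n B" using card_hamiltonian_cycle[of n B] H0 by auto
  have "?m \<le> real (card A)" using A by (auto intro!: card_mono)
  also have "\<dots> \<le> real ((2 * Suc k) choose 2)"
    unfolding A using card_admissible_le[OF H0] by (simp only: of_nat_le_iff)
  also have "\<dots> \<le> 2 * ?r ^ 2"
  proof -
    have "(2 * Suc k) choose 2 \<le> 2 * (Suc k) ^ 2"
      unfolding choose_two by (simp add: power2_eq_square algebra_simps)
    then have "real ((2 * Suc k) choose 2) \<le> real (2 * (Suc k) ^ 2)" by (simp only: of_nat_le_iff)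
    then show ?thesis by simp
  qed
  finally have m: "?m \<le> 2 * ?r ^ 2" .
  \<comment> \<open>There are at most \<open>2 * r ^ 2\<close> foreign edges; splitting off
    \<open>r / 3\<close>, a lower bound for the number of tour edges, produces the constant 6 in
    \<open>kappa\<close>.\<close>
  have "?m \<le> (6 * ?r) * (?r / 3)" using m by (simp add: power2_eq_square del: of_nat_Suc)
  also have "\<dots> \<le> (6 * ?r) * ?h" using h by (intro mult_left_mono) auto
  finally have mh: "zeta n * ?m \<le> (6 * zeta n * ?r) * ?h" using z by (simp add: mult_ac)
  have "?h + zeta n * ?m \<le> (1 + 6 * zeta n * ?r) * ?h" using mh by (simp add: algebra_simps)
  also have "\<dots> \<le> exp (6 * zeta n * ?r) * ?h" using hpos by (intro mult_right_mono) auto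
  finally have den: "?h + zeta n * ?m \<le> exp (6 * zeta n * ?r) * ?h" .
  have pos: "?h + zeta n * ?m > 0" using hpos z by (intro add_pos_nonneg) auto
  have "kappa n (Suc k) * exp (6 * zeta n * ?r) = kappa n k"
    unfolding kappa_def by (simp flip: exp_add) (simp add: algebra_simps)
  moreover have "kappa n (Suc k) * x * (?h + zeta n * ?m) \<le> kappa n (Suc k) * x * (exp (6 * zeta n * ?r) * ?h)"
    using den x kappa_bounds[OF n3, of "Suc k"] by (intro mult_left_mono) auto
  ultimately have "kappa n (Suc k) * x * (?h + zeta n * ?m) \<le> ?h * (kappa n k * x)"
    by (simp add: mult_ac)
  also note sum
  finally show ?thesis
    unfolding prob_egen_Suc[OF H nB A \<open>A \<noteq> {}\<close>] using pos by (simp add: pos_le_divide_eq)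
qed

text \<open>Backward induction for a submartingale: if the choice were uniform over the admissible
  edges of \<open>H\<close>, the expected \<open>V\<close> over the choices in \<open>S\<close>
  alone would be at least the current \<open>V\<close>. So \<open>V B\<close> bounds the probability
  of success from below, up to the final factor \<open>q0\<close> and the loss \<open>kappa\<close>.
  Stopping at \<open>r0\<close> missing edges leaves a last phase without such choices to a separate
  argument.\<close>

lemma prob_egen_submartingale:
  assumes H: "hamiltonian_cycle n H"
    and ext: "\<And>B. I B \<Longrightarrow> \<exists>H0. hamiltonian_cycle n H0 \<and> B \<subseteq> H0"
    and V: "\<And>B. V B \<ge> 0" and q0: "q0 \<ge> 0"
    and base: "\<And>B. I B \<Longrightarrow> card B = n - r0 \<Longrightarrow> measure_pmf.prob (egen n (Pi_of n H) r0 B) G \<ge> q0 * V B"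
    and step: "\<And>B r. I B \<Longrightarrow> card B = n - r \<Longrightarrow> r0 < r \<Longrightarrow> r \<le> n \<Longrightarrow>
      \<exists>S \<subseteq> {e. admissible n B e} \<inter> H. (\<forall>e\<in>S. I (insert e B)) \<and>
        (\<Sum>e\<in>S. V (insert e B)) \<ge> real (card ({e. admissible n B e} \<inter> H)) * V B \<and> real (card S) \<ge> real r / 3"
  shows "I B \<Longrightarrow> card B = n - r \<Longrightarrow> r0 \<le> r \<Longrightarrow> r \<le> n \<Longrightarrow>
    measure_pmf.prob (egen n (Pi_of n H) r B) G \<ge> kappa n r * (q0 * V B)"
proof (induction r arbitrary: B)
  case 0
  have n3: "n \<ge> 3" using H unfolding hamiltonian_cycle_def by auto
  have "kappa n 0 * (q0 * V B) \<le> 1 * (q0 * V B)"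
    using kappa_bounds[OF n3] V q0 by (intro mult_right_mono) auto
  then show ?case using base[OF 0(1)] 0 by simp
next
  case (Suc k)
  have n3: "n \<ge> 3" using H unfolding hamiltonian_cycle_def by auto
  show ?case
  proof (cases "Suc k = r0")
    case True
    have "kappa n (Suc k) * (q0 * V B) \<le> 1 * (q0 * V B)"
      using kappa_bounds[OF n3] V q0 by (intro mult_right_mono) auto
    then show ?thesis using base[OF Suc.prems(1)] Suc.prems(2) True by simp
  next
    case False
    let ?A = "{e. admissible n B e}" and ?p = "\<lambda>e. measure_pmf.prob (egen n (Pi_of n H) k (insert e B)) G"
    obtain H0 where H0: "hamiltonian_cycle n H0" "B \<subseteq> H0" using ext[OF Suc.prems(1)] by blast
    have finB: "finite B" using H0 finite_hamiltonian_cycle finite_subset by blast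
    obtain S where S: "S \<subseteq> ?A \<inter> H" "\<And>e. e \<in> S \<Longrightarrow> I (insert e B)"
      "(\<Sum>e\<in>S. V (insert e B)) \<ge> real (card (?A \<inter> H)) * V B" "real (card S) \<ge> real (Suc k) / 3"
      using step[OF Suc.prems(1,2)] False Suc.prems by (metis le_neq_implies_less)
    have "real (card (?A \<inter> H)) * (kappa n k * (q0 * V B)) = kappa n k * q0 * (real (card (?A \<inter> H)) * V B)"
      by simp
    also have "\<dots> \<le> kappa n k * q0 * (\<Sum>e\<in>S. V (insert e B))"
      using S(3) kappa_bounds[OF n3, of k] q0 by (intro mult_left_mono) auto
    also have "\<dots> = (\<Sum>e\<in>S. kappa n k * (q0 * V (insert e B)))"
      by (simp add: sum_distrib_left mult.assoc)
    also have "\<dots> \<le> (\<Sum>e\<in>S. ?p e)"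
    proof (rule sum_mono)
      fix e assume e: "e \<in> S"
      then have "e \<notin> B" using S(1) by (auto simp: admissible_def)
      then have "card (insert e B) = n - k" using finB Suc.prems by simp
      then show "kappa n k * (q0 * V (insert e B)) \<le> ?p e"
        using S(2)[OF e] Suc.prems False by (intro Suc.IH) auto
    qed
    also have "\<dots> \<le> (\<Sum>e\<in>?A \<inter> H. ?p e)" using S(1) by (intro sum_mono2) auto
    also have "\<dots> \<le> (\<Sum>e\<in>?A \<inter> H. ?p e) + zeta n * (\<Sum>e\<in>?A - H. ?p e)"
      using zeta_pos[OF n3] by (simp add: sum_nonneg)
    finally have num: "real (card (?A \<inter> H)) * (kappa n k * (q0 * V B)) \<le> \<dots>" .
    have "card S \<le> card (?A \<inter> H)" using S(1) by (intro card_mono) auto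
    then have "real (card (?A \<inter> H)) \<ge> real (Suc k) / 3" using S(4) by linarith
    then show ?thesis
      using num V q0 Suc.prems by (intro prob_egen_step[OF H H0 _ _ refl]) auto
  qed
qed

text \<open>Here \<open>V = 1\<close>: inside \<open>H\<close> every missing edge stays admissible,
  so nothing but \<open>kappa\<close> is lost.\<close>

lemma prob_edge_gen_same:
  assumes H: "hamiltonian_cycle n H"
  shows "measure_pmf.prob (edge_gen n (Pi_of n H)) {H} \<ge> exp (- 18)"
proof -
  have n3: "n \<ge> 3" using H unfolding hamiltonian_cycle_def by auto
  have fin: "finite H" "card H = n" using finite_hamiltonian_cycle[OF H] card_hamiltonian_cycle[OF H] by auto
  have "kappa n n * (1 * 1) \<le> measure_pmf.prob (egen n (Pi_of n H) n {}) {H}"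
  proof (rule prob_egen_submartingale[where I="\<lambda>B. B \<subseteq> H" and V="\<lambda>_. 1" and ?r0.0=0, OF H])
    fix B r assume B: "B \<subseteq> H" "card B = n - r" "0 < r" "r \<le> n"
    have "card (H - B) = r" using B fin by (simp add: card_Diff_subset finite_subset)
    moreover have eq: "{e. admissible n B e} \<inter> H = H - B"
      using B admissible_if_subset_hamiltonian[OF H] by (auto simp: admissible_def)
    ultimately show "\<exists>S\<subseteq>{e. admissible n B e} \<inter> H. (\<forall>e\<in>S. insert e B \<subseteq> H) \<and>
        real (card ({e. admissible n B e} \<inter> H)) * 1 \<le> (\<Sum>e\<in>S. 1) \<and> real r / 3 \<le> real (card S)"
      unfolding eq using B by (intro exI[of _ "H - B"]) auto
  next
    fix B assume "B \<subseteq> H" "card B = n - 0"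
    then have "B = H" using fin by (simp add: card_subset_eq)
    then show "1 * 1 \<le> measure_pmf.prob (egen n (Pi_of n H) 0 B) {H}" by simp
  qed (use H in auto)
  then show ?thesis using kappa_n_ge[OF n3] by (simp add: edge_gen_def)
qed

text \<open>With one edge missing only \<open>2 choose 2 = 1\<close> edge can be admissible, so its
  small weight does not matter.\<close>

lemma prob_egen_last:
  assumes H: "hamiltonian_cycle n H" and H': "hamiltonian_cycle n (insert e B)" "e \<notin> B" "finite B"
  shows "measure_pmf.prob (egen n (Pi_of n H) (Suc 0) B) {insert e B} = 1"
proof -
  have n3: "n \<ge> 3" using H unfolding hamiltonian_cycle_def by auto
  have cB: "card B = n - 1" using card_hamiltonian_cycle[OF H'(1)] H'(2,3) by simp
  have "card {e. admissible n B e} \<le> (2 * 1) choose 2"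
    using n3 cB by (intro card_admissible_le[OF H'(1)]) auto
  moreover have "e \<in> {e. admissible n B e}"
    using admissible_if_subset_hamiltonian[OF H'(1)] H'(2) by auto
  ultimately have A: "{e} = {e. admissible n B e}"
    by (intro card_seteq) (auto simp: choose_two)
  have nB: "\<not> hamiltonian_cycle n B" using card_hamiltonian_cycle[of n B] cB n3 by auto
  show ?thesis
    using prob_egen_Suc[OF H nB A, of 0 "{insert e B}"] zeta_pos[OF n3] by (cases "e \<in> H") auto
qed

lemma card_if_le: "card ((if p then {} else {x}) \<union> (if q then {} else {y}) \<union> Z)
   \<le> (if p then 0 else 1) + (if q then 0 else 1) + card Z"
  by (auto simp: card_insert_le_m1 card_insert_if intro!: order_trans[OF card_Un_le])

section \<open>Probability of carrying out a given exchange by edge-based generation\<close>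

context exchange
begin

definition kept :: "nat set set" where
  "kept = insert f (H - ({e1, e2} \<union> E3))"

text \<open>The blocking events, multiplied as if independent: each of \<open>g1\<close>,
  \<open>g2\<close> must precede its competitor, and the third removed edge must be last among the
  missing edges of \<open>Q\<close>. As \<open>g1\<close> and \<open>g2\<close> then lie in
  \<open>Q\<close>, choosing them serves both purposes, so the product is a lower bound.\<close>

definition value_of :: "nat set set \<Rightarrow> real" where
  "value_of B = (1 / 2) ^ card ({g1, g2} - B) / (if Q = {} then 1 else real (card (Q - B)))"

lemma n3: "n \<ge> 3"
  using ham unfolding hamiltonian_cycle_def by auto

lemma new_cycle_eq: "new_cycle = E \<union> kept" and ham_new: "hamiltonian_cycle n new_cycle"
  using ham' by (simp_all add: new_cycle_def kept_def)

lemma finite_kept: "finite kept" and card_kept: "card kept = n - card E" "card E \<le> 2" and disjoint_kept: "E \<inter> kept = {}"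
proof -
  show fin: "finite kept" using finite_HE by (simp add: kept_def)
  show E2: "card E \<le> 2" using alt by auto
  have X: "{e1, e2} \<union> E3 \<subseteq> H" using in_H by simp
  have "card (H - ({e1, e2} \<union> E3)) = n - Suc (card E)"
    using card_Diff_subset[OF finite_subset[OF X finite_HE(1)] X] card_removed card_hamiltonian_cycle[OF ham] by simp
  then show c: "card kept = n - card E"
    using f(2) finite_HE E2 n3 by (simp add: kept_def)
  have "card (E \<union> kept) = n" using card_hamiltonian_cycle[OF ham_new] by (simp add: new_cycle_eq)
  then have "card (E \<inter> kept) = 0"
    using card_Un_Int[OF finite_HE(2) fin] c E2 n3 by simp
  then show "E \<inter> kept = {}" using finite_HE by simp
qed

lemma g_in_kept: "g1 \<in> kept" "g2 \<in> kept"
proof -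
  have "g1 \<notin> E3" "g2 \<notin> E3" using alt by auto
  then show "g1 \<in> kept" "g2 \<in> kept"
    using in_H e1_ne_e2 at_a(2) at_b(2) by (auto simp: kept_def)
qed

lemma f_in_kept: "f \<in> kept"
  by (simp add: kept_def)

lemma not_admissible_1:
  assumes "f \<in> B" "g1 \<in> B" "finite B"
  shows "\<not> admissible n B e1"
proof
  assume *: "admissible n B e1"
  have "a \<in> e1" "a \<in> g1" using at_a(1) by blast+
  then have "degree (insert e1 B) a \<ge> 3"
    using assms in_H f at_a(2) by (intro three_edges_degree[of _ f g1 e1]) auto
  moreover have "degree (insert e1 B) a \<le> 2" using * unfolding admissible_def by blast
  ultimately show False by simp
qed

lemma not_admissible_2:
  assumes "f \<in> B" "g2 \<in> B" "finite B"
  shows "\<not> admissible n B e2"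
proof
  assume *: "admissible n B e2"
  have "b \<in> e2" "b \<in> g2" using at_b(1) by blast+
  then have "degree (insert e2 B) b \<ge> 3"
    using assms in_H f at_b(2) by (intro three_edges_degree[of _ f g2 e2]) auto
  moreover have "degree (insert e2 B) b \<le> 2" using * unfolding admissible_def by blast
  ultimately show False by simp
qed

lemma not_admissible_3:
  assumes "f \<in> B" "Q - B \<subseteq> E3" "e \<in> E3"
  shows "\<not> admissible n B e"
proof
  assume *: "admissible n B e"
  obtain e3 where e3: "E3 = {e3}" "is_cycle (insert f Q)" "card (insert f Q) < n"
    using alt assms(3) by auto
  then have "insert f Q \<subseteq> insert e B" using assms by auto
  then show False using * e3 unfolding admissible_def by blast
qed

text \<open>The last three sets are the removed edges not yet blocked, the only choices from
  \<open>H\<close> that spoil the exchange.\<close>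

lemma admissible_H_subset:
  assumes "f \<in> B" "B \<subseteq> kept"
  shows "{e. admissible n B e} \<inter> H \<subseteq> (kept - B) \<union> ((if g1 \<in> B then {} else {e1}) \<union>
     (if g2 \<in> B then {} else {e2}) \<union> (if Q - B \<subseteq> E3 then {} else E3))" (is "_ \<subseteq> ?R")
proof
  fix e assume e: "e \<in> {e. admissible n B e} \<inter> H"
  have finB: "finite B" using assms(2) finite_kept finite_subset by blast
  have "e \<notin> B" using e by (auto simp: admissible_def)
  consider "e \<in> kept" | "e = e1" | "e = e2" | "e \<in> E3" using e by (auto simp: kept_def)
  then show "e \<in> ?R"
  proof cases
    case 1
    then show ?thesis using \<open>e \<notin> B\<close> by simp
  next
    case 2
    then show ?thesis using not_admissible_1[OF assms(1) _ finB] e by auto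
  next
    case 3
    then show ?thesis using not_admissible_2[OF assms(1) _ finB] e by auto
  next
    case 4
    then show ?thesis using not_admissible_3[OF assms(1) _ 4] e by auto
  qed
qed

lemma kept_diff_subset_admissible:
  assumes "f \<in> B" "B \<subseteq> kept"
  shows "kept - B \<subseteq> {e. admissible n B e} \<inter> H"
proof
  fix e assume e: "e \<in> kept - B"
  then have "admissible n B e"
    using assms by (intro admissible_if_subset_hamiltonian[OF ham_new]) (auto simp: new_cycle_eq)
  then show "e \<in> {e. admissible n B e} \<inter> H" using e assms(1) by (auto simp: kept_def)
qed

lemma card_g_minus: "card ({g1, g2} - B) = (if g1 \<in> B then 0 else 1) + (if g2 \<in> B then 0 else 1)"
  using e1_ne_e2(4) by (simp add: insert_Diff_if)

lemma half_power_insert: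
  assumes "e \<notin> B"
  shows "(1 / 2 :: real) ^ card ({g1, g2} - insert e B) = (1 / 2) ^ card ({g1, g2} - B) * (if e \<in> {g1, g2} then 2 else 1)"
  using assms e1_ne_e2(4) by (auto simp: card_g_minus power2_eq_square)

lemma sum_indicator_g:
  assumes "B \<subseteq> kept"
  shows "(\<Sum>e\<in>kept - B. if e \<in> {g1, g2} then c else 0) = real (card ({g1, g2} - B)) * (c :: real)"
proof -
  have "{g1, g2} - B = (kept - B) \<inter> {g1, g2}" using g_in_kept by blast
  then show ?thesis using finite_kept by (simp add: sum.If_cases Int_def conj_commute)
qed

text \<open>Among the admissible edges of \<open>H\<close>, the choice of \<open>e1\<close> before \<open>g1\<close> and of \<open>g1\<close> before \<open>e1\<close> is equally
  likely, and so is each order of the missing edges of \<open>Q\<close>. Hence \<open>value_of\<close> lower bounds the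
  probability that \<open>e1, e2, E3\<close> get blocked.\<close>

lemma value_of_step:
  assumes B: "f \<in> B" "B \<subseteq> kept"
  shows "real (card ({e. admissible n B e} \<inter> H)) * value_of B \<le> (\<Sum>e\<in>kept - B. value_of (insert e B))"
proof -
  let ?A = "{e. admissible n B e} \<inter> H" and ?M = "kept - B"
  let ?c = "card ({g1, g2} - B)" and ?Z = "if Q - B \<subseteq> E3 then {} else E3"
  have finM: "finite ?M" using finite_kept by simp
  have "finite E3" using finite_HE in_H finite_subset by blast
  then have "card ?A \<le> card (?M \<union> ((if g1 \<in> B then {} else {e1}) \<union> (if g2 \<in> B then {} else {e2}) \<union> ?Z))"
    using finM by (intro card_mono[OF _ admissible_H_subset[OF B]]) auto
  also have "\<dots> \<le> card ?M + card ((if g1 \<in> B then {} else {e1}) \<union> (if g2 \<in> B then {} else {e2}) \<union> ?Z)"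
    by (rule card_Un_le)
  also have "\<dots> \<le> card ?M + (?c + card ?Z)"
    unfolding card_g_minus by (intro add_left_mono card_if_le)
  finally have cA: "card ?A \<le> card ?M + ?c + card ?Z" by simp
  from alt show ?thesis
  proof
    assume a: "E3 = {} \<and> Q = {} \<and> card E = 1"
    have v: "value_of B' = (1 / 2) ^ card ({g1, g2} - B')" for B' unfolding value_of_def using a by simp
    \<comment> \<open>Choosing a missing \<open>g1\<close> or \<open>g2\<close> doubles the value;
      this gain makes up for the competitor that is still admissible.\<close>
    have "(\<Sum>e\<in>?M. value_of (insert e B)) = (\<Sum>e\<in>?M. (1 / 2) ^ ?c * (1 + (if e \<in> {g1, g2} then 1 else 0)))"
      unfolding v by (intro sum.cong refl) (subst half_power_insert, auto)
    also have "\<dots> = (1 / 2) ^ ?c * (\<Sum>e\<in>?M. 1 + (if e \<in> {g1, g2} then 1 else 0))"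
      by (simp only: sum_distrib_left)
    also have "(\<Sum>e\<in>?M. 1 + (if e \<in> {g1, g2} then 1 else 0 :: real)) = real (card ?M) + real ?c"
      unfolding sum.distrib sum_indicator_g[OF B(2)] by simp
    finally have eq: "(\<Sum>e\<in>?M. value_of (insert e B)) = (1 / 2) ^ ?c * (real (card ?M) + real ?c)" .
    have "real (card ?A) \<le> real (card ?M) + real ?c" using cA a by simp
    then show ?thesis unfolding eq v[of B] by (simp add: mult_right_mono mult.commute)
  next
    assume "\<exists>e3. E3 = {e3} \<and> {e3, g1, g2} \<subseteq> Q \<and> e3 \<notin> {g1, g2} \<and> is_cycle (insert f Q) \<and>
      card (insert f Q) < n \<and> card E = 2"
    then obtain e3 where e3: "E3 = {e3}" "e3 \<in> Q" "g1 \<in> Q" "g2 \<in> Q" by auto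
    let ?L = "card (Q - B)"
    have finQ: "finite Q" using Q finite_HE finite_subset by blast
    have v: "value_of B' = (1 / 2) ^ card ({g1, g2} - B') / real (card (Q - B'))" for B'
      unfolding value_of_def using e3 by auto
    have e3B: "e3 \<notin> B" using B(2) e3(1,2) f(2) Q(1) unfolding kept_def by blast
    have QM: "?M \<inter> Q = (Q - B) - {e3}" unfolding kept_def using Q e3(1) f(2) by blast
    have L: "card (?M \<inter> Q) = ?L - 1" unfolding QM using finQ e3 e3B by simp
    have L1: "?L \<ge> 1" using e3 e3B finQ by (metis DiffI One_nat_def Suc_leI card_gt_0_iff empty_iff finite_Diff)
    have vi: "value_of (insert e B) = (1 / 2) ^ ?c * (if e \<in> {g1, g2} then 2 else 1) / (if e \<in> Q then real ?L - 1 else real ?L)"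
      if "e \<in> ?M" for e
    proof -
      have "Q - insert e B = (Q - B) - {e}" by blast
      then have "real (card (Q - insert e B)) = (if e \<in> Q then real ?L - 1 else real ?L)"
        using that finQ L1 by simp
      then show ?thesis unfolding v using half_power_insert[of e B] that by simp
    qed
    show ?thesis
    proof (cases "?L = 1")
      case True
      \<comment> \<open>Only the third removed edge is missing from \<open>Q\<close>: it is blocked,
        and \<open>g1\<close> and \<open>g2\<close> have already been chosen.\<close>
      then have "?M \<inter> Q = {}" using L finM by simp
      moreover from this have c0: "?c = 0" using g_in_kept e3 unfolding card_g_minus by auto
      ultimately have "(\<Sum>e\<in>?M. value_of (insert e B)) = (\<Sum>e\<in>?M. 1)"
        using e3 True by (intro sum.cong refl) (subst vi, auto)
      moreover have "Q - B \<subseteq> E3" using \<open>?M \<inter> Q = {}\<close> QM e3 by blast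
      then have "card ?A \<le> card ?M" using cA c0 by simp
      moreover have "value_of B = 1" unfolding v c0 True by simp
      ultimately show ?thesis by simp
    next
      case False
      then have L2: "real ?L \<ge> 2" using L1 by simp
      \<comment> \<open>The gain when an edge of \<open>Q\<close> is chosen. There are
        \<open>?L - 1\<close> good edges of this kind, so the total gain is \<open>1 / ?L\<close>,
        exactly what the admissible \<open>e3\<close> costs.\<close>
      let ?k = "1 / (real ?L - 1) - 1 / real ?L"
      have "(\<Sum>e\<in>?M. value_of (insert e B)) = (\<Sum>e\<in>?M. (1 / 2) ^ ?c *
          ((1 / real ?L + (if e \<in> Q then ?k else 0)) + (if e \<in> {g1, g2} then 1 / (real ?L - 1) else 0)))"
        using e3 by (intro sum.cong refl) (subst vi, auto simp: field_simps)
      also have "\<dots> = (1 / 2) ^ ?c * (\<Sum>e\<in>?M. (1 / real ?L + (if e \<in> Q then ?k else 0))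
          + (if e \<in> {g1, g2} then 1 / (real ?L - 1) else 0))"
        by (simp only: sum_distrib_left)
      also have "(\<Sum>e\<in>?M. (1 / real ?L + (if e \<in> Q then ?k else 0)) + (if e \<in> {g1, g2} then 1 / (real ?L - 1) else 0))
          = (\<Sum>e\<in>?M. 1 / real ?L) + (\<Sum>e\<in>?M. if e \<in> Q then ?k else 0) + real ?c * (1 / (real ?L - 1))"
        unfolding sum.distrib sum_indicator_g[OF B(2)] ..
      also have "(\<Sum>e\<in>?M. if e \<in> Q then ?k else 0) = real (card (?M \<inter> Q)) * ?k"
        using finM by (simp add: sum.If_cases Int_def)
      also have "real (card (?M \<inter> Q)) * ?k = 1 / real ?L"
        using L2 unfolding L by (simp add: of_nat_diff[OF L1] field_simps)
      finally have eq: "(\<Sum>e\<in>?M. value_of (insert e B))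
          = (1 / 2) ^ ?c * (real (card ?M) / real ?L + 1 / real ?L + real ?c / (real ?L - 1))" by simp
      have "real (card ?A) \<le> real (card ?M) + real ?c + 1" using cA e3 by (auto split: if_splits)
      then have "real (card ?A) / real ?L \<le> (real (card ?M) + real ?c + 1) / real ?L"
        by (intro divide_right_mono) auto
      also have "\<dots> = real (card ?M) / real ?L + 1 / real ?L + real ?c / real ?L" by (simp add: add_divide_distrib)
      also have "real ?c / real ?L \<le> real ?c / (real ?L - 1)" using L2 by (intro divide_left_mono) auto
      finally have "(1 / 2) ^ ?c * (real (card ?A) / real ?L) \<le>
          (1 / 2) ^ ?c * (real (card ?M) / real ?L + 1 / real ?L + real ?c / (real ?L - 1))"
        by (intro mult_left_mono) auto
      then show ?thesis unfolding eq v[of B] by (simp add: mult.commute)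
    qed
  qed
qed

lemma value_of_nonneg: "value_of B \<ge> 0"
  by (simp add: value_of_def)

lemma value_of_denominator:
  assumes "B \<subseteq> kept"
  shows "(if Q = {} then 1 else real (card (Q - B))) \<ge> 1"
proof (cases "Q = {}")
  case False
  then obtain e3 where "e3 \<in> E3" "e3 \<in> Q" using alt by auto
  then have "e3 \<in> Q - B" using assms f(2) Q(1) unfolding kept_def by blast
  moreover have "finite (Q - B)" using Q finite_HE finite_subset by blast
  ultimately have "card (Q - B) > 0" by (auto simp: card_gt_0_iff)
  then show ?thesis by simp
qed simp

lemma value_of_le_1:
  assumes "B \<subseteq> kept"
  shows "value_of B \<le> 1"
proof -
  have "(1 / 2 :: real) ^ card ({g1, g2} - B) \<le> 1" by (simp add: power_le_one)
  then show ?thesis using value_of_denominator[OF assms] unfolding value_of_def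
    by (smt (verit) divide_le_eq_1)
qed

lemma value_of_ge:
  assumes "B \<subseteq> kept"
  shows "value_of B \<ge> 1 / (4 * real n)"
proof -
  have "card ({g1, g2} - B) \<le> 2" unfolding card_g_minus by simp
  then have "(1 / 2 :: real) ^ 2 \<le> (1 / 2) ^ card ({g1, g2} - B)" by (intro power_decreasing) auto
  then have p: "1 / 4 \<le> (1 / 2 :: real) ^ card ({g1, g2} - B)" by (simp add: power2_eq_square)
  let ?d = "if Q = {} then 1 else real (card (Q - B))"
  have "card (Q - B) \<le> card H" using Q finite_HE by (intro card_mono) auto
  then have d: "?d \<le> real n" "?d \<ge> 1"
    using n3 card_hamiltonian_cycle[OF ham] value_of_denominator[OF assms] by auto
  have "1 / (4 * real n) = (1 / 4) / real n" by simp
  also have "\<dots> \<le> (1 / 4) / ?d" using d by (intro divide_left_mono) auto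
  also have "\<dots> \<le> value_of B" unfolding value_of_def using p d(2) by (intro divide_right_mono) auto
  finally show ?thesis .
qed

text \<open>Once \<open>kept\<close> is complete and two edges are missing, all edges of
  \<open>H\<close> are blocked. The factor \<open>zeta n\<close> then cancels and the choice is
  uniform over at most \<open>4 choose 2 = 6\<close> edges; after a right choice the last edge is
  forced.\<close>

lemma prob_egen_kept: "measure_pmf.prob (egen n (Pi_of n H) (card E) kept) {new_cycle} \<ge> 1 / 6"
  using alt
proof
  assume "E3 = {} \<and> Q = {} \<and> card E = 1"
  then obtain e where e: "E = {e}" by (auto simp: card_1_singleton_iff)
  then have "e \<notin> kept" "new_cycle = insert e kept" using disjoint_kept new_cycle_eq by auto
  then show ?thesis using prob_egen_last[OF ham, of e kept] ham_new finite_kept e by simp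
next
  assume "\<exists>e3. E3 = {e3} \<and> {e3, g1, g2} \<subseteq> Q \<and> e3 \<notin> {g1, g2} \<and> is_cycle (insert f Q) \<and>
      card (insert f Q) < n \<and> card E = 2"
  then have "card E = 2" "Q - kept \<subseteq> E3" using Q by (auto simp: kept_def)
  then obtain x y where xy: "E = {x, y}" "x \<noteq> y" by (auto simp: card_2_iff)
  then have nk: "x \<notin> kept" "y \<notin> insert x kept" "new_cycle = insert y (insert x kept)"
    using disjoint_kept new_cycle_eq by auto
  let ?A = "{e. admissible n kept e}"
  have "?A \<inter> H \<subseteq> {}"
    using admissible_H_subset[of kept] g_in_kept \<open>Q - kept \<subseteq> E3\<close> f_in_kept by simp
  then have AH: "?A \<inter> H = {}" "?A - H = ?A" by auto
  have xA: "x \<in> ?A" using nk by (auto intro!: admissible_if_subset_hamiltonian[OF ham_new])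
  have ck: "card kept = n - 2" using card_kept \<open>card E = 2\<close> by simp
  have "card ?A \<le> (2 * 2) choose 2"
    using ck n3 by (intro card_admissible_le[OF ham_new]) (auto simp: new_cycle_eq)
  then have A6: "card ?A \<le> 6" by (simp add: choose_two)
  have "card ?A > 0" using xA by (auto simp: card_gt_0_iff)
  have nB: "\<not> hamiltonian_cycle n kept" using card_hamiltonian_cycle[of n kept] ck n3 by auto
  let ?p = "\<lambda>e. measure_pmf.prob (egen n (Pi_of n H) 1 (insert e kept)) {new_cycle}"
  have "1 = ?p x" using prob_egen_last[OF ham, of y "insert x kept"] nk ham_new finite_kept by simp
  also have "\<dots> \<le> (\<Sum>e\<in>?A. ?p e)" using xA by (intro member_le_sum) auto
  finally have "1 / real (card ?A) \<le> (\<Sum>e\<in>?A. ?p e) / real (card ?A)"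
    by (intro divide_right_mono) auto
  also have "\<dots> = ((\<Sum>e\<in>?A \<inter> H. ?p e) + zeta n * (\<Sum>e\<in>?A - H. ?p e))
      / (real (card (?A \<inter> H)) + zeta n * real (card (?A - H)))"
    unfolding AH using zeta_pos[OF n3] by simp
  also have "\<dots> = measure_pmf.prob (egen n (Pi_of n H) (Suc 1) kept) {new_cycle}"
    using xA by (intro prob_egen_Suc[OF ham nB refl, symmetric]) blast
  finally have "1 / real (card ?A) \<le> measure_pmf.prob (egen n (Pi_of n H) (card E) kept) {new_cycle}"
    using \<open>card E = 2\<close> by (simp add: numeral_2_eq_2)
  moreover have "1 / 6 \<le> 1 / real (card ?A)" using A6 \<open>card ?A > 0\<close> by (intro divide_left_mono) auto
  ultimately show ?thesis by linarith
qed

lemma prob_egen_new_cycle: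
  assumes "f \<in> B" "B \<subseteq> kept" "card B = n - r" "r \<le> n"
  shows "measure_pmf.prob (egen n (Pi_of n H) r B) {new_cycle} \<ge> kappa n r * (1 / 6 * value_of B)"
proof (rule prob_egen_submartingale[where I="\<lambda>B. f \<in> B \<and> B \<subseteq> kept" and ?r0.0="card E", OF ham])
  show "\<exists>H0. hamiltonian_cycle n H0 \<and> B \<subseteq> H0" if "f \<in> B \<and> B \<subseteq> kept" for B
    using that ham_new new_cycle_eq by auto
  show "value_of B \<ge> 0" for B by (rule value_of_nonneg)
  show "1 / 6 * value_of B \<le> measure_pmf.prob (egen n (Pi_of n H) (card E) B) {new_cycle}"
    if B: "f \<in> B \<and> B \<subseteq> kept" "card B = n - card E" for B
  proof -
    have "B = kept" using B card_kept finite_kept by (metis card_subset_eq)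
    then show ?thesis using prob_egen_kept value_of_le_1[of kept] by simp
  qed
  show "\<exists>S \<subseteq> {e. admissible n B e} \<inter> H. (\<forall>e\<in>S. f \<in> insert e B \<and> insert e B \<subseteq> kept) \<and>
      (\<Sum>e\<in>S. value_of (insert e B)) \<ge> real (card ({e. admissible n B e} \<inter> H)) * value_of B \<and> real (card S) \<ge> real r / 3"
    if B: "f \<in> B \<and> B \<subseteq> kept" "card B = n - r" "card E < r" "r \<le> n" for B r
  proof (intro exI[of _ "kept - B"] conjI)
    have "finite B" using B finite_kept finite_subset by blast
    then have "card (kept - B) = card kept - card B" using B by (simp add: card_Diff_subset)
    then have "card (kept - B) = r - card E" using B card_kept by simp
    then have "real (card (kept - B)) = real r - real (card E)" using B by simp
    \<comment> \<open>The fraction 1/3 comes from here: \<open>r - card E\<close> is smallest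
      relative to \<open>r\<close> when \<open>card E = 2\<close> and \<open>r = 3\<close>.\<close>
    moreover have "real r \<ge> real (card E) + 1" "real (card E) \<le> 2" "card E = 1 \<or> card E = 2"
      using B card_kept alt by auto
    ultimately show "real r / 3 \<le> real (card (kept - B))" by auto
  qed (use B value_of_step kept_diff_subset_admissible in auto)
  have "card B \<le> card kept" using assms finite_kept by (intro card_mono) auto
  then show "card E \<le> r" using card_kept assms n3 by linarith
qed (use assms in auto)

end

text \<open>\<open>X\<close> is the set of removed edges: a part of \<open>H\<close> avoiding it
  still fits into the improved tour after \<open>f\<close> is added. The constant 24 is 6 for the
  final phase times 4 from \<open>value_of\<close>.\<close>

lemma prob_egen_first_new:
  assumes H: "hamiltonian_cycle n H" and f: "f \<in> unit_cycle n - H"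
  obtains X where "X \<subseteq> H" "X \<noteq> {}" "card X \<le> 3"
    "\<And>B. B \<subseteq> H \<Longrightarrow> B \<inter> X = {} \<Longrightarrow> admissible n B f"
    "\<And>B r. B \<subseteq> H \<Longrightarrow> B \<inter> X = {} \<Longrightarrow> card (insert f B) = n - r \<Longrightarrow> r \<le> n \<Longrightarrow>
      measure_pmf.prob (egen n (Pi_of n H) r (insert f B)) {x. level n x < level n H} \<ge> kappa n n / (24 * real n)"
proof -
  from improvement_exists[OF H f] obtain a b e1 g1 e2 g2 E3 Q E where
    ex: "exchange n H f a b e1 g1 e2 g2 E3 Q E" and
    lt: "level n (exchange.new_cycle H f e1 e2 E3 E) < level n H" by metis
  interpret exchange n H f a b e1 g1 e2 g2 E3 Q E by (fact ex)
  let ?X = "{e1, e2} \<union> E3"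
  have kept_subset: "kept \<subseteq> new_cycle" unfolding new_cycle_eq by blast
  show thesis
  proof (rule that[of ?X])
    show "?X \<subseteq> H" "?X \<noteq> {}" using in_H by auto
    show "card ?X \<le> 3" using card_removed card_kept(2) by simp
  next
    fix B assume B: "B \<subseteq> H" "B \<inter> ?X = {}"
    then have "insert f B \<subseteq> kept" unfolding kept_def by blast
    then show "admissible n B f"
      using B(1) f kept_subset by (intro admissible_if_subset_hamiltonian[OF ham_new]) blast+
  next
    fix B r assume B: "B \<subseteq> H" "B \<inter> ?X = {}" "card (insert f B) = n - r" "r \<le> n"
    then have sub: "insert f B \<subseteq> kept" unfolding kept_def by blast
    have "kappa n n / (24 * real n) = kappa n n * (1 / 6 * (1 / (4 * real n)))" by simp
    also have "\<dots> \<le> kappa n r * (1 / 6 * value_of (insert f B))"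
      using kappa_antimono[OF n3 B(4)] value_of_ge[OF sub] kappa_bounds[OF n3, of r]
      by (intro mult_mono mult_left_mono) auto
    also have "\<dots> \<le> measure_pmf.prob (egen n (Pi_of n H) r (insert f B)) {new_cycle}"
      using sub B by (intro prob_egen_new_cycle) auto
    also have "\<dots> \<le> measure_pmf.prob (egen n (Pi_of n H) r (insert f B)) {x. level n x < level n H}"
      using lt by (intro measure_pmf.finite_measure_mono) auto
    finally show "kappa n n / (24 * real n)
      \<le> measure_pmf.prob (egen n (Pi_of n H) r (insert f B)) {x. level n x < level n H}" .
  qed
qed

text \<open>As long as no edge of \<open>X f\<close> is chosen, the next choice from \<open>insert f (X f)\<close> is \<open>f\<close> with probability
  about \<open>zeta n / card (X f)\<close>, whatever happens elsewhere. The events for different \<open>f\<close>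
  are disjoint, since \<open>f\<close> is the first edge outside \<open>H\<close>.\<close>

lemma prob_egen_improve:
  assumes H: "hamiltonian_cycle n H"
    and X: "\<And>f. f \<in> unit_cycle n - H \<Longrightarrow> X f \<subseteq> H \<and> X f \<noteq> {} \<and> card (X f) \<le> 3"
    and adm: "\<And>f B. f \<in> unit_cycle n - H \<Longrightarrow> B \<subseteq> H \<Longrightarrow> B \<inter> X f = {} \<Longrightarrow> admissible n B f"
    and after: "\<And>f B r. f \<in> unit_cycle n - H \<Longrightarrow> B \<subseteq> H \<Longrightarrow> B \<inter> X f = {} \<Longrightarrow> card (insert f B) = n - r \<Longrightarrow> r \<le> n \<Longrightarrow>
      measure_pmf.prob (egen n (Pi_of n H) r (insert f B)) G \<ge> v"
    and v: "v \<ge> 0"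
  shows "B \<subseteq> H \<Longrightarrow> card B = n - r \<Longrightarrow> r \<le> n \<Longrightarrow>
    measure_pmf.prob (egen n (Pi_of n H) r B) G
      \<ge> kappa n r * (zeta n * v / 3 * real (card {f \<in> unit_cycle n - H. B \<inter> X f = {}}))"
proof (induction r arbitrary: B)
  case 0
  then have "B = H" using card_hamiltonian_cycle[OF H] finite_hamiltonian_cycle[OF H] by (simp add: card_subset_eq)
  then have "{f \<in> unit_cycle n - H. B \<inter> X f = {}} = {}" using X by blast
  then show ?case by (simp only: card.empty) simp
next
  case (Suc k)
  have n3: "n \<ge> 3" using H unfolding hamiltonian_cycle_def by auto
  let ?F = "\<lambda>B. {f \<in> unit_cycle n - H. B \<inter> X f = {}}" and ?u = "zeta n * v / 3"
  let ?A = "{e. admissible n B e}" and ?p = "\<lambda>e. measure_pmf.prob (egen n (Pi_of n H) k (insert e B)) G"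
  have finF: "finite (?F B')" for B' by (simp add: unit_cycle_def)
  have finH: "finite H" "card H = n" using finite_hamiltonian_cycle[OF H] card_hamiltonian_cycle[OF H] by auto
  have finB: "finite B" using Suc.prems finH finite_subset by blast
  have AH: "?A \<inter> H = H - B"
    using Suc.prems admissible_if_subset_hamiltonian[OF H] by (auto simp: admissible_def)
  have cHB: "card (H - B) = Suc k" using Suc.prems finH finB by (simp add: card_Diff_subset)
  have cins: "card (insert e B) = n - k" if "e \<notin> B" for e using that finB Suc.prems by simp
  have u: "?u \<ge> 0" using zeta_pos[OF n3] v by simp
  note kb = kappa_bounds[OF n3, of k]
  have "(\<Sum>e\<in>H - B. real (card (?F (insert e B)))) = (\<Sum>e\<in>H - B. \<Sum>f\<in>?F B. if e \<in> X f then 0 else 1)"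
  proof (intro sum.cong refl)
    fix e assume "e \<in> H - B"
    have "?F (insert e B) = {f \<in> ?F B. e \<notin> X f}" by auto
    then show "real (card (?F (insert e B))) = (\<Sum>f\<in>?F B. if e \<in> X f then 0 else 1)"
      using finF[of B] by (simp add: sum.If_cases Int_def)
  qed
  also have "\<dots> = (\<Sum>f\<in>?F B. \<Sum>e\<in>H - B. if e \<in> X f then 0 else 1)" by (rule sum.swap)
  \<comment> \<open>Each remaining \<open>f\<close> survives every choice from \<open>H - B\<close>
    except at most three, those in \<open>X f\<close>.\<close>
  also have "\<dots> \<ge> (\<Sum>f\<in>?F B. real (Suc k) - 3)"
  proof (intro sum_mono)
    fix f assume f: "f \<in> ?F B"
    have "(\<Sum>e\<in>H - B. if e \<in> X f then 0 else 1 :: real) = real (card ((H - B) - X f))"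
      using finH by (simp add: sum.If_cases Int_def set_diff_eq)
    moreover have "card (H - B) \<le> card ((H - B) - X f) + card (X f)"
      using finH f X[of f] by (intro order_trans[OF card_mono card_Un_le]) (auto intro: finite_subset)
    moreover have "card (X f) \<le> 3" using X f by blast
    ultimately show "real (Suc k) - 3 \<le> (\<Sum>e\<in>H - B. if e \<in> X f then 0 else 1)" using cHB by linarith
  qed
  finally have cnt: "(\<Sum>e\<in>H - B. real (card (?F (insert e B)))) \<ge> real (card (?F B)) * (real (Suc k) - 3)" by simp
  have "kappa n k * ?u * (real (card (?F B)) * (real (Suc k) - 3))
      \<le> kappa n k * ?u * (\<Sum>e\<in>H - B. real (card (?F (insert e B))))"
    using cnt kb u by (intro mult_left_mono) auto
  also have "\<dots> = (\<Sum>e\<in>H - B. kappa n k * (?u * real (card (?F (insert e B)))))"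
    by (simp add: sum_distrib_left mult.assoc)
  also have "\<dots> \<le> (\<Sum>e\<in>H - B. ?p e)"
    using Suc.prems cins by (intro sum_mono Suc.IH) auto
  finally have part1: "kappa n k * ?u * (real (card (?F B)) * (real (Suc k) - 3)) \<le> (\<Sum>e\<in>?A \<inter> H. ?p e)"
    unfolding AH .
  \<comment> \<open>Choosing \<open>f\<close> itself now contributes
    \<open>zeta n * v = 3 * ?u\<close>, exactly the three units lost to \<open>X f\<close>; hence
    the division by 3 in \<open>?u\<close>.\<close>
  have "kappa n k * (3 * ?u * real (card (?F B))) \<le> 1 * (3 * ?u * real (card (?F B)))"
    using kb u by (intro mult_right_mono) auto
  also have "\<dots> = zeta n * (\<Sum>f\<in>?F B. v)" by simp
  also have "\<dots> \<le> zeta n * (\<Sum>f\<in>?F B. ?p f)"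
  proof (intro mult_left_mono sum_mono)
    fix f assume "f \<in> ?F B"
    then have f: "f \<in> unit_cycle n - H" "B \<inter> X f = {}" by auto
    show "v \<le> ?p f" using f(1) Suc.prems by (intro after[OF f(1) _ f(2)] cins) auto
  qed (use zeta_pos[OF n3] in simp)
  also have "\<dots> \<le> zeta n * (\<Sum>f\<in>?A - H. ?p f)"
    using zeta_pos[OF n3] adm Suc.prems(1) by (intro mult_left_mono sum_mono2) auto
  finally have part2: "kappa n k * (3 * ?u * real (card (?F B))) \<le> zeta n * (\<Sum>f\<in>?A - H. ?p f)" .
  show ?case
  proof (rule prob_egen_step[OF H H Suc.prems refl])
    show "real (Suc k) / 3 \<le> real (card (?A \<inter> H))" unfolding AH cHB by simp
    show "0 \<le> ?u * real (card (?F B))" using u by simp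
    have "real (card (?A \<inter> H)) * (kappa n k * (?u * real (card (?F B))))
        = kappa n k * ?u * (real (card (?F B)) * (real (Suc k) - 3)) + kappa n k * (3 * ?u * real (card (?F B)))"
      unfolding AH cHB by (simp add: algebra_simps)
    also have "\<dots> \<le> (\<Sum>e\<in>?A \<inter> H. ?p e) + zeta n * (\<Sum>f\<in>?A - H. ?p f)"
      using part1 part2 by (rule add_mono)
    finally show "real (card (?A \<inter> H)) * (kappa n k * (?u * real (card (?F B))))
        \<le> (\<Sum>e\<in>?A \<inter> H. ?p e) + zeta n * (\<Sum>f\<in>?A - H. ?p f)" .
  qed
qed

lemma prob_edge_gen_improve:
  assumes H: "hamiltonian_cycle n H"
  shows "measure_pmf.prob (edge_gen n (Pi_of n H)) {x. level n x < level n H}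
    \<ge> exp (- 36) / 72 * real (level n H) / real n ^ 3"
proof -
  have n3: "n \<ge> 3" using H unfolding hamiltonian_cycle_def by auto
  let ?G = "{x. level n x < level n H}"
  have "\<forall>f\<in>unit_cycle n - H. \<exists>X. X \<subseteq> H \<and> X \<noteq> {} \<and> card X \<le> 3 \<and>
    (\<forall>B. B \<subseteq> H \<longrightarrow> B \<inter> X = {} \<longrightarrow> admissible n B f) \<and>
    (\<forall>B r. B \<subseteq> H \<longrightarrow> B \<inter> X = {} \<longrightarrow> card (insert f B) = n - r \<longrightarrow> r \<le> n \<longrightarrow>
      kappa n n / (24 * real n) \<le> measure_pmf.prob (egen n (Pi_of n H) r (insert f B)) ?G)"
    using prob_egen_first_new[OF H] by metis
  then obtain X where X: "\<forall>f\<in>unit_cycle n - H. X f \<subseteq> H \<and> X f \<noteq> {} \<and> card (X f) \<le> 3 \<and>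
    (\<forall>B. B \<subseteq> H \<longrightarrow> B \<inter> X f = {} \<longrightarrow> admissible n B f) \<and>
    (\<forall>B r. B \<subseteq> H \<longrightarrow> B \<inter> X f = {} \<longrightarrow> card (insert f B) = n - r \<longrightarrow> r \<le> n \<longrightarrow>
      kappa n n / (24 * real n) \<le> measure_pmf.prob (egen n (Pi_of n H) r (insert f B)) ?G)"
    by (rule bchoice[THEN exE])
  have v: "kappa n n / (24 * real n) \<ge> 0" using kappa_bounds[OF n3, of n] by simp
  have "kappa n n * (zeta n * (kappa n n / (24 * real n)) / 3 * real (card {f \<in> unit_cycle n - H. {} \<inter> X f = {}}))
    \<le> measure_pmf.prob (egen n (Pi_of n H) n {}) ?G"
    by (rule prob_egen_improve[where X = X, OF H _ _ _ v]) (use X in auto)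
  then have "kappa n n * (zeta n * (kappa n n / (24 * real n)) / 3 * real (level n H))
    \<le> measure_pmf.prob (edge_gen n (Pi_of n H)) ?G"
    using card_unit_minus[OF H] by (simp add: edge_gen_def set_diff_eq)
  moreover have "exp (- 36) / 72 * real (level n H) / real n ^ 3
     \<le> kappa n n * (zeta n * (kappa n n / (24 * real n)) / 3 * real (level n H))"
  proof -
    \<comment> \<open>The factor \<open>exp (- 18)\<close> enters twice, for the insertions before
      and after \<open>f\<close>; 72 is 24 times the 3 from \<open>X f\<close>.\<close>
    have "exp (- 36) / 72 * real (level n H) / real n ^ 3
        = exp (- 18) * ((1 / real n ^ 2) * (exp (- 18) / (24 * real n)) / 3 * real (level n H))"
      using exp_add[of "- 18" "- 18 :: real"] by (simp add: power2_eq_square power3_eq_cube mult_ac)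
    also have "\<dots> \<le> kappa n n * (zeta n * (kappa n n / (24 * real n)) / 3 * real (level n H))"
      using kappa_n_ge[OF n3] kappa_bounds[OF n3, of n] zeta_ge[OF n3] zeta_pos[OF n3]
      by (intro mult_mono divide_right_mono mult_nonneg_nonneg divide_nonneg_nonneg) auto
    finally show ?thesis .
  qed
  ultimately show ?thesis by linarith
qed

section \<open>Asymptotics\<close>

lemma Pi0_pos: "n \<ge> 3 \<Longrightarrow> i \<noteq> j \<Longrightarrow> Pi0 n i j > 0"
  by (simp add: Pi0_def)

text \<open>\<open>N n\<close> is at least a multiple of \<open>n powr \<epsilon>\<close>, so half
  of the exponent outgrows any polynomial. The factor 2 stands for two error terms, the rises of the
  level and the levels that use up their budget.\<close>

lemma exp_absorbs_polynomial:
  fixes N :: "nat \<Rightarrow> nat"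
  assumes "0 < \<epsilon>" and N: "(\<lambda>n. real (N n)) \<in> \<Omega>(\<lambda>n. real n powr \<epsilon>)" and m: "m > 0"
  shows "\<forall>\<^sub>F n in at_top. N n > 0 \<and> 2 * real n ^ 6 * exp (- m * real (N n)) \<le> exp (- (m / 2) * real (N n))"
proof -
  obtain C where C: "C > 0" "\<forall>\<^sub>F n in at_top. norm (real (N n)) \<ge> C * norm (real n powr \<epsilon>)"
    using N by (rule landau_omega.bigE)
  define c where "c = m / 2 * C"
  have c: "c > 0" using m C(1) by (simp add: c_def)
  have "\<forall>\<^sub>F n in at_top. 2 * real n ^ 6 \<le> exp (c * real n powr \<epsilon>)"
    using c assms(1) by real_asymp
  with C(2) eventually_gt_at_top[of "0 :: nat"] show ?thesis
  proof eventually_elim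
    case (elim n)
    have "C * real n powr \<epsilon> > 0" using C(1) elim(2) by simp
    then have "real (N n) > 0" using elim(1) by simp
    have "c * real n powr \<epsilon> \<le> m / 2 * real (N n)"
      using elim(1) m by (simp add: c_def)
    then have "exp (c * real n powr \<epsilon>) \<le> exp (m / 2 * real (N n))" by simp
    with elim(3) have "2 * real n ^ 6 \<le> exp (m / 2 * real (N n))" by (rule order_trans)
    then have "2 * real n ^ 6 * exp (- m * real (N n)) \<le> exp (m / 2 * real (N n)) * exp (- m * real (N n))"
      by (intro mult_right_mono) auto
    also have "\<dots> = exp (- (m / 2) * real (N n))" by (simp flip: exp_add)
    finally show ?case using \<open>real (N n) > 0\<close> by simp
  qed
qed

text \<open>\<open>harm n - ln n\<close> is decreasing and equals 1 at \<open>n = 1\<close>.\<close>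

lemma harm_le_ln: "n > 0 \<Longrightarrow> harm n \<le> ln (real n) + 1"
proof -
  assume "n > 0"
  then obtain m where m: "n = Suc m" by (cases n) auto
  show ?thesis using decseqD[OF decseq_harm_diff_ln, of 0 m] by (simp add: m harm_Suc[of 0] harm_expand)
qed

text \<open>Each of the two error terms consists of at most \<open>n ^ 6\<close> summands bounded by
  \<open>exp (- min p c * N n)\<close>; half of this rate absorbs their number.\<close>

lemma found_prob_eventually:
  fixes N T :: "nat \<Rightarrow> nat" and gen
  assumes "0 < \<epsilon>" and N: "(\<lambda>n. real (N n)) \<in> \<Omega>(\<lambda>n. real n powr \<epsilon>)" and sel: "valid_selector sel"
    and gen: "\<And>n P x. (\<And>i j. i \<noteq> j \<Longrightarrow> P i j > 0) \<Longrightarrow> n \<ge> 3 \<Longrightarrow> x \<in> set_pmf (gen n P) \<Longrightarrow> hamiltonian_cycle n x"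
    and p: "p > 0" "\<And>n H. hamiltonian_cycle n H \<Longrightarrow> measure_pmf.prob (gen n (Pi_of n H)) {H} \<ge> p"
    and q: "\<And>n H. hamiltonian_cycle n H \<Longrightarrow> level n H > 0 \<Longrightarrow>
        measure_pmf.prob (gen n (Pi_of n H)) {x. level n x < level n H} \<ge> q n (level n H)"
    and c: "c > 0" "\<forall>\<^sub>F n in at_top. \<forall>j\<in>{1..n}. q n j * real (b n j) \<ge> c"
    and T: "\<forall>\<^sub>F n in at_top. (\<Sum>j\<in>{1..n}. b n j) < T n" "\<forall>\<^sub>F n in at_top. T n \<le> n ^ 6"
  shows "\<exists>c>0. \<forall>\<^sub>F n in at_top. found_prob gen sel n (N n) (T n) \<ge> 1 - exp (- c * real (N n))"
proof (intro exI[of _ "min p c / 2"] conjI)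
  let ?m = "min p c"
  show "?m / 2 > 0" using p c by simp
  then have "?m > 0" by simp
  from exp_absorbs_polynomial[OF assms(1) N this] c(2) T eventually_ge_at_top[of 3]
  show "\<forall>\<^sub>F n in at_top. found_prob gen sel n (N n) (T n) \<ge> 1 - exp (- (?m / 2) * real (N n))"
  proof eventually_elim
    case (elim n)
    let ?x = "exp (- ?m * real (N n))"
    have "real (T n) * exp (- p * real (N n)) \<le> real n ^ 6 * ?x"
    proof (intro mult_mono)
      show "real (T n) \<le> real n ^ 6" using elim(4) by (metis of_nat_le_iff of_nat_power)
    qed (auto intro!: mult_right_mono)
    moreover have "(\<Sum>j\<in>{1..n}. exp (- q n j * real (N n) * real (b n j))) \<le> (\<Sum>j\<in>{1..n}. ?x)"
    proof (intro sum_mono)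
      fix j assume "j \<in> {1..n}"
      then have "?m \<le> q n j * real (b n j)" using elim(2) by fastforce
      then have "?m * real (N n) \<le> q n j * real (b n j) * real (N n)" by (intro mult_right_mono) auto
      then show "exp (- q n j * real (N n) * real (b n j)) \<le> ?x" by (simp add: mult_ac)
    qed
    moreover have "(\<Sum>j\<in>{1..n}. ?x) \<le> real n ^ 6 * ?x"
      using elim(5) self_le_power[of "real n" 6] by (simp add: mult_right_mono)
    moreover have "found_prob gen sel n (N n) (T n)
      \<ge> 1 - (real (T n) * exp (- p * real (N n)) + (\<Sum>j\<in>{1..n}. exp (- q n j * real (N n) * real (b n j))))"
      using elim gen Pi_of_pos Pi0_pos by (intro found_prob_ge[OF sel] p q) blast+
    ultimately show ?case using elim(1) by linarith
  qed
qed

theorem theorem2: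
  fixes N :: "nat \<Rightarrow> nat" and \<epsilon> :: real
    and sel :: "nat \<Rightarrow> nat set set list \<Rightarrow> nat set set"
  assumes "0 < \<epsilon>" and "\<epsilon> < 1"
    and "(\<lambda>n. real (N n)) \<in> \<Omega>(\<lambda>n. real n powr \<epsilon>)"
    and "valid_selector sel"
  shows "(\<exists>c>0. \<forall>\<^sub>F n in at_top.
            found_prob vertex_gen sel n (N n) (n ^ 6) \<ge> 1 - exp (- c * real (N n)))
       \<and> (\<exists>c>0. \<forall>\<^sub>F n in at_top.
            found_prob edge_gen sel n (N n) (nat \<lfloor>real n ^ 3 * ln (real n)\<rfloor>)
              \<ge> 1 - exp (- c * real (N n)))"
proof
  show "\<exists>c>0. \<forall>\<^sub>F n in at_top. found_prob vertex_gen sel n (N n) (n ^ 6) \<ge> 1 - exp (- c * real (N n))"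
  \<comment> \<open>Subtracting 1 in the budget \<open>n ^ 5 - 1\<close> makes the total strictly
    smaller than \<open>n ^ 6\<close>; it still exceeds half of \<open>n ^ 5\<close>, which turns 32
    into 64.\<close>
  proof (rule found_prob_eventually[OF assms(1,3,4), where p = "exp (- 1) / 2" and c = "exp (- 1) / 64"
        and q = "\<lambda>n j. exp (- 1) / 32 / real n ^ 5" and b = "\<lambda>n j. n ^ 5 - 1"])
    show "\<forall>\<^sub>F n in at_top. \<forall>j\<in>{1..n}. exp (- 1) / 64 \<le> exp (- 1) / 32 / real n ^ 5 * real (n ^ 5 - 1)"
      using eventually_ge_at_top[of 2]
    proof eventually_elim
      case (elim n)
      have "(2::real) \<le> real n ^ 5" using elim self_le_power[of "real n" 5] by linarith
      moreover have "real (n ^ 5 - 1) = real n ^ 5 - 1" using elim by (simp add: of_nat_diff)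
      ultimately show ?case by (simp add: field_simps)
    qed
    show "\<forall>\<^sub>F n in at_top. (\<Sum>j\<in>{1..n}. n ^ 5 - 1 :: nat) < n ^ 6"
      using eventually_gt_at_top[of "0 :: nat"]
    proof eventually_elim
      case (elim n)
      then have "n * (n ^ 5 - 1) < n * n ^ 5" by simp
      then show ?case by (simp add: eval_nat_numeral)
    qed
  qed ((rule prob_vertex_gen_same prob_vertex_gen_improve; assumption) | (rule vertex_gen_hamiltonian; blast) | simp)+
  show "\<exists>c>0. \<forall>\<^sub>F n in at_top. found_prob edge_gen sel n (N n) (nat \<lfloor>real n ^ 3 * ln (real n)\<rfloor>)
              \<ge> 1 - exp (- c * real (N n))"
  \<comment> \<open>Halving the budget makes the harmonic sum about \<open>n ^ 3 * ln n / 2\<close>,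
    so that lower-order terms fit below \<open>n ^ 3 * ln n\<close>. The constant is
    \<open>288 = 4 * 72\<close>, one factor 2 for the halving and one for rounding.\<close>
  proof (rule found_prob_eventually[OF assms(1,3,4), where p = "exp (- 18)" and c = "exp (- 36) / 288"
        and q = "\<lambda>n j. exp (- 36) / 72 * real j / real n ^ 3" and b = "\<lambda>n j. n ^ 3 div (2 * j)"])
    show "\<forall>\<^sub>F n in at_top. \<forall>j\<in>{1..n}. exp (- 36) / 288 \<le> exp (- 36) / 72 * real j / real n ^ 3 * real (n ^ 3 div (2 * j))"
      using eventually_ge_at_top[of 2]
    proof (eventually_elim, intro ballI)
      fix n j :: nat assume n: "n \<ge> 2" and j: "j \<in> {1..n}"
      \<comment> \<open>Rounding down loses less than \<open>d\<close>, hence at most half of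
        \<open>x\<close> once \<open>2 * d\<close> fits into \<open>x\<close>.\<close>
      have half: "x \<le> 2 * (d * (x div d))" if "d > 0" "2 * d \<le> x" for x d :: nat
      proof -
        have "x < d + d * (x div d)" using dividend_less_times_div[OF that(1), of x] by simp
        then show ?thesis using that(2) by linarith
      qed
      have "2 * 2 * j \<le> n * n * n" using n j by (intro mult_mono) auto
      then have "2 * (2 * j) \<le> n ^ 3" by (simp add: power3_eq_cube)
      then have "n ^ 3 \<le> 2 * (2 * j * (n ^ 3 div (2 * j)))" using j by (intro half) auto
      then have "n ^ 3 \<le> 4 * j * (n ^ 3 div (2 * j))" by simp
      then have "real (n ^ 3) \<le> real (4 * j * (n ^ 3 div (2 * j)))" by (simp only: of_nat_le_iff)
      then have "real n ^ 3 \<le> 4 * real j * real (n ^ 3 div (2 * j))"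
        unfolding of_nat_mult of_nat_power of_nat_numeral .
      then have "exp (- 36) / 288 * (real n ^ 3 / real n ^ 3)
          \<le> exp (- 36) / 288 * (4 * real j * real (n ^ 3 div (2 * j)) / real n ^ 3)"
        by (intro mult_left_mono divide_right_mono) auto
      then show "exp (- 36) / 288 \<le> exp (- 36) / 72 * real j / real n ^ 3 * real (n ^ 3 div (2 * j))"
        using n by simp
    qed
    \<comment> \<open>The summand 2 leaves room for the floor and for the strict inequality.\<close>
    have *: "\<forall>\<^sub>F n in at_top. real n ^ 3 / 2 * (ln (real n) + 1) + 2 \<le> real n ^ 3 * ln (real n)"
      by real_asymp
    show "\<forall>\<^sub>F n in at_top. (\<Sum>j\<in>{1..n}. n ^ 3 div (2 * j)) < nat \<lfloor>real n ^ 3 * ln (real n)\<rfloor>"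
      using * eventually_gt_at_top[of "0 :: nat"]
    proof eventually_elim
      case (elim n)
      have "real (\<Sum>j\<in>{1..n}. n ^ 3 div (2 * j)) \<le> (\<Sum>j\<in>{1..n}. real n ^ 3 / 2 * inverse (real j))"
        unfolding of_nat_sum
      proof (intro sum_mono)
        fix j
        have "real (n ^ 3 div (2 * j)) \<le> real (n ^ 3) / real (2 * j)" by (rule of_nat_div_le_of_nat)
        also have "\<dots> = real n ^ 3 / 2 * inverse (real j)" by (simp add: inverse_eq_divide)
        finally show "real (n ^ 3 div (2 * j)) \<le> real n ^ 3 / 2 * inverse (real j)" .
      qed
      also have "\<dots> = real n ^ 3 / 2 * harm n" by (simp add: harm_def sum_distrib_left)
      also have "\<dots> \<le> real n ^ 3 / 2 * (ln (real n) + 1)"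
        using elim(2) harm_le_ln[of n] by (intro mult_left_mono) auto
      finally have "real (\<Sum>j\<in>{1..n}. n ^ 3 div (2 * j)) \<le> real n ^ 3 / 2 * (ln (real n) + 1)" .
      then have fits: "real k < real n ^ 3 * ln (real n) - 1" if "k = (\<Sum>j\<in>{1..n}. n ^ 3 div (2 * j))" for k
        using elim(1) that by linarith
      have less_floor: "k < nat \<lfloor>x\<rfloor>" if "real k < x - 1" for k :: nat and x :: real
        using that by linarith
      show ?case by (rule less_floor[OF fits[OF refl]])
    qed
    show "\<forall>\<^sub>F n in at_top. nat \<lfloor>real n ^ 3 * ln (real n)\<rfloor> \<le> n ^ 6"
    proof -
      have "\<forall>\<^sub>F n in at_top. real n ^ 3 * ln (real n) \<le> real n ^ 6" by real_asymp
      then show ?thesis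
      proof eventually_elim
        case (elim n)
        then have "\<lfloor>real n ^ 3 * ln (real n)\<rfloor> \<le> int (n ^ 6)" by (simp add: floor_le_iff)
        then show ?case by linarith
      qed
    qed
  qed ((rule prob_edge_gen_same prob_edge_gen_improve; assumption) | (rule edge_gen_hamiltonian; blast) | simp)+
qed

end
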